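(* \textsc{Even Cycle Transversal} is NP-complete on line graphs.
   Context: \textsc{Even Cycle Transversal}: given a graph $G$ and an integer $k$, decide whether there is a set of at most $k$ vertices meeting every (not necessarily induced) cycle of even length in $G$. The line graph $L(G)$ of a graph $G=(V,E)$ has vertex set $E$, with two distinct edges adjacent when they share an endpoint in $G$. *)

theory Defs
  imports Complex_Main "HOL-Computational_Algebra.Polynomial"
begin

section \<open>Polynomial time and NP\<close>

text \<open>
  Deterministic Turing machines with a fixed number of two-way infinite tapes.  States and tape
  symbols are initial segments of the natural numbers.  State 0 is the initial state; symbol 0 is
  the blank, and symbols 1 and 2 represent the input bits \<^term>\<open>False\<close> and \<^term>\<open>True\<close>.
\<close>

datatype direction = Lft | Stay | Rgt

record machine =
  num_tapes :: nat
  num_symbols :: nat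
  num_states :: nat
  accept_state :: nat
  reject_state :: nat
  trans :: "nat \<Rightarrow> nat list \<Rightarrow> nat \<times> (nat \<times> direction) list"

definition turing_machine :: "machine \<Rightarrow> bool" where
  "turing_machine M \<longleftrightarrow>
     num_tapes M \<ge> 1 \<and> num_symbols M \<ge> 3 \<and>
     0 < num_states M \<and> accept_state M < num_states M \<and> reject_state M < num_states M \<and>
     accept_state M \<noteq> reject_state M \<and>
     (\<forall>q < num_states M. \<forall>rs. length rs = num_tapes M \<and> set rs \<subseteq> {..<num_symbols M} \<longrightarrow>
        fst (trans M q rs) < num_states M \<and>
        length (snd (trans M q rs)) = num_tapes M \<and>
        fst ` set (snd (trans M q rs)) \<subseteq> {..<num_symbols M})"

text \<open>A tape is given by the contents of its cells and the position of its head.\<close>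

type_synonym tape = "(int \<Rightarrow> nat) \<times> int"

type_synonym config = "nat \<times> tape list"

fun read_tape :: "tape \<Rightarrow> nat" where
  "read_tape (f, h) = f h"

fun offset :: "direction \<Rightarrow> int" where
  "offset Lft = - 1"
| "offset Stay = 0"
| "offset Rgt = 1"

fun act :: "nat \<times> direction \<Rightarrow> tape \<Rightarrow> tape" where
  "act (s, d) (f, h) = (f(h := s), h + offset d)"

definition halted :: "machine \<Rightarrow> config \<Rightarrow> bool" where
  "halted M c \<longleftrightarrow> fst c = accept_state M \<or> fst c = reject_state M"

definition step :: "machine \<Rightarrow> config \<Rightarrow> config" where
  "step M c =
     (if halted M c then c
      else let (q, as) = trans M (fst c) (map read_tape (snd c))
           in (q, map2 act as (snd c)))"

definition word_cells :: "bool list \<Rightarrow> int \<Rightarrow> nat" where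
  "word_cells w i =
     (if 0 \<le> i \<and> i < int (length w) then (if w ! nat i then 2 else 1) else 0)"

text \<open>The i-th input word is written on the i-th tape; the remaining tapes are blank.\<close>

definition init_config :: "machine \<Rightarrow> bool list list \<Rightarrow> config" where
  "init_config M ws =
     (0, map (\<lambda>w. (word_cells w, 0)) (ws @ replicate (num_tapes M - length ws) []))"

definition run :: "machine \<Rightarrow> bool list list \<Rightarrow> nat \<Rightarrow> config" where
  "run M ws t = (step M ^^ t) (init_config M ws)"

definition accepts :: "machine \<Rightarrow> bool list list \<Rightarrow> bool" where
  "accepts M ws \<longleftrightarrow> (\<exists>t. fst (run M ws t) = accept_state M)"

text \<open>
  A machine taking \<open>m\<close> input words that halts on all inputs, within a number of steps polynomial
  in the total input length.
\<close>

definition poly_time_machine :: "nat \<Rightarrow> machine \<Rightarrow> bool" where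
  "poly_time_machine m M \<longleftrightarrow>
     turing_machine M \<and> m \<le> num_tapes M \<and>
     (\<exists>p :: nat poly. \<forall>ws. length ws = m \<longrightarrow>
        halted M (run M ws (poly p (sum_list (map length ws)))))"

text \<open>The value of the computed function is found on the last tape when the machine halts.\<close>

definition computes :: "machine \<Rightarrow> (bool list \<Rightarrow> bool list) \<Rightarrow> bool" where
  "computes M f \<longleftrightarrow>
     (\<forall>x. \<exists>t. halted M (run M [x] t) \<and> fst (last (snd (run M [x] t))) = word_cells (f x))"

definition poly_time_computable :: "(bool list \<Rightarrow> bool list) \<Rightarrow> bool" where
  "poly_time_computable f \<longleftrightarrow> (\<exists>M. poly_time_machine 1 M \<and> computes M f)"

text \<open>The verifier receives the instance on its first tape and the certificate on its second.\<close>

definition NP :: "bool list set set" where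
  "NP = {L. \<exists>M (p :: nat poly). poly_time_machine 2 M \<and>
           (\<forall>x. x \<in> L \<longleftrightarrow> (\<exists>u. length u \<le> poly p (length x) \<and> accepts M [x, u]))}"

definition poly_reducible :: "bool list set \<Rightarrow> bool list set \<Rightarrow> bool" where
  "poly_reducible A B \<longleftrightarrow> (\<exists>f. poly_time_computable f \<and> (\<forall>x. x \<in> A \<longleftrightarrow> f x \<in> B))"

definition NP_hard :: "bool list set \<Rightarrow> bool" where
  "NP_hard L \<longleftrightarrow> (\<forall>A \<in> NP. poly_reducible A L)"

definition NP_complete :: "bool list set \<Rightarrow> bool" where
  "NP_complete L \<longleftrightarrow> L \<in> NP \<and> NP_hard L"


section \<open>Graphs, line graphs and even cycles\<close>

record 'a ugraph =
  verts :: "'a set"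
  edges :: "'a set set"

text \<open>Finite simple undirected graphs.\<close>

definition simple_graph :: "'a ugraph \<Rightarrow> bool" where
  "simple_graph G \<longleftrightarrow> finite (verts G) \<and> (\<forall>e \<in> edges G. e \<subseteq> verts G \<and> card e = 2)"

definition line_graph :: "'a ugraph \<Rightarrow> 'a set ugraph" where
  "line_graph G =
     \<lparr> verts = edges G,
       edges = {{e, f} | e f. e \<in> edges G \<and> f \<in> edges G \<and> e \<noteq> f \<and> e \<inter> f \<noteq> {}} \<rparr>"

definition graph_iso :: "'a ugraph \<Rightarrow> 'b ugraph \<Rightarrow> bool" where
  "graph_iso G H \<longleftrightarrow>
     (\<exists>\<phi>. bij_betw \<phi> (verts G) (verts H) \<and>
          (\<forall>u \<in> verts G. \<forall>v \<in> verts G. {u, v} \<in> edges G \<longleftrightarrow> {\<phi> u, \<phi> v} \<in> edges H))"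

text \<open>
  Root graphs are finite, so it is no restriction that their vertices are natural numbers.
\<close>

definition is_line_graph :: "'a ugraph \<Rightarrow> bool" where
  "is_line_graph G \<longleftrightarrow> (\<exists>H :: nat ugraph. simple_graph H \<and> graph_iso G (line_graph H))"

definition is_cycle :: "'a ugraph \<Rightarrow> 'a list \<Rightarrow> bool" where
  "is_cycle G c \<longleftrightarrow>
     length c \<ge> 3 \<and> distinct c \<and> set c \<subseteq> verts G \<and>
     (\<forall>i < length c. {c ! i, c ! (Suc i mod length c)} \<in> edges G)"

definition even_cycle_transversal :: "'a ugraph \<Rightarrow> 'a set \<Rightarrow> bool" where
  "even_cycle_transversal G S \<longleftrightarrow>
     S \<subseteq> verts G \<and> (\<forall>c. is_cycle G c \<and> even (length c) \<longrightarrow> S \<inter> set c \<noteq> {})"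


section \<open>The decision problem\<close>

text \<open>Binary representation, least significant bit first.\<close>

fun binary :: "nat \<Rightarrow> bool list" where
  "binary k = (if k = 0 then [] else odd k # binary (k div 2))"

declare binary.simps [simp del]

text \<open>
  An instance whose graph has vertex set \<open>{0, \<dots>, n - 1}\<close> is encoded by \<open>n\<close> in unary, a delimiter,
  the rows of the adjacency matrix, and \<open>k\<close> in binary.
\<close>

definition encode_instance :: "nat ugraph \<Rightarrow> nat \<Rightarrow> bool list" where
  "encode_instance G k =
     (let n = card (verts G)
      in replicate n True @ [False] @
         concat (map (\<lambda>i. map (\<lambda>j. {i, j} \<in> edges G) [0..<n]) [0..<n]) @
         binary k)"

definition even_cycle_transversal_on :: "(nat ugraph \<Rightarrow> bool) \<Rightarrow> bool list set" where
  "even_cycle_transversal_on P =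
     {encode_instance G k | G k.
        simple_graph G \<and> verts G = {..<card (verts G)} \<and> P G \<and>
        (\<exists>S. even_cycle_transversal G S \<and> card S \<le> k)}"

end

theory Submission
  imports Defs "HOL-Library.Countable_Set"
begin

text \<open>
  Let \<open>F\<close> be a set of edges of a simple graph. Its line graph has no even cycle iff every component of
  \<open>F\<close> is an odd cycle or a tree of maximum degree 3: four edges at a vertex form a \<open>K\<^sub>4\<close> in the line graph,
  and a cycle with a further edge at it can be lengthened by one in the line graph. Hence \<open>F\<close> has at
  most as many edges as there are vertices, with equality iff \<open>F\<close> is a spanning union of disjoint odd
  cycles. A transversal of \<open>L(H)\<close> with \<open>|E(H)| - |V(H)|\<close> elements thus amounts to a 2-factor of \<open>H\<close> all
  of whose cycles are odd. Such 2-factors encode exact covers, which encode tilings of a torus with a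
  fixed set of tiles, which in turn encode the accepting runs of a nondeterministic machine.

  For membership in NP, the certificate consists of a root graph, a transversal, and labels
  of the remaining edges which prove locally that the components are as above.
\<close>

section \<open>Programs on Turing machines\<close>

text \<open>Finding a 2-factor is easy; the hardness lies in the parity of its cycles. In the
  gadgets, degrees leave only a few local choices, and parity rules out some of them.

  Polynomial time refers to concrete Turing machines, so the verifier and the reduction are both
  written as arithmetic expressions with bounded sums, which compile to machines running in
  polynomial time. This shapes the constructions. The output of the reduction is given as a function
  of the position in the word, so adjacency must be decidable by division with remainder and tables
  of constant size: the tiles depend on the machine only, the torus is one cyclic row of cells in
  which the neighbour above is a fixed shift away, and the input enters only through a test of which
  tile may lie on which cell.

  In the verifier, a statement about all even cycles becomes a condition on at most four edges at a
  time. The budget can be exponential in the word length while certificate entries are unary, so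
  only lower bounds no larger than the transversal are certified for it.\<close>

text \<open>Register \<open>r\<close> is the position of the head on tape \<open>r\<close>, which holds the read-only word \<open>W r\<close>;
  tests inspect the scanned symbol. A program runs on a stack of commands; only finitely many stacks are
  reachable, and these become the states of the machine.\<close>

datatype com = INC nat | DEC nat | OUT bool | SEQ com com
  | WHL nat "nat set" com | IFT nat "nat set" com com

type_synonym store = "(nat \<Rightarrow> nat) \<times> bool list"

text \<open>The 3 added at position 0 makes the left end visible in the scanned symbol, so a test
  for zero is a test on symbols: a register is nonzero iff its symbol is below 3.\<close>

definition symb :: "(nat \<Rightarrow> bool list) \<Rightarrow> (nat \<Rightarrow> nat) \<Rightarrow> nat \<Rightarrow> nat" where
  "symb W \<sigma> r = word_cells (W r) (int (\<sigma> r)) + (if \<sigma> r = 0 then 3 else 0)"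

fun nxt :: "(nat \<Rightarrow> nat) \<Rightarrow> com list \<Rightarrow> com list" where
  "nxt y [] = []"
| "nxt y (INC r # k) = k"
| "nxt y (DEC r # k) = k"
| "nxt y (OUT b # k) = k"
| "nxt y (SEQ a b # k) = a # b # k"
| "nxt y (WHL r A c # k) = (if y r \<in> A then c # WHL r A c # k else k)"
| "nxt y (IFT r A a b # k) = (if y r \<in> A then a # k else b # k)"

fun upd :: "com list \<Rightarrow> store \<Rightarrow> store" where
  "upd (INC r # k) (\<sigma>, w) = (\<sigma>(r := \<sigma> r + 1), w)"
| "upd (DEC r # k) (\<sigma>, w) = (\<sigma>(r := \<sigma> r - 1), w)"
| "upd (OUT b # k) (\<sigma>, w) = (\<sigma>, w @ [b])"
| "upd k s = s"

definition cstep :: "(nat \<Rightarrow> bool list) \<Rightarrow> com list \<times> store \<Rightarrow> com list \<times> store" where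
  "cstep W = (\<lambda>(k, s). (nxt (symb W (fst s)) k, upd k s))"

text \<open>Quantifying over the continuation \<open>k\<close> makes the judgement compositional;
  \<open>t\<close> is only an upper bound, so that times can be rounded up to polynomials.\<close>

definition runs :: "(nat \<Rightarrow> bool list) \<Rightarrow> com \<Rightarrow> nat \<Rightarrow> store \<Rightarrow> store \<Rightarrow> bool" where
  "runs W c t s s' \<longleftrightarrow> (\<forall>k. \<exists>t'\<le>t. (cstep W ^^ t') (c # k, s) = (k, s'))"

lemma runs_mono: "runs W c t s s' \<Longrightarrow> t \<le> t' \<Longrightarrow> runs W c t' s s'"
  unfolding runs_def using order_trans by fast

lemma runs_step1:
  assumes "\<And>k. cstep W (c # k, s) = (k, s')"
  shows "runs W c 1 s s'"
  unfolding runs_def using assms by (intro allI exI[of _ 1]) simp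

lemma runs_INC: "runs W (INC r) 1 (\<sigma>, w) (\<sigma>(r := \<sigma> r + 1), w)"
  by (rule runs_step1) (simp add: cstep_def)

lemma runs_DEC: "runs W (DEC r) 1 (\<sigma>, w) (\<sigma>(r := \<sigma> r - 1), w)"
  by (rule runs_step1) (simp add: cstep_def)

lemma runs_OUT: "runs W (OUT b) 1 (\<sigma>, w) (\<sigma>, w @ [b])"
  by (rule runs_step1) (simp add: cstep_def)

lemma funpow_split: "(f ^^ m) x = y \<Longrightarrow> (f ^^ n) y = z \<Longrightarrow> (f ^^ (n + m)) x = z"
  by (simp add: funpow_add)

lemma runs_SEQ:
  assumes "runs W a t1 x y" "runs W b t2 y z"
  shows "runs W (SEQ a b) (t1 + t2 + 1) x z"
  unfolding runs_def
proof
  fix k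
  obtain i where i: "i \<le> t1" "(cstep W ^^ i) (a # b # k, x) = (b # k, y)"
    using assms(1) unfolding runs_def by blast
  obtain j where j: "j \<le> t2" "(cstep W ^^ j) (b # k, y) = (k, z)"
    using assms(2) unfolding runs_def by blast
  have "(cstep W ^^ 1) (SEQ a b # k, x) = (a # b # k, x)"
    by (cases x) (simp add: cstep_def)
  from funpow_split[OF funpow_split[OF this i(2)] j(2)]
  show "\<exists>t'\<le>t1 + t2 + 1. (cstep W ^^ t') (SEQ a b # k, x) = (k, z)"
    using i(1) j(1) by (intro exI[of _ "j + (i + 1)"]) simp
qed

lemma runs_IFT:
  assumes "symb W (fst x) r \<in> A \<Longrightarrow> runs W a t x y" "symb W (fst x) r \<notin> A \<Longrightarrow> runs W b t x y"
  shows "runs W (IFT r A a b) (t + 1) x y"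
  unfolding runs_def
proof
  fix k
  let ?c = "if symb W (fst x) r \<in> A then a else b"
  obtain i where i: "i \<le> t" "(cstep W ^^ i) (?c # k, x) = (k, y)"
    using assms unfolding runs_def by (cases "symb W (fst x) r \<in> A") auto
  have "(cstep W ^^ 1) (IFT r A a b # k, x) = (?c # k, x)"
    by (cases x) (simp add: cstep_def)
  from funpow_split[OF this i(2)]
  show "\<exists>t'\<le>t + 1. (cstep W ^^ t') (IFT r A a b # k, x) = (k, y)"
    using i(1) by (intro exI[of _ "i + 1"]) simp
qed

lemma runs_WHL:
  assumes "\<And>i. i < n \<Longrightarrow> symb W (fst (x i)) r \<in> A" "\<And>i. i < n \<Longrightarrow> runs W c t (x i) (x (Suc i))"
    and "symb W (fst (x n)) r \<notin> A"
  shows "runs W (WHL r A c) (n * (t + 1) + 1) (x 0) (x n)"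
  using assms
proof (induction n arbitrary: x)
  case 0
  show ?case
    by (rule runs_mono[OF runs_step1]) (use 0 in \<open>cases "x 0"; simp add: cstep_def\<close>)+
next
  case (Suc n)
  have IH: "runs W (WHL r A c) (n * (t + 1) + 1) (x 1) (x (Suc n))"
    using Suc.IH[of "\<lambda>i. x (Suc i)"] Suc.prems by simp
  show ?case unfolding runs_def
  proof
    fix k
    obtain i where i: "i \<le> t" "(cstep W ^^ i) (c # WHL r A c # k, x 0) = (WHL r A c # k, x 1)"
      using Suc.prems(2)[of 0] unfolding runs_def by auto
    obtain j where j: "j \<le> n * (t + 1) + 1" "(cstep W ^^ j) (WHL r A c # k, x 1) = (k, x (Suc n))"
      using IH unfolding runs_def by blast
    have "(cstep W ^^ 1) (WHL r A c # k, x 0) = (c # WHL r A c # k, x 0)"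
      using Suc.prems(1)[of 0] by (cases "x 0") (simp add: cstep_def)
    from funpow_split[OF funpow_split[OF this i(2)] j(2)]
    show "\<exists>t'\<le>Suc n * (t + 1) + 1. (cstep W ^^ t') (WHL r A c # k, x 0) = (k, x (Suc n))"
      using i(1) j(1) by (intro exI[of _ "j + (i + 1)"]) simp
  qed
qed

section \<open>Simulation of programs by Turing machines\<close>

fun regs :: "com \<Rightarrow> nat set" where
  "regs (INC r) = {r}"
| "regs (DEC r) = {r}"
| "regs (OUT b) = {}"
| "regs (SEQ a b) = regs a \<union> regs b"
| "regs (WHL r A c) = insert r (regs c)"
| "regs (IFT r A a b) = insert r (regs a \<union> regs b)"

lemma finite_regs: "finite (regs c)"
  by (induction c) auto

text \<open>A loop puts itself below its body, yet the stack does not grow, because the body is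
  consumed before the loop is tested again. So a stack is determined by a place in the program
  text.\<close>

fun reach :: "com \<Rightarrow> com list \<Rightarrow> com list set" where
  "reach (SEQ a b) k = insert (SEQ a b # k) (reach a (b # k) \<union> reach b k)"
| "reach (WHL r A c) k = insert (WHL r A c # k) (reach c (WHL r A c # k))"
| "reach (IFT r A a b) k = insert (IFT r A a b # k) (reach a k \<union> reach b k)"
| "reach c k = {c # k}"

lemma finite_reach: "finite (reach c k)"
  by (induction c k rule: reach.induct) auto

lemma reach_start: "c # k \<in> reach c k"
  by (cases c) auto

lemma reach_nxt: "x \<in> reach c k \<Longrightarrow> nxt y x \<in> insert k (reach c k)"
proof (induction c k arbitrary: x rule: reach.induct)
  case (1 a b k)
  then consider "x = SEQ a b # k" | "x \<in> reach a (b # k)" | "x \<in> reach b k" by auto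
  then show ?case
  proof cases
    case 1
    then show ?thesis using reach_start[of a "b # k"] by simp
  next
    case 2
    then show ?thesis using "1.IH"(1)[of x] reach_start[of b k] by auto
  next
    case 3
    then show ?thesis using "1.IH"(2)[of x] by auto
  qed
next
  case (2 r A c k)
  then consider "x = WHL r A c # k" | "x \<in> reach c (WHL r A c # k)" by auto
  then show ?case
  proof cases
    case 1
    then show ?thesis using reach_start[of c "WHL r A c # k"] by simp
  next
    case 2
    then show ?thesis using "2.IH"[of x] by auto
  qed
next
  case (3 r A a b k)
  then consider "x = IFT r A a b # k" | "x \<in> reach a k" | "x \<in> reach b k" by auto
  then show ?case
  proof cases
    case 1
    then show ?thesis using reach_start[of a k] reach_start[of b k] by simp
  next
    case 2
    then show ?thesis using "3.IH"(1)[of x] by auto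
  next
    case 3
    then show ?thesis using "3.IH"(2)[of x] by auto
  qed
qed simp_all

lemma reach_regs: "x \<in> reach c k \<Longrightarrow> d \<in> set x \<Longrightarrow> regs d \<subseteq> regs c \<union> (\<Union>e\<in>set k. regs e)"
proof (induction c k arbitrary: x rule: reach.induct)
  case (1 a b k)
  then show ?case using "1.IH"(1)[of x] "1.IH"(2)[of x] by auto
next
  case (2 r A c k)
  then show ?case using "2.IH"[of x] by auto
next
  case (3 r A a b k)
  then show ?case using "3.IH"(1)[of x] "3.IH"(2)[of x] by auto
qed auto

definition stacks :: "com \<Rightarrow> com list set" where
  "stacks c = insert [] (reach c [])"

text \<open>States 0, 1 and 2 are kept for starting, accepting and rejecting.\<close>

definition enc :: "com \<Rightarrow> com list \<Rightarrow> nat" where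
  "enc c k = 3 + to_nat_on (stacks c) k"

definition dec :: "com \<Rightarrow> nat \<Rightarrow> com list" where
  "dec c q = from_nat_into (stacks c) (q - 3)"

text \<open>The test \<open>y r < 3\<close> keeps a head from leaving cell 0 to the left, which
  makes \<open>DEC\<close> the truncated predecessor.\<close>

definition dirs :: "com list \<Rightarrow> (nat \<Rightarrow> nat) \<Rightarrow> nat \<Rightarrow> direction" where
  "dirs k y r = (case k of INC r' # _ \<Rightarrow> if r = r' then Rgt else Stay
     | DEC r' # _ \<Rightarrow> if r = r' \<and> y r < 3 then Lft else Stay | _ \<Rightarrow> Stay)"

definition outp :: "com list \<Rightarrow> nat \<Rightarrow> nat \<times> direction" where
  "outp k s = (case k of OUT b # _ \<Rightarrow> (if b then 2 else 1, Rgt) | _ \<Rightarrow> (s, Stay))"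

text \<open>The symbols 3, 4, 5 are the copies of 0, 1, 2 used in cell 0 of a register tape.\<close>

definition mach :: "com \<Rightarrow> nat \<Rightarrow> machine" where
  "mach c m = \<lparr>num_tapes = m + 1, num_symbols = 6, num_states = 3 + card (stacks c),
     accept_state = 1, reject_state = 2,
     trans = (\<lambda>q rs.
       if q = 0 then (enc c [c],
         map (\<lambda>r. (if r < m then rs ! r mod 3 + 3 else rs ! r, Stay)) [0..<m + 1])
       else if q < 3 \<or> dec c q = [] then
         (if rs ! 2 < 3 then 1 else 2, map (\<lambda>r. (rs ! r, Stay)) [0..<m + 1])
       else (enc c (nxt (\<lambda>r. rs ! r) (dec c q)),
         map (\<lambda>r. if r < m then (rs ! r, dirs (dec c q) (\<lambda>r. rs ! r) r)
                  else outp (dec c q) (rs ! r)) [0..<m + 1]))\<rparr>"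

definition tapes :: "(nat \<Rightarrow> bool list) \<Rightarrow> nat \<Rightarrow> store \<Rightarrow> tape list" where
  "tapes W m s = map (\<lambda>r. if r < m
     then (\<lambda>i. word_cells (W r) i + (if i = 0 then 3 else 0), int (fst s r))
     else (word_cells (snd s), int (length (snd s)))) [0..<m + 1]"

lemma stacks_facts:
  "finite (stacks c)" "[c] \<in> stacks c" "[] \<in> stacks c"
  "k \<in> stacks c \<Longrightarrow> nxt y k \<in> stacks c"
  "k \<in> stacks c \<Longrightarrow> d \<in> set k \<Longrightarrow> regs d \<subseteq> regs c"
  unfolding stacks_def using finite_reach reach_start[of c "[]"] reach_nxt[of k c "[]" y]
    reach_regs[of k c "[]"] by auto

lemma dec_enc: "k \<in> stacks c \<Longrightarrow> dec c (enc c k) = k"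
  unfolding dec_def enc_def by (simp add: countable_finite stacks_facts(1))

lemma enc_bound: "k \<in> stacks c \<Longrightarrow> enc c k < 3 + card (stacks c)"
  unfolding enc_def using to_nat_on_finite[OF stacks_facts(1), of c]
  by (auto simp: bij_betw_def)

lemma turing_machine_mach: "turing_machine (mach c m)"
proof -
  have dec_in: "dec c q \<in> stacks c" for q
    unfolding dec_def using stacks_facts(3) by (intro from_nat_into) auto
  show ?thesis
    unfolding turing_machine_def
  proof (intro conjI allI impI)
    fix q rs assume q: "q < num_states (mach c m)"
      and rs: "length rs = num_tapes (mach c m) \<and> set rs \<subseteq> {..<num_symbols (mach c m)}"
    have rs6: "rs ! r < 6" if "r < m + 1" for r
      using rs that nth_mem[of r rs] by (auto simp: mach_def subset_iff simp del: nth_mem)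
    show "fst (trans (mach c m) q rs) < num_states (mach c m)"
      using enc_bound[OF stacks_facts(2)] enc_bound[OF stacks_facts(4)[OF dec_in]]
      by (simp add: mach_def)
    show "length (snd (trans (mach c m) q rs)) = num_tapes (mach c m)"
      by (simp add: mach_def)
    have m6: "n mod 3 + 3 < 6" for n :: nat using mod_less_divisor[of 3 n] by linarith
    show "fst ` set (snd (trans (mach c m) q rs)) \<subseteq> {..<num_symbols (mach c m)}"
      using rs6 m6 by (auto simp: mach_def outp_def less_Suc_eq split: list.splits com.splits)
  qed (auto simp: mach_def)
qed

lemma word_cells_append:
  "(word_cells w)(int (length w) := (if b then 2 else 1)) = word_cells (w @ [b])"
  by (rule ext) (auto simp: word_cells_def nth_append)

lemma word_cells_le: "word_cells w i \<le> 2"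
  by (auto simp: word_cells_def)

lemma sym_less_3: "symb W \<sigma> r < 3 \<longleftrightarrow> \<sigma> r \<noteq> 0"
  using word_cells_le[of "W r" "int (\<sigma> r)"] by (auto simp: symb_def)

lemma nxt_cong: "(\<And>r. r \<in> (\<Union>d\<in>set k. regs d) \<Longrightarrow> y r = y' r) \<Longrightarrow> nxt y k = nxt y' k"
  by (cases "(y, k)" rule: nxt.cases) auto

lemma read_tapes:
  "map read_tape (tapes W m s) =
     map (\<lambda>r. if r < m then symb W (fst s) r else word_cells (snd s) (int (length (snd s)))) [0..<m + 1]"
  by (auto simp: tapes_def symb_def)

lemma map2_upt: "map2 f (map g [0..<n]) (map h [0..<n]) = map (\<lambda>i. f (g i) (h i)) [0..<n]"
  by (induction n) auto

text \<open>One command is one machine step. Register tapes keep their contents because the scanned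
  symbol is written back; only the output tape grows, at its head.\<close>

lemma step_mach:
  assumes k: "k \<in> stacks c" "k \<noteq> []" and m: "regs c \<subseteq> {..<m}"
  shows "step (mach c m) (enc c k, tapes W m s) =
    (enc c (fst (cstep W (k, s))), tapes W m (snd (cstep W (k, s))))"
proof -
  obtain \<sigma> w where s: "s = (\<sigma>, w)" by (cases s)
  define rs where "rs = map read_tape (tapes W m s)"
  have rs: "rs ! r = symb W \<sigma> r" if "r < m" for r
    using that unfolding rs_def read_tapes by (simp add: s nth_append)
  have rsm: "rs ! m = word_cells w (int (length w))"
    unfolding rs_def read_tapes by (simp add: s nth_append)
  have regs: "r < m" if "d \<in> set k" "r \<in> regs d" for d r
    using stacks_facts(5)[OF k(1) that(1)] that(2) m by auto
  have n: "nxt (\<lambda>r. rs ! r) k = nxt (symb W \<sigma>) k"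
    by (rule nxt_cong) (use regs rs in auto)
  have e3: "enc c k \<ge> 3" by (simp add: enc_def)
  obtain a k' where kc: "k = a # k'" using k(2) by (cases k) auto
  have T: "trans (mach c m) (enc c k) rs = (enc c (nxt (\<lambda>r. rs ! r) k),
         map (\<lambda>r. if r < m then (rs ! r, dirs k (\<lambda>r. rs ! r) r) else outp k (rs ! r)) [0..<m + 1])"
    using e3 k by (simp add: mach_def dec_enc)
  have H: "\<not> halted (mach c m) (enc c k, tapes W m s)"
    using e3 by (auto simp: halted_def mach_def)
  have "step (mach c m) (enc c k, tapes W m s) = (enc c (nxt (symb W \<sigma>) k),
     map2 act (map (\<lambda>r. if r < m then (rs ! r, dirs k (\<lambda>r. rs ! r) r) else outp k (rs ! r)) [0..<m + 1])
        (tapes W m s))"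
    unfolding step_def using H T n by (simp add: rs_def[symmetric])
  also have "map2 act (map (\<lambda>r. if r < m then (rs ! r, dirs k (\<lambda>r. rs ! r) r) else outp k (rs ! r)) [0..<m + 1])
        (tapes W m s) = tapes W m (upd k s)"
    unfolding tapes_def map2_upt
  proof (rule map_cong[OF refl])
    fix r assume "r \<in> set [0..<m + 1]"
    then consider "r < m" | "r = m" by fastforce
    then show "act (if r < m then (rs ! r, dirs k (\<lambda>r. rs ! r) r) else outp k (rs ! r))
          (if r < m then (\<lambda>i. word_cells (W r) i + (if i = 0 then 3 else 0), int (fst s r))
           else (word_cells (snd s), int (length (snd s)))) =
         (if r < m then (\<lambda>i. word_cells (W r) i + (if i = 0 then 3 else 0), int (fst (upd k s) r))
         else (word_cells (snd (upd k s)), int (length (snd (upd k s)))))"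
    proof cases
      case 1
      have "dirs k (\<lambda>r. rs ! r) r = dirs k (symb W \<sigma>) r"
        using rs 1 by (auto simp: dirs_def split: list.splits com.splits)
      moreover have "offset (dirs k (symb W \<sigma>) r) = int (fst (upd k s) r) - int (\<sigma> r)"
        unfolding s kc by (cases a) (auto simp: dirs_def sym_less_3)
      moreover have "(\<lambda>i. word_cells (W r) i + (if i = 0 then 3 else 0))(int (\<sigma> r) := symb W \<sigma> r)
         = (\<lambda>i. word_cells (W r) i + (if i = 0 then 3 else 0))"
        by (rule ext) (simp add: symb_def)
      ultimately show ?thesis using 1 rs by (simp add: s)
    next
      case 2
      have "(word_cells w)(int (length w) := word_cells w (int (length w))) = word_cells w"
        by (rule fun_upd_triv)
      then show ?thesis using 2 rsm unfolding s kc
        by (cases a) (auto simp: outp_def word_cells_append)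
    qed
  qed
  finally show ?thesis by (simp add: cstep_def s)
qed

lemma cstep_stacks: "k \<in> stacks c \<Longrightarrow> fst ((cstep W ^^ t) (k, s)) \<in> stacks c"
  by (induction t) (auto simp: cstep_def case_prod_unfold stacks_facts(4))

lemma cstep_Nil: "(cstep W ^^ t) ([], s) = ([], s)"
  by (induction t) (auto simp: cstep_def)

lemma steps_mach:
  assumes m: "regs c \<subseteq> {..<m}" and k: "k \<in> stacks c"
    and r: "(cstep W ^^ t) (k, s) = ([], s')"
  shows "\<exists>t'\<le>t. (step (mach c m) ^^ t') (enc c k, tapes W m s) = (enc c [], tapes W m s')"
  using k r
proof (induction t arbitrary: k s)
  case 0
  then show ?case by auto
next
  case (Suc t)
  show ?case
  proof (cases "k = []")
    case True
    then show ?thesis using Suc.prems(2) cstep_Nil[of "Suc t" W s] by (intro exI[of _ 0]) auto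
  next
    case False
    let ?x = "cstep W (k, s)"
    have "fst ?x \<in> stacks c" using cstep_stacks[OF Suc.prems(1), where W = W and t = 1 and s = s] by simp
    moreover have "(cstep W ^^ t) (fst ?x, snd ?x) = ([], s')"
      using Suc.prems(2) by (simp add: funpow_swap1)
    ultimately obtain t' where "t' \<le> t"
      "(step (mach c m) ^^ t') (enc c (fst ?x), tapes W m (snd ?x)) = (enc c [], tapes W m s')"
      using Suc.IH by blast
    then show ?thesis using step_mach[OF Suc.prems(1) False m, of W s]
      by (intro exI[of _ "Suc t'"]) (simp add: funpow_swap1)
  qed
qed

lemma halted_step: "halted M c \<Longrightarrow> (step M ^^ t) c = c"
  by (induction t) (auto simp: step_def)

lemma halted_run_mono:
  assumes "halted M (run M ws t)" "t \<le> t'"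
  shows "run M ws t' = run M ws t"
proof -
  have "run M ws t' = (step M ^^ (t' - t)) (run M ws t)"
    unfolding run_def using assms(2) by (metis funpow_add comp_apply le_add_diff_inverse2)
  then show ?thesis using halted_step[OF assms(1)] by simp
qed

definition words :: "bool list list \<Rightarrow> nat \<Rightarrow> bool list" where
  "words ws r = (if r < length ws then ws ! r else [])"

text \<open>The two extra steps are the initial one, which marks cell 0 of the register tapes, and
  the last one, which turns the test of register 2 into the answer. If the program ends early, the
  halted configuration persists.\<close>

lemma run_mach:
  assumes R: "runs (words ws) c t ((\<lambda>_. 0), []) (\<sigma>, w)"
    and m: "regs c \<subseteq> {..<m}" "2 < m" "length ws \<le> m"
  shows "run (mach c m) ws (t + 2) = (if \<sigma> 2 \<noteq> 0 then 1 else 2, tapes (words ws) m (\<sigma>, w))"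
    and "halted (mach c m) (run (mach c m) ws (t + 2))"
proof -
  let ?M = "mach c m" and ?W = "words ws"
  have ini: "init_config ?M ws = (0, map (\<lambda>r. (word_cells (?W r), 0)) [0..<m + 1])"
    unfolding init_config_def using m(3)
    by (auto simp: mach_def words_def nth_append intro!: nth_equalityI)
  have "map read_tape (snd (init_config ?M ws)) = map (\<lambda>r. word_cells (?W r) 0) [0..<m + 1]"
    unfolding ini by simp
  moreover have "word_cells (?W m) = word_cells []" using m(3) by (simp add: words_def)
  moreover have "(word_cells (?W r))(0 := word_cells (?W r) 0 mod 3 + 3)
      = (\<lambda>i. word_cells (?W r) i + (if i = 0 then 3 else 0))" for r
    using word_cells_le[of "?W r" 0] by (intro ext) simp
  ultimately have s1: "step ?M (init_config ?M ws) = (enc c [c], tapes ?W m ((\<lambda>_. 0), []))"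
    unfolding step_def ini
    by (auto simp: mach_def halted_def map2_upt tapes_def nth_append fun_upd_triv less_Suc_eq
        simp del: upt_Suc)
  obtain t0 where t0: "t0 \<le> t" "(cstep ?W ^^ t0) ([c], (\<lambda>_. 0), []) = ([], \<sigma>, w)"
    using R unfolding runs_def by blast
  obtain t1 where t1: "t1 \<le> t0"
    "(step ?M ^^ t1) (enc c [c], tapes ?W m ((\<lambda>_. 0), [])) = (enc c [], tapes ?W m (\<sigma>, w))"
    using steps_mach[OF m(1) stacks_facts(2) t0(2)] by blast
  have e: "enc c [] \<ge> 3" by (simp add: enc_def)
  have rd: "map read_tape (tapes ?W m (\<sigma>, w)) ! r
     = (if r < m then symb ?W \<sigma> r else word_cells w (int (length w)))" if "r < m + 1" for r
    unfolding read_tapes using that by (simp add: nth_append)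
  have "map2 act (map (\<lambda>r. (map read_tape (tapes ?W m (\<sigma>, w)) ! r, Stay)) [0..<m + 1]) (tapes ?W m (\<sigma>, w))
     = tapes ?W m (\<sigma>, w)"
    unfolding tapes_def map2_upt by (rule map_cong[OF refl]) (auto simp: nth_append fun_upd_triv simp del: upt_Suc)
  moreover have "map read_tape (tapes ?W m (\<sigma>, w)) ! 2 < 3 \<longleftrightarrow> \<sigma> 2 \<noteq> 0"
    using rd[of 2] m(2) sym_less_3[of ?W \<sigma> 2] by simp
  ultimately have s3: "step ?M (enc c [], tapes ?W m (\<sigma>, w))
     = (if \<sigma> 2 \<noteq> 0 then 1 else 2, tapes ?W m (\<sigma>, w))"
    unfolding step_def using e dec_enc[OF stacks_facts(3)]
    by (simp add: mach_def halted_def)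
  have "(step ?M ^^ 1) (init_config ?M ws) = (enc c [c], tapes ?W m ((\<lambda>_. 0), []))"
    using s1 by simp
  from funpow_split[OF funpow_split[OF this t1(2)], of 1] s3
  have r: "run ?M ws (t1 + 2) = (if \<sigma> 2 \<noteq> 0 then 1 else 2, tapes ?W m (\<sigma>, w))"
    by (simp add: run_def)
  then have h: "halted ?M (run ?M ws (t1 + 2))" by (simp add: halted_def mach_def)
  have "run ?M ws (t + 2) = run ?M ws (t1 + 2)"
    by (rule halted_run_mono[OF h]) (use t0 t1 in simp)
  then show "run ?M ws (t + 2) = (if \<sigma> 2 \<noteq> 0 then 1 else 2, tapes ?W m (\<sigma>, w))"
    "halted ?M (run ?M ws (t + 2))" using r h by simp_all
qed

section \<open>Polynomial time by bounded arithmetic\<close>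

text \<open>Bounded sums are the only iteration. They yield products, quotients and bounded
  quantifiers, and they keep values and running times polynomial.\<close>

datatype ex = Var nat | Cst nat | Plus ex ex | Minus ex ex | Sm ex ex | Inp bool ex | Len bool

fun eval :: "ex \<Rightarrow> (nat \<Rightarrow> bool list) \<Rightarrow> (nat \<Rightarrow> nat) \<Rightarrow> nat" where
  "eval (Var i) W s = s i"
| "eval (Cst c) W s = c"
| "eval (Plus a b) W s = eval a W s + eval b W s"
| "eval (Minus a b) W s = eval a W s - eval b W s"
| "eval (Sm a b) W s = (\<Sum>j<eval a W s. eval b W (case_nat j s))"
| "eval (Inp t a) W s = word_cells (W (of_bool t)) (int (eval a W s))"
| "eval (Len t) W s = length (W (of_bool t))"

abbreviation NZ :: "nat set" where "NZ \<equiv> {..<3}"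

definition skip :: com where "skip = WHL 0 {} (INC 0)"
definition clear :: "nat \<Rightarrow> com" where "clear a = WHL a NZ (DEC a)"
definition move :: "nat \<Rightarrow> nat \<Rightarrow> com" where "move a b = WHL a NZ (SEQ (DEC a) (INC b))"
definition move2 :: "nat \<Rightarrow> nat \<Rightarrow> nat \<Rightarrow> com" where
  "move2 a b c = WHL a NZ (SEQ (DEC a) (SEQ (INC b) (INC c)))"
definition monus :: "nat \<Rightarrow> nat \<Rightarrow> com" where "monus a b = WHL a NZ (SEQ (DEC a) (DEC b))"

fun adds :: "nat \<Rightarrow> nat \<Rightarrow> com" where
  "adds r 0 = skip"
| "adds r (Suc c) = SEQ (INC r) (adds r c)"

text \<open>Variables are de Bruijn indices, stored in the registers \<open>\<rho>\<close>. Registers 0 and 1 are the heads on the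
  input words, and the value is added to register \<open>f\<close>, all registers from \<open>f\<close> on being 0 before.\<close>

fun cmp :: "ex \<Rightarrow> (nat \<Rightarrow> nat) \<Rightarrow> nat \<Rightarrow> com" where
  "cmp (Var i) \<rho> f = SEQ (move2 (\<rho> i) f (f + 1)) (move (f + 1) (\<rho> i))"
| "cmp (Cst c) \<rho> f = adds f c"
| "cmp (Plus a b) \<rho> f = SEQ (cmp a \<rho> f) (SEQ (cmp b \<rho> (f + 1)) (move (f + 1) f))"
| "cmp (Minus a b) \<rho> f = SEQ (cmp a \<rho> f) (SEQ (cmp b \<rho> (f + 1)) (monus (f + 1) f))"
| "cmp (Sm a b) \<rho> f = SEQ (cmp a \<rho> (f + 2)) (SEQ
     (WHL (f + 2) NZ (SEQ (DEC (f + 2)) (SEQ (cmp b (case_nat (f + 1) \<rho>) (f + 3))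
        (SEQ (move (f + 3) f) (INC (f + 1))))))
     (clear (f + 1)))"
| "cmp (Inp t a) \<rho> f = SEQ (cmp a \<rho> f) (SEQ (move2 f (of_bool t) (f + 1))
     (SEQ (IFT (of_bool t) {1, 2, 4, 5} (INC f) skip) (SEQ (IFT (of_bool t) {2, 5} (INC f) skip)
     (monus (f + 1) (of_bool t)))))"
| "cmp (Len t) \<rho> f = SEQ (WHL (of_bool t) {1, 2, 4, 5} (SEQ (INC (of_bool t)) (SEQ (INC f) (INC (f + 1)))))
     (monus (f + 1) (of_bool t))"

lemma runs_NZ:
  assumes "\<And>i. i < n \<Longrightarrow> runs W c t (x i) (x (Suc i))" "\<And>i. i \<le> n \<Longrightarrow> fst (x i) r = n - i"
  shows "runs W (WHL r NZ c) (n * (t + 1) + 1) (x 0) (x n)"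
  by (rule runs_WHL) (use assms in \<open>auto simp: sym_less_3\<close>)

lemma runs_skip: "runs W skip 1 s s"
  using runs_WHL[of 0 W "\<lambda>_. s" 0 "{}" "INC 0" 0] by (simp add: skip_def)

lemma runs_SEQ':
  assumes "runs W a t1 x y" "runs W b t2 y z" "t1 + t2 + 1 \<le> t"
  shows "runs W (SEQ a b) t x z"
  using runs_SEQ[OF assms(1,2)] runs_mono assms(3) by blast

lemma runs_eq: "runs W c t s s1 \<Longrightarrow> s1 = s' \<Longrightarrow> runs W c t s s'"
  by simp

lemma runs_clear: "runs W (clear a) (2 * \<sigma> a + 1) (\<sigma>, w) (\<sigma>(a := 0), w)"
proof -
  have "runs W (clear a) (\<sigma> a * (1 + 1) + 1) (\<sigma>(a := \<sigma> a - 0), w) (\<sigma>(a := \<sigma> a - \<sigma> a), w)"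
    unfolding clear_def
    by (rule runs_NZ[where x = "\<lambda>i. (\<sigma>(a := \<sigma> a - i), w)"]) (rule runs_eq[OF runs_DEC], auto)
  then show ?thesis by (simp add: mult_2 mult_2_right)
qed

lemma runs_move:
  assumes "a \<noteq> b"
  shows "runs W (move a b) (4 * \<sigma> a + 1) (\<sigma>, w) (\<sigma>(a := 0, b := \<sigma> b + \<sigma> a), w)"
proof -
  let ?x = "\<lambda>i. (\<sigma>(a := \<sigma> a - i, b := \<sigma> b + i), w)"
  have "runs W (move a b) (\<sigma> a * (3 + 1) + 1) (?x 0) (?x (\<sigma> a))"
    unfolding move_def
  proof (rule runs_NZ[where x = ?x])
    show "runs W (SEQ (DEC a) (INC b)) 3 (?x i) (?x (Suc i))" for i
      by (rule runs_SEQ'[OF runs_DEC runs_eq[OF runs_INC]]) (use assms in auto)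
  qed (use assms in auto)
  then show ?thesis by (simp add: mult.commute)
qed

lemma runs_monus:
  assumes "a \<noteq> b"
  shows "runs W (monus a b) (4 * \<sigma> a + 1) (\<sigma>, w) (\<sigma>(a := 0, b := \<sigma> b - \<sigma> a), w)"
proof -
  let ?x = "\<lambda>i. (\<sigma>(a := \<sigma> a - i, b := \<sigma> b - i), w)"
  have "runs W (monus a b) (\<sigma> a * (3 + 1) + 1) (?x 0) (?x (\<sigma> a))"
    unfolding monus_def
  proof (rule runs_NZ[where x = ?x])
    show "runs W (SEQ (DEC a) (DEC b)) 3 (?x i) (?x (Suc i))" for i
      by (rule runs_SEQ'[OF runs_DEC runs_eq[OF runs_DEC]]) (use assms in auto)
  qed (use assms in auto)
  then show ?thesis by (simp add: mult.commute)
qed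

lemma runs_move2:
  assumes "a \<noteq> b" "a \<noteq> c" "b \<noteq> c"
  shows "runs W (move2 a b c) (6 * \<sigma> a + 1) (\<sigma>, w) (\<sigma>(a := 0, b := \<sigma> b + \<sigma> a, c := \<sigma> c + \<sigma> a), w)"
proof -
  let ?x = "\<lambda>i. (\<sigma>(a := \<sigma> a - i, b := \<sigma> b + i, c := \<sigma> c + i), w)"
  have "runs W (move2 a b c) (\<sigma> a * (5 + 1) + 1) (?x 0) (?x (\<sigma> a))"
    unfolding move2_def
  proof (rule runs_NZ[where x = ?x])
    show "runs W (SEQ (DEC a) (SEQ (INC b) (INC c))) 5 (?x i) (?x (Suc i))" for i
      by (rule runs_SEQ'[OF runs_DEC runs_SEQ'[OF runs_INC runs_eq[OF runs_INC] order_refl]])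
        (use assms in auto)
  qed (use assms in auto)
  then show ?thesis by (simp add: mult.commute)
qed

lemma runs_adds: "runs W (adds r c) (2 * c + 1) (\<sigma>, w) (\<sigma>(r := \<sigma> r + c), w)"
proof (induction c arbitrary: \<sigma>)
  case 0
  then show ?case using runs_skip by simp
next
  case (Suc c)
  show ?case unfolding adds.simps
    by (rule runs_SEQ'[OF runs_INC runs_eq[OF Suc]]) auto
qed

section \<open>Polynomial bounds for compiled expressions\<close>

lemma poly_mono_nat:
  fixes p :: "nat poly"
  assumes "x \<le> y"
  shows "poly p x \<le> poly p y"
  by (induction p) (auto intro!: add_mono mult_mono assms)

text \<open>Symbols 4 and 5 are 1 and 2 in the marked cell 0, so the two tests mean "not blank" and
  "\<open>True\<close>".\<close>

lemma in_sets: "word_cells w i + (if c then 3 else 0) \<in> {1, 2, 4, 5} \<longleftrightarrow> word_cells w i \<noteq> 0"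
  "word_cells w i + (if c then 3 else 0) \<in> {2, 5} \<longleftrightarrow> word_cells w i = 2"
  using word_cells_le[of w i] by auto

text \<open>One polynomial bounds both value and time, since the value of an inner expression
  becomes the length of a loop. Apart from \<open>f\<close>, the scratch registers are 0 again
  afterwards and the heads 0 and 1 are back at cell 0, so that evaluations can be chained.\<close>

definition spec :: "ex \<Rightarrow> nat poly \<Rightarrow> bool" where
  "spec e P \<longleftrightarrow> (\<forall>W \<rho> f s w B. (\<forall>i. \<rho> i < f) \<longrightarrow> 2 \<le> f \<longrightarrow> s 0 = 0 \<longrightarrow> s 1 = 0 \<longrightarrow> (\<forall>r\<ge>f. s r = 0) \<longrightarrow>
     (\<forall>i. s (\<rho> i) \<le> B) \<longrightarrow> (\<forall>i. length (W i) \<le> B) \<longrightarrow>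
     eval e W (s \<circ> \<rho>) \<le> poly P B \<and>
     runs W (cmp e \<rho> f) (poly P B) (s, w) (s(f := eval e W (s \<circ> \<rho>)), w))"

lemma specI:
  assumes "\<And>W \<rho> f s w B. (\<And>i. \<rho> i < f) \<Longrightarrow> 2 \<le> f \<Longrightarrow> s 0 = 0 \<Longrightarrow> s 1 = 0 \<Longrightarrow> (\<And>r. r \<ge> f \<Longrightarrow> s r = 0) \<Longrightarrow>
     (\<And>i. s (\<rho> i) \<le> B) \<Longrightarrow> (\<And>i. length (W i) \<le> B) \<Longrightarrow>
     eval e W (s \<circ> \<rho>) \<le> poly P B \<and>
     runs W (cmp e \<rho> f) (poly P B) (s, w) (s(f := eval e W (s \<circ> \<rho>)), w)"
  shows "spec e P"
  using assms unfolding spec_def by blast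

lemma specD:
  assumes "spec e P" "\<And>i. \<rho> i < f" "2 \<le> f" "s 0 = 0" "s 1 = 0" "\<And>r. r \<ge> f \<Longrightarrow> s r = 0"
     "\<And>i. s (\<rho> i) \<le> B" "\<And>i. length (W i) \<le> B"
  shows "eval e W (s \<circ> \<rho>) \<le> poly P B \<and>
    runs W (cmp e \<rho> f) (poly P B) (s, w) (s(f := eval e W (s \<circ> \<rho>)), w)"
  using assms unfolding spec_def by blast

text \<open>The body sees an index below the value \<open>A\<close> of the bound, hence the argument
  \<open>B + A\<close> of its polynomial. The coefficient 5 stands for one evaluation of the body
  and four steps per unit to move its value to the accumulator.\<close>

lemma spec_Sm:
  assumes a: "spec a Pa" and b: "spec b Pb"
  shows "spec (Sm a b) (Pa + Pa * (smult 5 (pcompose Pb ([:0, 1:] + Pa)) + [:8:]) + smult 2 Pa + [:4:])"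
proof (rule specI)
  fix W :: "nat \<Rightarrow> bool list" and \<rho> :: "nat \<Rightarrow> nat" and f :: nat and s :: "nat \<Rightarrow> nat" and w :: "bool list" and B :: nat
  assume \<rho>: "\<And>i. \<rho> i < f" and f: "2 \<le> f" and s: "s 0 = 0" "s 1 = 0" "\<And>r. r \<ge> f \<Longrightarrow> s r = 0"
    "\<And>i. s (\<rho> i) \<le> B" and W: "\<And>i. length (W i) \<le> B"
  define A where "A = poly Pa B"
  define Z where "Z = poly Pb (B + A)"
  define n where "n = eval a W (s \<circ> \<rho>)"
  define v where "v j = eval b W (case_nat j (s \<circ> \<rho>))" for j
  have \<rho>': "\<rho> i < f + 2" for i using \<rho>[of i] by simp
  note A = specD[OF a, of \<rho> "f + 2" s B W w, folded A_def n_def, OF \<rho>' _ s(1,2) s(3) s(4) W]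
  have nA: "n \<le> A" and ra: "runs W (cmp a \<rho> (f + 2)) A (s, w) (s(f + 2 := n), w)"
    using A f by auto
  let ?x = "\<lambda>i. (s(f := (\<Sum>j<i. v j), f + 1 := i, f + 2 := n - i), w)"
  let ?body = "SEQ (DEC (f + 2)) (SEQ (cmp b (case_nat (f + 1) \<rho>) (f + 3))
        (SEQ (move (f + 3) f) (INC (f + 1))))"
  have vb: "v i \<le> Z \<and> runs W ?body (5 * Z + 6) (?x i) (?x (Suc i))" if i: "i < n" for i
  proof -
    define s' where "s' = s(f := (\<Sum>j<i. v j), f + 1 := i, f + 2 := n - Suc i)"
    have 1: "s' \<circ> case_nat (f + 1) \<rho> = case_nat i (s \<circ> \<rho>)"
    proof
      fix j show "(s' \<circ> case_nat (f + 1) \<rho>) j = case_nat i (s \<circ> \<rho>) j"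
        using \<rho>[of "j - 1"] by (cases j) (auto simp: s'_def)
    qed
    have 2: "s' (case_nat (f + 1) \<rho> j) \<le> B + A" for j
      using 1 s(4)[of "j - 1"] i nA by (cases j) (auto simp: fun_eq_iff dest: spec[of _ j])
    have "case_nat (f + 1) \<rho> j < f + 3" for j
      using \<rho>[of "j - 1"] by (cases j) auto
    note S = specD[OF b, of "case_nat (f + 1) \<rho>" "f + 3" s' "B + A" W w, unfolded 1, folded v_def Z_def, OF this]
    have S1: "v i \<le> Z" and S2: "runs W (cmp b (case_nat (f + 1) \<rho>) (f + 3)) Z (s', w) (s'(f + 3 := v i), w)"
      using S 2 f s W by (auto simp: s'_def trans_le_add1)
    have d: "runs W (DEC (f + 2)) 1 (?x i) (s', w)"
      by (rule runs_eq[OF runs_DEC]) (auto simp: s'_def)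
    have m: "runs W (move (f + 3) f) (4 * v i + 1) (s'(f + 3 := v i), w)
        (s'(f := (\<Sum>j<Suc i. v j)), w)"
      by (rule runs_mono[OF runs_eq[OF runs_move]]) (use s(3) in \<open>auto simp: s'_def\<close>)
    have "runs W (INC (f + 1)) 1 (s'(f := (\<Sum>j<Suc i. v j)), w) (?x (Suc i))"
      by (rule runs_eq[OF runs_INC]) (auto simp: s'_def)
    from runs_SEQ'[OF d runs_SEQ'[OF S2 runs_SEQ'[OF m this order_refl] order_refl], of "5 * Z + 6"] S1
    show ?thesis by simp
  qed
  have l: "runs W (WHL (f + 2) NZ ?body) (n * (5 * Z + 6 + 1) + 1) (?x 0) (?x n)"
    by (rule runs_NZ[where x = ?x]) (use vb in auto)
  have x0: "?x 0 = (s(f + 2 := n), w)" using s(3) by auto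
  have c: "runs W (clear (f + 1)) (2 * n + 1) (?x n) (s(f := (\<Sum>j<n. v j)), w)"
    by (rule runs_mono[OF runs_eq[OF runs_clear]]) (use s(3) in auto)
  have t: "A + (n * (5 * Z + 6 + 1) + 1 + (2 * n + 1) + 1) + 1 \<le> A + A * (5 * Z + 8) + 2 * A + 4"
    using nA mult_le_mono[OF nA, of "7 + 5 * Z" "5 * Z + 8"] by simp
  have "runs W (cmp (Sm a b) \<rho> f) (A + A * (5 * Z + 8) + 2 * A + 4) (s, w) (s(f := (\<Sum>j<n. v j)), w)"
    unfolding cmp.simps by (rule runs_SEQ'[OF ra runs_SEQ'[OF l[unfolded x0] c order_refl] t])
  moreover have "(\<Sum>j<n. v j) \<le> A * (5 * Z + 8)"
  proof -
    have "(\<Sum>j<n. v j) \<le> (\<Sum>j<n. Z)" using vb by (intro sum_mono) auto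
    also have "\<dots> \<le> A * (5 * Z + 8)" using mult_le_mono[OF nA, of Z "5 * Z + 8"] by simp
    finally show ?thesis .
  qed
  moreover have "poly (Pa + Pa * (smult 5 (pcompose Pb ([:0, 1:] + Pa)) + [:8:]) + smult 2 Pa + [:4:]) B
      = A + A * (5 * Z + 8) + 2 * A + 4"
    by (simp add: poly_pcompose A_def Z_def add.commute)
  ultimately show "eval (Sm a b) W (s \<circ> \<rho>) \<le>
      poly (Pa + Pa * (smult 5 (pcompose Pb ([:0, 1:] + Pa)) + [:8:]) + smult 2 Pa + [:4:]) B \<and>
    runs W (cmp (Sm a b) \<rho> f) (poly (Pa + Pa * (smult 5 (pcompose Pb ([:0, 1:] + Pa)) + [:8:]) + smult 2 Pa + [:4:]) B)
      (s, w) (s(f := eval (Sm a b) W (s \<circ> \<rho>)), w)"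
    by (simp only: eval.simps n_def[symmetric] v_def[symmetric] simp_thms)
qed

lemma spec_binary:
  assumes a: "spec a Pa" and b: "spec b Pb"
  shows "spec (Plus a b) (Pa + smult 5 Pb + [:3:])" "spec (Minus a b) (Pa + smult 5 Pb + [:3:])"
proof -
  have *: "\<exists>x y. eval a W (s \<circ> \<rho>) = x \<and> eval b W (s \<circ> \<rho>) = y \<and> x \<le> poly Pa B \<and> y \<le> poly Pb B
     \<and> runs W (cmp (Plus a b) \<rho> f) (poly (Pa + smult 5 Pb + [:3:]) B) (s, w) (s(f := x + y), w)
     \<and> runs W (cmp (Minus a b) \<rho> f) (poly (Pa + smult 5 Pb + [:3:]) B) (s, w) (s(f := x - y), w)"
    if \<rho>: "\<And>i. \<rho> i < f" and f: "2 \<le> f" and s: "s 0 = 0" "s 1 = 0" "\<And>r. r \<ge> f \<Longrightarrow> s r = 0"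
    "\<And>i. s (\<rho> i) \<le> B" and W: "\<And>i. length (W i) \<le> B" for W \<rho> f s w B
  proof -
    define x where "x = eval a W (s \<circ> \<rho>)"
    define y where "y = eval b W (s \<circ> \<rho>)"
    have xa: "x \<le> poly Pa B" and ra: "runs W (cmp a \<rho> f) (poly Pa B) (s, w) (s(f := x), w)"
      using specD[OF a, of \<rho> f s B W w] \<rho> f s W unfolding x_def by auto
    define s' where "s' = s(f := x)"
    have \<rho>': "\<rho> i < f + 1" for i using \<rho>[of i] by simp
    have "s' (\<rho> i) = s (\<rho> i)" for i using \<rho>[of i] by (simp add: s'_def)
    then have s'\<rho>: "s' \<circ> \<rho> = s \<circ> \<rho>" "\<And>i. s' (\<rho> i) \<le> B" using s(4) by (auto simp: fun_eq_iff)
    have yb: "y \<le> poly Pb B" and rb: "runs W (cmp b \<rho> (f + 1)) (poly Pb B) (s', w) (s'(f + 1 := y), w)"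
      using specD[OF b, of \<rho> "f + 1" s' B W w, OF \<rho>'] s'\<rho> f s W unfolding y_def by (auto simp: s'_def)
    have p: "runs W (move (f + 1) f) (4 * y + 1) (s'(f + 1 := y), w) (s(f := x + y), w)"
      by (rule runs_mono[OF runs_eq[OF runs_move]]) (use s(3) in \<open>auto simp: s'_def\<close>)
    have m: "runs W (monus (f + 1) f) (4 * y + 1) (s'(f + 1 := y), w) (s(f := x - y), w)"
      by (rule runs_mono[OF runs_eq[OF runs_monus]]) (use s(3) in \<open>auto simp: s'_def\<close>)
    have t: "poly Pa B + (poly Pb B + (4 * y + 1) + 1) + 1 \<le> poly (Pa + smult 5 Pb + [:3:]) B"
      using yb by simp
    show ?thesis
      using xa yb runs_SEQ'[OF ra runs_SEQ'[OF rb[unfolded s'_def] p[unfolded s'_def] order_refl] t]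
        runs_SEQ'[OF ra runs_SEQ'[OF rb[unfolded s'_def] m[unfolded s'_def] order_refl] t]
      by (intro exI[of _ x] exI[of _ y]) (simp add: x_def y_def)
  qed
  show "spec (Plus a b) (Pa + smult 5 Pb + [:3:])"
    by (rule specI) (drule *, assumption+, auto)
  show "spec (Minus a b) (Pa + smult 5 Pb + [:3:])"
    by (rule specI) (drule *, assumption+, auto)
qed

lemma spec_Inp:
  assumes a: "spec a Pa"
  shows "spec (Inp t a) (smult 11 Pa + [:20:])"
proof (rule specI)
  fix W :: "nat \<Rightarrow> bool list" and \<rho> :: "nat \<Rightarrow> nat" and f :: nat and s :: "nat \<Rightarrow> nat" and w :: "bool list" and B :: nat
  assume \<rho>: "\<And>i. \<rho> i < f" and f: "2 \<le> f" and s: "s 0 = 0" "s 1 = 0" "\<And>r. r \<ge> f \<Longrightarrow> s r = 0"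
    "\<And>i. s (\<rho> i) \<le> B" and W: "\<And>i. length (W i) \<le> B"
  define x where "x = eval a W (s \<circ> \<rho>)"
  define v where "v = word_cells (W (of_bool t)) (int x)"
  have xa: "x \<le> poly Pa B" and ra: "runs W (cmp a \<rho> f) (poly Pa B) (s, w) (s(f := x), w)"
    using specD[OF a, of \<rho> f s B W w] \<rho> f s W unfolding x_def by auto
  let ?t = "of_bool t :: nat"
  have tf: "?t < f" using f by (cases t) auto
  have st: "s ?t = 0" using s by (cases t) auto
  have v2: "v \<le> 2" unfolding v_def by (rule word_cells_le)
  define s1 where "s1 = s(?t := x, f + 1 := x)"
  have sy: "symb W (s1(f := y)) ?t = v + (if x = 0 then 3 else 0)" for y
    using tf by (auto simp: symb_def s1_def v_def)
  have 1: "runs W (move2 f ?t (f + 1)) (6 * x + 1) (s(f := x), w) (s1(f := 0), w)"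
    by (rule runs_mono[OF runs_eq[OF runs_move2]]) (use tf st s(3) in \<open>auto simp: s1_def fun_eq_iff\<close>)
  have 2: "runs W (IFT ?t {1, 2, 4, 5} (INC f) skip) 2 (s1(f := 0), w) (s1(f := (if v = 0 then 0 else 1)), w)"
  proof (rule runs_mono[OF runs_IFT])
    assume "symb W (fst (s1(f := 0), w)) ?t \<in> {1, 2, 4, 5}"
    then have "v \<noteq> 0" using in_sets unfolding fst_conv sy v_def by blast
    then show "runs W (INC f) 1 (s1(f := 0), w) (s1(f := (if v = 0 then 0 else 1)), w)"
      by (intro runs_eq[OF runs_INC]) auto
  next
    assume "symb W (fst (s1(f := 0), w)) ?t \<notin> {1, 2, 4, 5}"
    then have "v = 0" using in_sets unfolding fst_conv sy v_def by blast
    then show "runs W skip 1 (s1(f := 0), w) (s1(f := (if v = 0 then 0 else 1)), w)"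
      using runs_skip by simp
  qed simp
  have 3: "runs W (IFT ?t {2, 5} (INC f) skip) 2 (s1(f := (if v = 0 then 0 else 1)), w) (s1(f := v), w)"
  proof (rule runs_mono[OF runs_IFT])
    assume "symb W (fst (s1(f := (if v = 0 then 0 else 1)), w)) ?t \<in> {2, 5}"
    then have "v = 2" using in_sets unfolding fst_conv sy v_def by blast
    then show "runs W (INC f) 1 (s1(f := (if v = 0 then 0 else 1)), w) (s1(f := v), w)"
      by (intro runs_eq[OF runs_INC]) auto
  next
    assume "symb W (fst (s1(f := (if v = 0 then 0 else 1)), w)) ?t \<notin> {2, 5}"
    then have "v \<noteq> 2" using in_sets unfolding fst_conv sy v_def by blast
    then have "(if v = 0 then 0 else 1) = v" using v2 by auto
    then show "runs W skip 1 (s1(f := (if v = 0 then 0 else 1)), w) (s1(f := v), w)"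
      using runs_skip by metis
  qed simp
  have 4: "runs W (monus (f + 1) ?t) (4 * x + 1) (s1(f := v), w) (s(f := v), w)"
    by (rule runs_mono[OF runs_eq[OF runs_monus]]) (use tf st s(3) in \<open>auto simp: s1_def fun_eq_iff\<close>)
  have t: "poly Pa B + (6 * x + 1 + (2 + (2 + (4 * x + 1) + 1) + 1) + 1) + 1 \<le> poly (smult 11 Pa + [:20:]) B"
    using xa by simp
  have "runs W (cmp (Inp t a) \<rho> f) (poly (smult 11 Pa + [:20:]) B) (s, w) (s(f := v), w)"
    unfolding cmp.simps
    by (rule runs_SEQ'[OF ra runs_SEQ'[OF 1 runs_SEQ'[OF 2 runs_SEQ'[OF 3 4 order_refl] order_refl] order_refl] t])
  then show "eval (Inp t a) W (s \<circ> \<rho>) \<le> poly (smult 11 Pa + [:20:]) B \<and>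
    runs W (cmp (Inp t a) \<rho> f) (poly (smult 11 Pa + [:20:]) B) (s, w) (s(f := eval (Inp t a) W (s \<circ> \<rho>)), w)"
    using v2 by (simp add: v_def x_def)
qed

lemma spec_Len: "spec (Len t) [:5, 10:]"
proof (rule specI)
  fix W :: "nat \<Rightarrow> bool list" and \<rho> :: "nat \<Rightarrow> nat" and f :: nat and s :: "nat \<Rightarrow> nat" and w :: "bool list" and B :: nat
  assume f: "2 \<le> f" and s: "s 0 = 0" "s 1 = 0" "\<And>r. r \<ge> f \<Longrightarrow> s r = 0"
    and W: "\<And>i. length (W i) \<le> B"
  let ?t = "of_bool t :: nat" let ?n = "length (W ?t)"
  have tf: "?t < f" using f by (cases t) auto
  have st: "s ?t = 0" using s by (cases t) auto
  let ?x = "\<lambda>i. (s(f := i, f + 1 := i, ?t := i), w)"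
  have "runs W (WHL ?t {1, 2, 4, 5} (SEQ (INC ?t) (SEQ (INC f) (INC (f + 1)))))
      (?n * (5 + 1) + 1) (?x 0) (?x ?n)"
  proof (rule runs_WHL[where x = ?x])
    fix i assume i: "i < ?n"
    have "runs W (INC ?t) 1 (?x i) (s(f := i, f + 1 := i, ?t := Suc i), w)"
      by (rule runs_eq[OF runs_INC]) (use tf in auto)
    moreover have "runs W (INC f) 1 (s(f := i, f + 1 := i, ?t := Suc i), w)
      (s(f := Suc i, f + 1 := i, ?t := Suc i), w)"
      by (rule runs_eq[OF runs_INC]) (use tf in auto)
    moreover have "runs W (INC (f + 1)) 1 (s(f := Suc i, f + 1 := i, ?t := Suc i), w) (?x (Suc i))"
      by (rule runs_eq[OF runs_INC]) (use tf in auto)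
    ultimately show "runs W (SEQ (INC ?t) (SEQ (INC f) (INC (f + 1)))) 5 (?x i) (?x (Suc i))"
      by (rule runs_SEQ'[OF _ runs_SEQ'[OF _ _ order_refl]]) simp
  qed (use tf in \<open>auto simp: symb_def word_cells_def\<close>)
  moreover have "?x 0 = (s, w)" using tf st s(3) by auto
  ultimately have 1: "runs W (WHL ?t {1, 2, 4, 5} (SEQ (INC ?t) (SEQ (INC f) (INC (f + 1)))))
      (6 * ?n + 1) (s, w) (?x ?n)" by (simp add: mult.commute)
  have 2: "runs W (monus (f + 1) ?t) (4 * ?n + 1) (?x ?n) (s(f := ?n), w)"
    by (rule runs_mono[OF runs_eq[OF runs_monus]]) (use tf st s(3) in \<open>auto simp: fun_eq_iff\<close>)
  have "runs W (cmp (Len t) \<rho> f) (poly [:5, 10:] B) (s, w) (s(f := ?n), w)"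
    unfolding cmp.simps by (rule runs_SEQ'[OF 1 2]) (use W[of ?t] in simp)
  then show "eval (Len t) W (s \<circ> \<rho>) \<le> poly [:5, 10:] B \<and>
    runs W (cmp (Len t) \<rho> f) (poly [:5, 10:] B) (s, w) (s(f := eval (Len t) W (s \<circ> \<rho>)), w)"
    using W[of ?t] by simp
qed

lemma spec_V: "spec (Var i) [:3, 10:]"
proof (rule specI)
  fix W :: "nat \<Rightarrow> bool list" and \<rho> :: "nat \<Rightarrow> nat" and f :: nat and s :: "nat \<Rightarrow> nat" and w :: "bool list" and B :: nat
  assume \<rho>: "\<And>i. \<rho> i < f" and f: "2 \<le> f" and s: "\<And>r. r \<ge> f \<Longrightarrow> s r = 0" "\<And>i. s (\<rho> i) \<le> B"
  let ?x = "s (\<rho> i)"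
  have ne: "\<rho> i < f" using \<rho> by auto
  have 1: "runs W (move2 (\<rho> i) f (f + 1)) (6 * ?x + 1) (s, w) (s(\<rho> i := 0, f := ?x, f + 1 := ?x), w)"
    by (rule runs_mono[OF runs_eq[OF runs_move2]]) (use ne s(1) in auto)
  have 2: "runs W (move (f + 1) (\<rho> i)) (4 * ?x + 1) (s(\<rho> i := 0, f := ?x, f + 1 := ?x), w) (s(f := ?x), w)"
    by (rule runs_mono[OF runs_eq[OF runs_move]]) (use ne s(1) in auto)
  have "runs W (cmp (Var i) \<rho> f) (poly [:3, 10:] B) (s, w) (s(f := ?x), w)"
    unfolding cmp.simps by (rule runs_SEQ'[OF 1 2]) (use s(2)[of i] in simp)
  then show "eval (Var i) W (s \<circ> \<rho>) \<le> poly [:3, 10:] B \<and>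
    runs W (cmp (Var i) \<rho> f) (poly [:3, 10:] B) (s, w) (s(f := eval (Var i) W (s \<circ> \<rho>)), w)"
    using s(2)[of i] by simp
qed

lemma spec_Cn: "spec (Cst c) [:2 * c + 1:]"
proof (rule specI)
  fix W :: "nat \<Rightarrow> bool list" and \<rho> :: "nat \<Rightarrow> nat" and f :: nat and s :: "nat \<Rightarrow> nat" and w :: "bool list" and B :: nat
  assume s: "\<And>r. r \<ge> f \<Longrightarrow> s r = 0"
  show "eval (Cst c) W (s \<circ> \<rho>) \<le> poly [:2 * c + 1:] B \<and>
    runs W (cmp (Cst c) \<rho> f) (poly [:2 * c + 1:] B) (s, w) (s(f := eval (Cst c) W (s \<circ> \<rho>)), w)"
    using runs_adds[of W f c s w] s by simp
qed

lemma spec_ex: "\<exists>P. spec e P"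
  by (induction e) (blast intro: spec_V spec_Cn spec_binary spec_Sm spec_Inp spec_Len)+

text \<open>With all variables mapped to register 0, which holds 0, free variables are read as
  0.\<close>

lemma spec_top:
  assumes "spec e P" "\<And>i. length (W i) \<le> B" "2 \<le> f"
  shows "eval e W (\<lambda>_. 0) \<le> poly P B \<and>
    runs W (cmp e (\<lambda>_. 0) f) (poly P B) (\<lambda>_. 0, w) ((\<lambda>_. 0)(f := eval e W (\<lambda>_. 0)), w)"
  using specD[OF assms(1), of "\<lambda>_. 0" f "\<lambda>_. 0" B W w] assms(2,3) by (simp add: comp_def)

lemma length_words: "length (words ws i) \<le> sum_list (map length ws)"
  by (auto simp: words_def intro!: member_le_sum_list)

lemma accepts_iff:
  assumes "halted M (run M ws T)" "turing_machine M"
  shows "accepts M ws \<longleftrightarrow> fst (run M ws T) = accept_state M"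
proof
  assume "accepts M ws"
  then obtain t where t: "fst (run M ws t) = accept_state M" unfolding accepts_def by blast
  then have "halted M (run M ws t)" by (simp add: halted_def)
  then show "fst (run M ws T) = accept_state M"
    using t halted_run_mono[of M ws t T] halted_run_mono[OF assms(1), of t] by (cases "t \<le> T") auto
qed (auto simp: accepts_def)

lemma regs_bound: "\<exists>m. regs c \<subseteq> {..<m} \<and> 2 < m"
proof -
  obtain k where "regs c \<subseteq> {..<k}" using finite_regs finite_nat_iff_bounded by blast
  then show ?thesis by (intro exI[of _ "max k 3"]) auto
qed

text \<open>The value is computed into register 2, the one that decides acceptance.\<close>

lemma NP_I:
  assumes L: "\<And>x. x \<in> L \<longleftrightarrow> (\<exists>u. length u \<le> poly p (length x) \<and> eval e (words [x, u]) (\<lambda>_. 0) \<noteq> 0)"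
  shows "L \<in> NP"
proof -
  let ?c = "cmp e (\<lambda>_. 0) 2"
  obtain P where P: "spec e P" using spec_ex by blast
  obtain m where m: "regs ?c \<subseteq> {..<m}" "2 < m" using regs_bound by blast
  let ?M = "mach ?c m"
  have r: "run ?M ws (poly P B + 2) = (if eval e (words ws) (\<lambda>_. 0) \<noteq> 0 then 1 else 2, tapes (words ws) m ((\<lambda>_. 0)(2 := eval e (words ws) (\<lambda>_. 0)), []))"
    "halted ?M (run ?M ws (poly P B + 2))" if "length ws = 2" "B = sum_list (map length ws)" for ws B
    using run_mach[where m = m, OF spec_top[OF P, of "words ws" B 2 "[]", THEN conjunct2] m] that length_words[of ws] m
    by auto
  have "poly_time_machine 2 ?M"
    unfolding poly_time_machine_def
    by (intro conjI turing_machine_mach exI[of _ "P + [:2:]"]) (use m r(2) in \<open>auto simp: mach_def\<close>)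
  moreover have "accepts ?M [x, u] \<longleftrightarrow> eval e (words [x, u]) (\<lambda>_. 0) \<noteq> 0" for x u
    using accepts_iff[OF r(2)[of "[x, u]", OF _ refl] turing_machine_mach] r(1)[of "[x, u]", OF _ refl]
    by (simp add: mach_def)
  ultimately show ?thesis unfolding NP_def using L by blast
qed

text \<open>Symbol 0 stands for no output, so that the output length may be overestimated.\<close>

definition emit :: "nat \<Rightarrow> bool list" where
  "emit v = (if v = 0 then [] else if v = 1 then [False] else [True])"

text \<open>Register 2 holds the current output position and serves as variable 0 of
  \<open>e\<close>, register 3 counts the positions left, and register 4 receives the code of the
  symbol to emit.\<close>

lemma poly_time_computableI:
  assumes f: "\<And>x. f x = concat (map (\<lambda>p. emit (eval e (words [x]) (case_nat p (\<lambda>_. 0))))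
     [0..<eval l (words [x]) (\<lambda>_. 0)])"
  shows "poly_time_computable f"
proof -
  let ?b = "SEQ (cmp e (case_nat 2 (\<lambda>_. 0)) 4) (SEQ (IFT 4 NZ (SEQ (DEC 4)
     (SEQ (IFT 4 NZ (OUT True) (OUT False)) (clear 4))) skip) (INC 2))"
  let ?c = "SEQ (cmp l (\<lambda>_. 0) 3) (WHL 3 NZ (SEQ (DEC 3) ?b))"
  obtain P where P: "spec e P" using spec_ex by blast
  obtain L where L: "spec l L" using spec_ex by blast
  obtain m where m: "regs ?c \<subseteq> {..<m}" "2 < m" using regs_bound by blast
  let ?M = "mach ?c m"
  define Q where "Q = L + L * (smult 3 (pcompose P ([:0, 1:] + L)) + [:13:]) + [:2:]"
  have R: "\<exists>\<sigma>. runs (words [x]) ?c (poly Q (length x)) ((\<lambda>_. 0), []) (\<sigma>, f x)" for x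
  proof -
    let ?W = "words [x]"
    define B where "B = length x"
    have W: "length (?W i) \<le> B" for i using length_words[of "[x]" i] by (simp add: B_def)
    define n where "n = eval l ?W (\<lambda>_. 0)"
    define v where "v i = eval e ?W (case_nat i (\<lambda>_. 0))" for i
    have nL: "n \<le> poly L B" and rl: "runs ?W (cmp l (\<lambda>_. 0) 3) (poly L B) (\<lambda>_. 0, []) ((\<lambda>_. 0)(3 := n), [])"
      using spec_top[OF L, of ?W B 3 "[]"] W unfolding n_def by auto
    define Z where "Z = poly P (B + poly L B)"
    let ?w = "\<lambda>i. concat (map (\<lambda>p. emit (v p)) [0..<i])"
    let ?x = "\<lambda>i. ((\<lambda>_. 0)(2 := i, 3 := n - i), ?w i)"
    have body: "runs ?W (SEQ (DEC 3) ?b) (3 * Z + 12) (?x i) (?x (Suc i))" if i: "i < n" for i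
    proof -
      define s where "s = (\<lambda>_::nat. 0::nat)(2 := i, 3 := n - Suc i)"
      have c: "s \<circ> case_nat 2 (\<lambda>_. 0) = case_nat i (\<lambda>_. 0)"
        by (auto simp: s_def fun_eq_iff split: nat.split)
      have 0: "case_nat 2 (\<lambda>_. 0) j < (4::nat)" for j :: nat by (cases j) auto
      have le: "s (case_nat 2 (\<lambda>_. 0) j) \<le> B + poly L B" for j
        using i nL by (cases j) (auto simp: s_def)
      note S = specD[OF P, of "case_nat 2 (\<lambda>_. 0)" 4 s "B + poly L B" ?W "?w i", unfolded c, folded v_def Z_def, OF 0 _ _ _ _ le]
      have vZ: "v i \<le> Z" and rb: "runs ?W (cmp e (case_nat 2 (\<lambda>_. 0)) 4) Z (s, ?w i) (s(4 := v i), ?w i)"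
        using S W by (auto simp: s_def trans_le_add1)
      have rI: "runs ?W (IFT 4 NZ (SEQ (DEC 4) (SEQ (IFT 4 NZ (OUT True) (OUT False)) (clear 4))) skip)
         (2 * Z + 6 + 1) (s(4 := v i), ?w i) (s, ?w i @ emit (v i))"
      proof (rule runs_IFT)
        assume "symb ?W (fst (s(4 := v i), ?w i)) 4 \<in> NZ"
        then have v0: "v i \<noteq> 0" by (simp add: sym_less_3)
        have 1: "runs ?W (DEC 4) 1 (s(4 := v i), ?w i) (s(4 := v i - 1), ?w i)"
          by (rule runs_eq[OF runs_DEC]) auto
        have 2: "runs ?W (IFT 4 NZ (OUT True) (OUT False)) (1 + 1) (s(4 := v i - 1), ?w i)
            (s(4 := v i - 1), ?w i @ emit (v i))"
          by (rule runs_IFT; rule runs_eq[OF runs_OUT]) (use v0 in \<open>auto simp: sym_less_3 emit_def\<close>)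
        have 3: "runs ?W (clear 4) (2 * (v i - 1) + 1) (s(4 := v i - 1), ?w i @ emit (v i)) (s, ?w i @ emit (v i))"
          by (rule runs_mono[OF runs_eq[OF runs_clear]]) (auto simp: s_def)
        show "runs ?W (SEQ (DEC 4) (SEQ (IFT 4 NZ (OUT True) (OUT False)) (clear 4))) (2 * Z + 6)
           (s(4 := v i), ?w i) (s, ?w i @ emit (v i))"
          by (rule runs_SEQ'[OF 1 runs_SEQ'[OF 2 3 order_refl]]) (use vZ in simp)
      next
        assume "symb ?W (fst (s(4 := v i), ?w i)) 4 \<notin> NZ"
        then have "v i = 0" by (simp add: sym_less_3)
        then have e: "(s(4 := v i), ?w i) = (s, ?w i @ emit (v i))" by (auto simp: s_def emit_def)
        show "runs ?W skip (2 * Z + 6) (s(4 := v i), ?w i) (s, ?w i @ emit (v i))"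
          unfolding e by (rule runs_mono[OF runs_skip]) simp
      qed
      have rD: "runs ?W (DEC 3) 1 (?x i) (s, ?w i)"
        by (rule runs_eq[OF runs_DEC]) (auto simp: s_def)
      have rN: "runs ?W (INC 2) 1 (s, ?w i @ emit (v i)) (?x (Suc i))"
        by (rule runs_eq[OF runs_INC]) (auto simp: s_def)
      show ?thesis
        by (rule runs_SEQ'[OF rD runs_SEQ'[OF rb runs_SEQ'[OF rI rN order_refl] order_refl]]) linarith
    qed
    have "runs ?W (WHL 3 NZ (SEQ (DEC 3) ?b)) (n * (3 * Z + 12 + 1) + 1) (?x 0) (?x n)"
      by (rule runs_NZ[where x = ?x, OF body]) simp_all
    moreover have "?x 0 = ((\<lambda>_::nat. 0)(3 := n), [])" by auto
    ultimately have lo: "runs ?W (WHL 3 NZ (SEQ (DEC 3) ?b)) (n * (3 * Z + 12 + 1) + 1) ((\<lambda>_. 0)(3 := n), []) (?x n)"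
      by simp
    have "?w n = f x" unfolding f n_def v_def ..
    moreover have "runs ?W ?c (poly Q B) ((\<lambda>_. 0), []) (?x n)"
      by (rule runs_SEQ'[OF rl lo])
        (use mult_le_mono[OF nL, of "13 + 3 * Z" "13 + 3 * Z"] in \<open>simp add: Q_def poly_pcompose Z_def[symmetric] algebra_simps\<close>)
    ultimately show ?thesis unfolding B_def by auto
  qed
  have r: "\<exists>\<sigma>. run ?M [x] (poly Q (length x) + 2) = (if \<sigma> 2 \<noteq> 0 then 1 else 2, tapes (words [x]) m (\<sigma>, f x))
     \<and> halted ?M (run ?M [x] (poly Q (length x) + 2))" for x
    using R[of x] run_mach[where m = m and ws = "[x]", OF _ m] m(2) by fastforce
  have la: "fst (last (tapes W m s)) = word_cells (snd s)" for W s
    by (simp add: tapes_def)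
  have "poly_time_machine 1 ?M"
    unfolding poly_time_machine_def
  proof (intro conjI turing_machine_mach exI[of _ "Q + [:2:]"] allI impI)
    fix ws :: "bool list list" assume "length ws = 1"
    then obtain x where "ws = [x]" by (cases ws) auto
    then show "halted ?M (run ?M ws (poly (Q + [:2:]) (sum_list (map length ws))))"
      using r[of x] by auto
  qed (use m in \<open>simp add: mach_def\<close>)
  moreover have "computes ?M f"
    unfolding computes_def
  proof
    fix x show "\<exists>t. halted ?M (run ?M [x] t) \<and> fst (last (snd (run ?M [x] t))) = word_cells (f x)"
    proof -
      obtain \<sigma> where s: "run ?M [x] (poly Q (length x) + 2)
          = (if \<sigma> 2 \<noteq> 0 then 1 else 2, tapes (words [x]) m (\<sigma>, f x))"
        "halted ?M (run ?M [x] (poly Q (length x) + 2))" using r[of x] by blast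
      have "fst (last (snd (run ?M [x] (poly Q (length x) + 2)))) = word_cells (f x)"
        unfolding s(1) snd_conv la ..
      then show ?thesis using s(2) by blast
    qed
  qed
  ultimately show ?thesis unfolding poly_time_computable_def by blast
qed

section \<open>Closure properties of functions and predicates given by expressions\<close>

fun ren :: "(nat \<Rightarrow> nat) \<Rightarrow> ex \<Rightarrow> ex" where
  "ren \<rho> (Var i) = Var (\<rho> i)"
| "ren \<rho> (Cst c) = Cst c"
| "ren \<rho> (Plus a b) = Plus (ren \<rho> a) (ren \<rho> b)"
| "ren \<rho> (Minus a b) = Minus (ren \<rho> a) (ren \<rho> b)"
| "ren \<rho> (Sm a b) = Sm (ren \<rho> a) (ren (case_nat 0 (\<lambda>i. Suc (\<rho> i))) b)"
| "ren \<rho> (Inp t a) = Inp t (ren \<rho> a)"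
| "ren \<rho> (Len t) = Len t"

lemma eval_ren: "eval (ren \<rho> e) W s = eval e W (\<lambda>i. s (\<rho> i))"
proof (induction e arbitrary: \<rho> s)
  case (Sm a b)
  have "(\<lambda>i. case_nat j s (case_nat 0 (\<lambda>i. Suc (\<rho> i)) i)) = case_nat j (\<lambda>i. s (\<rho> i))" for j
    by (auto split: nat.split)
  then show ?case using Sm by simp
qed simp_all

type_synonym sem = "(nat \<Rightarrow> bool list) \<Rightarrow> (nat \<Rightarrow> nat) \<Rightarrow> nat"

text \<open>The semantic side of \<open>ex\<close>: computability is proved by following the shape
  of a definition, without writing the expression down.\<close>

definition dfun :: "sem \<Rightarrow> bool" where "dfun f \<longleftrightarrow> (\<exists>e. f = eval e)"

lemma D_ex: "dfun f \<Longrightarrow> \<exists>e. \<forall>W s. eval e W s = f W s"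
  unfolding dfun_def by metis

lemma D_I: "(\<And>W s. f W s = eval e W s) \<Longrightarrow> dfun f"
  unfolding dfun_def by blast

lemma D_weak: "dfun F \<Longrightarrow> dfun (\<lambda>W s. F W (\<lambda>i. s (\<rho> i)))"
  by (drule D_ex, erule exE, rule_tac e = "ren \<rho> e" in D_I) (simp add: eval_ren)

lemma D_var: "dfun (\<lambda>W s. s i)" by (rule D_I[of _ "Var i"]) simp
lemma D_const: "dfun (\<lambda>W s. c)" by (rule D_I[of _ "Cst c"]) simp
lemma D_len: "dfun (\<lambda>W s. length (W 0))" "dfun (\<lambda>W s. length (W (Suc 0)))"
  by (rule D_I[of _ "Len False"], simp) (rule D_I[of _ "Len True"], simp)

lemma D_plus: "dfun F \<Longrightarrow> dfun G \<Longrightarrow> dfun (\<lambda>W s. F W s + G W s)"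
  by (drule D_ex, drule D_ex, elim exE, rule_tac e = "Plus e ea" in D_I) simp

lemma D_minus: "dfun F \<Longrightarrow> dfun G \<Longrightarrow> dfun (\<lambda>W s. F W s - G W s)"
  by (drule D_ex, drule D_ex, elim exE, rule_tac e = "Minus e ea" in D_I) simp

lemma D_Suc: "dfun F \<Longrightarrow> dfun (\<lambda>W s. Suc (F W s))"
  using D_plus[OF _ D_const[of 1]] by simp

lemma D_inp: "dfun F \<Longrightarrow> dfun (\<lambda>W s. word_cells (W 0) (int (F W s)))"
  "dfun F \<Longrightarrow> dfun (\<lambda>W s. word_cells (W (Suc 0)) (int (F W s)))"
  by (drule D_ex, erule exE, rule_tac e = "Inp False e" in D_I, simp)
     (drule D_ex, erule exE, rule_tac e = "Inp True e" in D_I, simp)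

text \<open>The body is a function of the environment extended by the summation index: variable 0 is
  the index and the others move up by one.\<close>

lemma D_sum:
  assumes "dfun F" "dfun (\<lambda>W s. B W (\<lambda>i. s (Suc i)) (s 0))"
  shows "dfun (\<lambda>W s. \<Sum>j<F W s. B W s j)"
proof -
  obtain a where a: "\<And>W s. eval a W s = F W s" using D_ex[OF assms(1)] by blast
  obtain b where b: "\<And>W s. eval b W s = B W (\<lambda>i. s (Suc i)) (s 0)" using D_ex[OF assms(2)] by blast
  show ?thesis by (rule D_I[of _ "Sm a b"]) (simp add: a b)
qed

lemma D_mult:
  assumes "dfun F" "dfun G"
  shows "dfun (\<lambda>W s. F W s * G W s)"
  using D_sum[OF assms(1) D_weak[OF assms(2), of Suc]] by simp

definition dpred :: "((nat \<Rightarrow> bool list) \<Rightarrow> (nat \<Rightarrow> nat) \<Rightarrow> bool) \<Rightarrow> bool" where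
  "dpred P \<longleftrightarrow> dfun (\<lambda>W s. of_bool (P W s))"

lemma D_of_bool: "dpred P \<Longrightarrow> dfun (\<lambda>W s. of_bool (P W s))" by (simp add: dpred_def)

lemma D_cong:
  assumes "dfun F" "\<And>W s. F W s = G W s"
  shows "dfun G"
proof -
  have "F = G" using assms(2) by (intro ext)
  then show ?thesis using assms(1) by simp
qed

lemma DP_cong: "dfun F \<Longrightarrow> (\<And>W s. F W s = of_bool (P W s)) \<Longrightarrow> dpred P"
  unfolding dpred_def by (rule D_cong)

lemma DP_not:
  assumes "dpred P"
  shows "dpred (\<lambda>W s. \<not> P W s)"
  by (rule DP_cong[OF D_minus[OF D_const[of 1] D_of_bool[OF assms]]]) simp

lemma DP_conj:
  assumes "dpred P" "dpred Q"
  shows "dpred (\<lambda>W s. P W s \<and> Q W s)"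
  by (rule DP_cong[OF D_mult[OF assms[THEN D_of_bool]]]) simp

lemma DP_disj:
  assumes "dpred P" "dpred Q"
  shows "dpred (\<lambda>W s. P W s \<or> Q W s)"
  using DP_not[OF DP_conj[OF assms[THEN DP_not]]] by simp

lemma DP_imp:
  assumes "dpred P" "dpred Q"
  shows "dpred (\<lambda>W s. P W s \<longrightarrow> Q W s)"
  using DP_disj[OF DP_not[OF assms(1)] assms(2)] by (simp only: imp_conv_disj)

text \<open>In truncated arithmetic \<open>F - G\<close> vanishes iff \<open>F \<le> G\<close>, so
  \<open>1 - (F - G)\<close> is the indicator.\<close>

lemma DP_le:
  assumes "dfun F" "dfun G"
  shows "dpred (\<lambda>W s. F W s \<le> G W s)"
  by (rule DP_cong[OF D_minus[OF D_const[of 1] D_minus[OF assms]]]) auto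

lemma DP_less:
  assumes "dfun F" "dfun G"
  shows "dpred (\<lambda>W s. F W s < G W s)"
  using DP_le[OF D_Suc[OF assms(1)] assms(2)] by (simp only: Suc_le_eq)

lemma DP_eq:
  assumes "dfun F" "dfun G"
  shows "dpred (\<lambda>W s. F W s = G W s)"
  using DP_conj[OF DP_le[OF assms] DP_le[OF assms(2,1)]] by (simp only: order_eq_iff)

lemma DP_iff:
  assumes "dpred P" "dpred Q"
  shows "dpred (\<lambda>W s. P W s = Q W s)"
  using DP_conj[OF DP_imp[OF assms] DP_imp[OF assms(2,1)]] by (simp only: iff_conv_conj_imp)

lemma DP_ex:
  assumes "dfun F" "dpred (\<lambda>W s. P W (\<lambda>i. s (Suc i)) (s 0))"
  shows "dpred (\<lambda>W s. \<exists>j<F W s. P W s j)"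
proof -
  have *: "((0::nat) < (\<Sum>j<n. of_bool (Q j))) = (\<exists>j<n. Q j)" for n :: nat and Q
    by (induction n) (auto simp: less_Suc_eq)
  have "dpred (\<lambda>W s. (0::nat) < (\<Sum>j<F W s. of_bool (P W s j)))"
    by (intro DP_less D_const D_sum assms(1) D_of_bool) (rule assms(2))
  then show ?thesis unfolding * .
qed

lemma DP_all:
  assumes "dfun F" "dpred (\<lambda>W s. P W (\<lambda>i. s (Suc i)) (s 0))"
  shows "dpred (\<lambda>W s. \<forall>j<F W s. P W s j)"
  using DP_not[OF DP_ex[OF assms(1), of "\<lambda>W s j. \<not> P W s j", OF DP_not[OF assms(2)]]] by simp

lemma D_if: "dpred P \<Longrightarrow> dfun F \<Longrightarrow> dfun G \<Longrightarrow> dfun (\<lambda>W s. if P W s then F W s else G W s)"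
proof -
  assume "dpred P" "dfun F" "dfun G"
  then have "dfun (\<lambda>W s. of_bool (P W s) * F W s + of_bool (\<not> P W s) * G W s)"
    by (intro D_plus D_mult D_of_bool DP_not)
  moreover have "(\<lambda>W s. of_bool (P W s) * F W s + of_bool (\<not> P W s) * G W s)
    = (\<lambda>W s. if P W s then F W s else G W s)" by (intro ext) simp
  ultimately show ?thesis by simp
qed

text \<open>The quotient counts the positive multiples of \<open>b\<close> up to \<open>a\<close>;
  for \<open>b = 0\<close> both sides are 0.\<close>

lemma sum_of_bool_div: "(\<Sum>j<a. of_bool (0 < b \<and> (j + 1) * b \<le> a)) = a div (b::nat)"
proof (cases "b = 0")
  case False
  have "(\<Sum>j<a. of_bool (0 < b \<and> (j + 1) * b \<le> a)) = card {j\<in>{..<a}. 0 < b \<and> (j + 1) * b \<le> a}"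
    by (simp only: sum_of_bool_eq finite_lessThan) (simp add: Int_def)
  also have "{j\<in>{..<a}. 0 < b \<and> (j + 1) * b \<le> a} = {..<a div b}"
  proof (intro set_eqI iffI)
    fix j assume "j \<in> {..<a div b}"
    then have "j + 1 \<le> a div b" by simp
    then have "(j + 1) * b \<le> a" using False less_eq_div_iff_mult_less_eq by blast
    moreover have "j < a" using \<open>j + 1 \<le> a div b\<close> div_le_dividend[of a b] by linarith
    ultimately show "j \<in> {j\<in>{..<a}. 0 < b \<and> (j + 1) * b \<le> a}" using False by simp
  next
    fix j assume "j \<in> {j\<in>{..<a}. 0 < b \<and> (j + 1) * b \<le> a}"
    then have "j + 1 \<le> a div b" using False less_eq_div_iff_mult_less_eq by blast
    then show "j \<in> {..<a div b}" by simp
  qed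
  finally show ?thesis by simp
qed simp

lemma D_div:
  assumes "dfun F" "dfun G"
  shows "dfun (\<lambda>W s. F W s div G W s)"
proof (rule D_cong)
  show "dfun (\<lambda>W s. \<Sum>j<F W s. of_bool (0 < G W s \<and> (j + 1) * G W s \<le> F W s))"
    by (intro D_sum D_of_bool DP_conj DP_less DP_le D_mult D_plus D_var D_const assms
        D_weak[OF assms(1), of Suc] D_weak[OF assms(2), of Suc])
qed (rule sum_of_bool_div)

lemma D_mod:
  assumes "dfun F" "dfun G"
  shows "dfun (\<lambda>W s. F W s mod G W s)"
  by (rule D_cong[OF D_minus[OF assms(1) D_mult[OF D_div[OF assms] assms(2)]]])
    (simp add: minus_div_mult_eq_mod)

text \<open>\<open>T\<close> is arbitrary, since finitely many values can be wired into an
  expression. In this way objects obtained by choice, such as enumerations of tiles or of gadget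
  edges, enter computable functions.\<close>

lemma D_table:
  assumes "dfun F" "\<And>W s. F W s < c"
  shows "dfun (\<lambda>W s. T (F W s))"
proof -
  have "dfun (\<lambda>W s. \<Sum>v<m. of_bool (F W s = v) * T v)" for m
    by (induction m) (auto intro!: D_const D_plus D_mult D_of_bool DP_eq assms(1))
  from this[of c] show ?thesis
  proof (rule D_cong)
    fix W s
    have "(\<Sum>v<c. of_bool (F W s = v) * T v) = (\<Sum>v<c. if F W s = v then T v else 0)"
      by (intro sum.cong) auto
    then show "(\<Sum>v<c. of_bool (F W s = v) * T v) = T (F W s)" using assms(2) by simp
  qed
qed

lemma DP_table:
  assumes "dfun F" "\<And>W s. F W s < c"
  shows "dpred (\<lambda>W s. T (F W s))"
  unfolding dpred_def by (rule D_table[OF assms])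

lemma D_poly:
  assumes "dfun F"
  shows "dfun (\<lambda>W s. poly p (F W s))"
  by (induction p) (auto intro!: D_const D_plus D_mult assms)

lemmas D_intros = D_plus D_minus D_Suc D_inp D_mult D_of_bool D_if D_div D_mod D_poly D_len D_sum
  DP_not DP_conj DP_disj DP_imp DP_le DP_less DP_eq DP_iff DP_ex DP_all

section \<open>Even cycles in line graphs\<close>

text \<open>By distinctness consecutive members are different edges, so that meeting is adjacency in
  the line graph of \<open>F\<close>.\<close>

definition lcyc :: "'a set set \<Rightarrow> 'a set list \<Rightarrow> bool" where
  "lcyc F c \<longleftrightarrow> 3 \<le> length c \<and> distinct c \<and> set c \<subseteq> F \<and>
     (\<forall>i<length c. c ! i \<inter> c ! (Suc i mod length c) \<noteq> {})"

definition noeven :: "'a set set \<Rightarrow> bool" where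
  "noeven F \<longleftrightarrow> (\<forall>c. lcyc F c \<longrightarrow> odd (length c))"

definition cedge :: "'a list \<Rightarrow> nat \<Rightarrow> 'a set" where
  "cedge c i = {c ! i, c ! (Suc i mod length c)}"

definition cedges :: "'a list \<Rightarrow> 'a set set" where
  "cedges c = cedge c ` {..<length c}"

definition vcyc :: "'a set set \<Rightarrow> 'a list \<Rightarrow> bool" where
  "vcyc F c \<longleftrightarrow> 3 \<le> length c \<and> distinct c \<and> cedges c \<subseteq> F"

text \<open>Disjoint unions of subcubic trees and odd cycles, where \<open>C\<close> is the set of vertices on cycles. A leaf
  may be attached to a new vertex \<open>u\<close>, which starts a new tree.\<close>

inductive oc :: "'a set set \<Rightarrow> 'a set \<Rightarrow> bool" where
  oc_empty: "oc {} {}"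
| oc_leaf: "oc F C \<Longrightarrow> v \<notin> \<Union>F \<Longrightarrow> v \<noteq> u \<Longrightarrow> u \<notin> C \<Longrightarrow> card {e \<in> F. u \<in> e} \<le> 2 \<Longrightarrow> oc (insert {u, v} F) C"
| oc_cycle: "oc F C \<Longrightarrow> 3 \<le> length c \<Longrightarrow> distinct c \<Longrightarrow> odd (length c) \<Longrightarrow> set c \<inter> \<Union>F = {} \<Longrightarrow>
    oc (F \<union> cedges c) (C \<union> set c)"

lemma Suc_mod: "i < n \<Longrightarrow> Suc i mod n = (if Suc i = n then 0 else Suc i)"
  by auto

lemma mod_add_inj:
  assumes "a < n" "b < n" "(j + a) mod n = (j + b) mod (n::nat)"
  shows "a = b"
proof -
  have *: "x = y" if "x \<le> y" "y < n" "(j + y) mod n = (j + x) mod n" for x y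
  proof -
    have "n dvd (j + y) - (j + x)" using that mod_eq_dvd_iff_nat[of "j + x" "j + y" n] by simp
    then show ?thesis using that dvd_imp_le[of n "y - x"] by (cases "y = x") auto
  qed
  show ?thesis using *[of a b] *[of b a] assms by (cases "a \<le> b") auto
qed

lemma finite_Union_2:
  assumes "finite F" "\<And>e. e \<in> F \<Longrightarrow> card e = 2"
  shows "finite (\<Union>F)"
proof (rule finite_Union)
  fix e assume "e \<in> F"
  then have "card e > 0" using assms(2) by simp
  then show "finite e" by (rule card_ge_0_finite)
qed (rule assms)

lemma cedge_meet:
  assumes "distinct c" "3 \<le> length c" "i < length c" "j < length c" "i \<noteq> j" "cedge c i \<inter> cedge c j \<noteq> {}"
  shows "j = Suc i \<or> i = Suc j \<or> (i = 0 \<and> Suc j = length c) \<or> (j = 0 \<and> Suc i = length c)"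
  using assms by (cases "c = []") (auto simp: cedge_def nth_eq_iff_index_eq Suc_mod split: if_splits)

lemma cedge_eq:
  assumes "distinct c" "3 \<le> length c" "i < length c" "j < length c" "cedge c i = cedge c j"
  shows "i = j"
proof (rule ccontr)
  assume "i \<noteq> j"
  moreover have "c \<noteq> []" using assms by auto
  ultimately show False using assms
    by (auto simp: cedge_def doubleton_eq_iff nth_eq_iff_index_eq Suc_mod split: if_splits)
qed

lemma card_cedge: "distinct c \<Longrightarrow> 3 \<le> length c \<Longrightarrow> i < length c \<Longrightarrow> card (cedge c i) = 2"
  by (cases "c = []") (auto simp: cedge_def nth_eq_iff_index_eq Suc_mod)

lemma Union_cedges: "\<Union>(cedges c) = set c"
proof
  show "\<Union>(cedges c) \<subseteq> set c"
    by (auto simp: cedges_def cedge_def) (metis bot_nat_0.not_eq_extremum list.size(3) mod_less_divisor not_less0 nth_mem)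
  show "set c \<subseteq> \<Union>(cedges c)" by (auto simp: cedges_def cedge_def in_set_conv_nth)
qed

lemma card_cedges: "distinct c \<Longrightarrow> 3 \<le> length c \<Longrightarrow> card (cedges c) = length c"
  unfolding cedges_def by (subst card_image) (auto intro!: inj_onI cedge_eq[of c])

lemma finite_cedges: "finite (cedges c)" by (simp add: cedges_def)

text \<open>The free starting point \<open>j\<close> makes it possible to open the cycle at a given
  vertex and to insert a further edge there.\<close>

lemma vcyc_lcyc:
  assumes "vcyc F c" "j < length c"
  defines "n \<equiv> length c"
  defines "l \<equiv> map (\<lambda>i. cedge c ((j + i) mod n)) [0..<n]"
  shows "distinct l" "set l = cedges c" "length l = n"
    "\<And>i. i < n \<Longrightarrow> c ! ((j + Suc i) mod n) \<in> l ! i \<inter> cedge c ((j + Suc i) mod n)"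
proof -
  have n: "3 \<le> n" "distinct c" using assms by (auto simp: vcyc_def)
  note inj = mod_add_inj[of _ n]
  show "length l = n" by (simp add: l_def)
  have lt: "(j + i) mod n < n" for i using n by simp
  show "distinct l" unfolding l_def distinct_map using n lt inj
    by (auto intro!: inj_onI dest!: cedge_eq[of c, rotated 4] simp: n_def)
  have "(\<lambda>i. (j + i) mod n) ` {..<n} = {..<n}"
    by (rule endo_inj_surj) (use lt inj in \<open>auto intro!: inj_onI\<close>)
  then have "cedge c ` {..<n} = cedge c ` (\<lambda>i. (j + i) mod n) ` {..<n}" by simp
  then show "set l = cedges c"
    by (simp add: l_def cedges_def n_def image_image atLeast0LessThan)
  show "c ! ((j + Suc i) mod n) \<in> l ! i \<inter> cedge c ((j + Suc i) mod n)" if "i < n" for i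
    using that by (simp add: l_def cedge_def n_def[symmetric] mod_Suc_eq)
qed

section \<open>Structure of edge sets whose line graph has no even cycle\<close>

lemma vcyc_odd:
  assumes "vcyc F c" "noeven F"
  shows "odd (length c)"
proof -
  have c: "3 \<le> length c" "cedges c \<subseteq> F" "0 < length c" using assms(1) by (auto simp: vcyc_def)
  let ?l = "map (\<lambda>i. cedge c ((0 + i) mod length c)) [0..<length c]"
  note l = vcyc_lcyc[OF assms(1) c(3)]
  have "lcyc F ?l"
    unfolding lcyc_def
  proof (intro conjI allI impI)
    fix i assume "i < length ?l"
    then have i: "i < length c" by simp
    have "?l ! (Suc i mod length ?l) = cedge c ((0 + Suc i) mod length c)"
      using c by simp
    then show "?l ! i \<inter> ?l ! (Suc i mod length ?l) \<noteq> {}" using l(4)[OF i] by auto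
  qed (use l c in auto)
  then have "odd (length ?l)" using assms(2) unfolding noeven_def by blast
  then show ?thesis by simp
qed

lemma vcyc_isolated:
  assumes "vcyc F c" "noeven F" "w \<in> set c" "f \<in> F" "w \<in> f"
  shows "f \<in> cedges c"
proof (rule ccontr)
  assume f: "f \<notin> cedges c"
  have c: "3 \<le> length c" "cedges c \<subseteq> F" using assms(1) by (auto simp: vcyc_def)
  obtain j where j: "j < length c" "c ! j = w" using assms(3) by (auto simp: in_set_conv_nth)
  let ?n = "length c"
  \<comment> \<open>Started at \<open>w\<close>, the list has \<open>w\<close> in both its first and
    its last edge, so appending \<open>f\<close> closes up to a cycle of length
    \<open>length c + 1\<close>.\<close>
  define l where "l = map (\<lambda>i. cedge c ((j + i) mod ?n)) [0..<?n]"
  note l = vcyc_lcyc[OF assms(1) j(1), folded l_def]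
  have "lcyc F (l @ [f])"
    unfolding lcyc_def
  proof (intro conjI allI impI)
    fix i assume "i < length (l @ [f])"
    then consider "Suc i < ?n" | "Suc i = ?n" | "i = ?n" using l(3) by fastforce
    then show "(l @ [f]) ! i \<inter> (l @ [f]) ! (Suc i mod length (l @ [f])) \<noteq> {}"
    proof cases
      case 1
      then have "(l @ [f]) ! (Suc i mod length (l @ [f])) = cedge c ((j + Suc i) mod ?n)"
        using l(3) by (simp add: nth_append l_def)
      then show ?thesis using l(4)[of i] 1 l(3) by (auto simp: nth_append)
    next
      case 2
      then have "(l @ [f]) ! (Suc i mod length (l @ [f])) = f" using l(3) by (simp add: nth_append)
      moreover have "w \<in> l ! i" using l(4)[of i] 2 j by auto
      ultimately show ?thesis using assms(5) 2 l(3) by (auto simp: nth_append)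
    next
      case 3
      then have "(l @ [f]) ! (Suc i mod length (l @ [f])) = cedge c j"
        using l(3) c j by (cases "c = []") (auto simp: nth_append, auto simp: l_def)
      moreover have "w \<in> cedge c j" using j by (simp add: cedge_def)
      ultimately show ?thesis using assms(5) 3 l(3) by (auto simp: nth_append)
    qed
  qed (use l f c assms(4) in auto)
  then have "odd (length (l @ [f]))" using assms(2) unfolding noeven_def by blast
  then show False using vcyc_odd[OF assms(1,2)] l(3) by simp
qed

text \<open>All neighbours of the first vertex of a longest path lie on the path. Of two such
  neighbours one has index at least 2, and the edge to it closes a cycle.\<close>

lemma exists_cycle:
  assumes F: "finite F" "F \<noteq> {}" "\<And>e. e \<in> F \<Longrightarrow> card e = 2"
    and deg: "\<And>v. v \<in> \<Union>F \<Longrightarrow> 2 \<le> card {e \<in> F. v \<in> e}"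
  shows "\<exists>c. vcyc F c"
proof -
  define P where "P p \<longleftrightarrow> distinct p \<and> p \<noteq> [] \<and> set p \<subseteq> \<Union>F \<and> (\<forall>i. Suc i < length p \<longrightarrow> {p ! i, p ! Suc i} \<in> F)" for p
  have fin: "finite (\<Union>F)" using finite_Union_2[OF F(1,3)] .
  have len: "length p \<le> card (\<Union>F)" if "P p" for p
    using that card_mono[OF fin, of "set p"] distinct_card[of p] by (auto simp: P_def)
  obtain v0 where "v0 \<in> \<Union>F" using F(2,3) by (metis UnionI card.empty ex_in_conv zero_neq_numeral)
  then have "P [v0]" by (auto simp: P_def)
  then have "\<exists>p. P p \<and> (\<forall>q. P q \<longrightarrow> length q \<le> length p)"
    by (rule ex_has_greatest_nat[of P _ length "Suc (card (\<Union>F))"]) (use len in \<open>simp add: less_Suc_eq_le\<close>)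
  then obtain p where p: "P p" and mx: "\<And>q. P q \<Longrightarrow> length q \<le> length p" by blast
  let ?v = "p ! 0"
  have vp: "?v \<in> set p" using p by (auto simp: P_def)
  then have "?v \<in> \<Union>F" using p unfolding P_def by blast
  then obtain e1 e2 where e: "e1 \<in> F" "e2 \<in> F" "?v \<in> e1" "?v \<in> e2" "e1 \<noteq> e2"
  proof -
    have "\<not> card {e \<in> F. ?v \<in> e} \<le> Suc 0" using deg[OF \<open>?v \<in> \<Union>F\<close>] by simp
    then have "\<not> (\<forall>e1\<in>{e \<in> F. ?v \<in> e}. \<forall>e2\<in>{e \<in> F. ?v \<in> e}. e1 = e2)"
      using card_le_Suc0_iff_eq[of "{e \<in> F. ?v \<in> e}"] F(1) by simp
    then show ?thesis using that by blast
  qed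
  have nb: "\<exists>k. 0 < k \<and> k < length p \<and> e = {?v, p ! k}" if ef: "e \<in> F" "?v \<in> e" for e
  proof -
    obtain a where a: "e = {?v, a}" "a \<noteq> ?v"
      using F(3)[OF ef(1)] ef(2) by (auto simp: card_2_iff doubleton_eq_iff)
    have "a \<in> set p"
    proof (rule ccontr)
      assume "a \<notin> set p"
      then have "P (a # p)" using p ef a
        by (auto simp: P_def nth_Cons insert_commute split: nat.split)
      then show False using mx by fastforce
    qed
    then obtain k where "k < length p" "p ! k = a" by (auto simp: in_set_conv_nth)
    then show ?thesis using a by (intro exI[of _ k]) (cases "k = 0", auto)
  qed
  obtain k1 where k1: "0 < k1" "k1 < length p" "e1 = {?v, p ! k1}" using nb[OF e(1,3)] by blast
  obtain k2 where k2: "0 < k2" "k2 < length p" "e2 = {?v, p ! k2}" using nb[OF e(2,4)] by blast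
  have "k1 \<noteq> k2" using e k1 k2 by auto
  then obtain k where k: "2 \<le> k" "k < length p" "{?v, p ! k} \<in> F"
    using k1 k2 e(1,2) by (metis One_nat_def Suc_1 Suc_leI le_neq_implies_less less_one linorder_neqE_nat not_less)
  let ?c = "take (Suc k) p"
  have "vcyc F ?c"
    unfolding vcyc_def
  proof (intro conjI subsetI)
    show "3 \<le> length ?c" using k by simp
    show "distinct ?c" using p by (simp add: P_def)
    fix e assume "e \<in> cedges ?c"
    then obtain i where i: "i < Suc k" "e = cedge ?c i" using k by (auto simp: cedges_def)
    show "e \<in> F"
    proof (cases "i = k")
      case True
      then show ?thesis using i k by (simp add: cedge_def insert_commute)
    next
      case False
      then have "e = {p ! i, p ! Suc i}" using i k by (simp add: cedge_def)
      then show ?thesis using p i k False by (simp add: P_def)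
    qed
  qed
  then show ?thesis by blast
qed

text \<open>The cycles stay isolated during the construction: a new leaf edge avoids
  \<open>C\<close> at both ends, and a new cycle avoids all old vertices.\<close>

lemma oc_props:
  assumes "oc F C"
  shows "finite F \<and> (\<forall>e\<in>F. card e = 2) \<and> C \<subseteq> \<Union>F \<and>
    (\<forall>u\<in>C. \<exists>c. u \<in> set c \<and> vcyc F c \<and> odd (length c) \<and> (\<forall>f\<in>F. f \<inter> set c \<noteq> {} \<longrightarrow> f \<in> cedges c) \<and> set c \<subseteq> C)"
  using assms
proof induction
  case oc_empty
  then show ?case by simp
next
  case (oc_leaf F C v u)
  have "\<exists>c. w \<in> set c \<and> vcyc (insert {u, v} F) c \<and> odd (length c) \<and>
      (\<forall>f\<in>insert {u, v} F. f \<inter> set c \<noteq> {} \<longrightarrow> f \<in> cedges c) \<and> set c \<subseteq> C" if "w \<in> C" for w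
  proof -
    obtain c where "w \<in> set c" "vcyc F c" "odd (length c)" "\<forall>f\<in>F. f \<inter> set c \<noteq> {} \<longrightarrow> f \<in> cedges c" "set c \<subseteq> C"
      using bspec[OF oc_leaf.IH[THEN conjunct2, THEN conjunct2, THEN conjunct2] \<open>w \<in> C\<close>] by auto
    moreover have "{u, v} \<inter> C = {}" using oc_leaf by auto
    ultimately show ?thesis by (intro exI[of _ c]) (auto simp: vcyc_def)
  qed
  then show ?case using oc_leaf by auto
next
  case (oc_cycle F C c)
  have e: "cedges c \<subseteq> Pow (set c)" using Union_cedges[of c] by auto
  have "\<exists>c'. w \<in> set c' \<and> vcyc (F \<union> cedges c) c' \<and> odd (length c') \<and>
      (\<forall>f\<in>F \<union> cedges c. f \<inter> set c' \<noteq> {} \<longrightarrow> f \<in> cedges c') \<and> set c' \<subseteq> C \<union> set c" if "w \<in> C \<union> set c" for w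
  proof (cases "w \<in> set c")
    case True
    then show ?thesis using oc_cycle by (intro exI[of _ c]) (auto simp: vcyc_def)
  next
    case False
    then obtain c' where c': "w \<in> set c'" "vcyc F c'" "odd (length c')" "\<forall>f\<in>F. f \<inter> set c' \<noteq> {} \<longrightarrow> f \<in> cedges c'" "set c' \<subseteq> C"
      using bspec[OF oc_cycle.IH[THEN conjunct2, THEN conjunct2, THEN conjunct2], of w] \<open>w \<in> C \<union> set c\<close> False by auto
    have "C \<subseteq> \<Union>F" using oc_cycle.IH[THEN conjunct2, THEN conjunct2, THEN conjunct1] .
    then have "set c' \<inter> set c = {}" using c'(5) oc_cycle.hyps(5) by blast
    then have "\<forall>f\<in>cedges c. f \<inter> set c' = {}" using e by blast
    then have "\<forall>f\<in>F \<union> cedges c. f \<inter> set c' \<noteq> {} \<longrightarrow> f \<in> cedges c'" using c'(4) by blast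
    moreover have "vcyc (F \<union> cedges c) c'" using c'(2) by (auto simp: vcyc_def)
    ultimately show ?thesis using c'(1,3,5) by blast
  qed
  moreover have "finite (F \<union> cedges c)" using oc_cycle.IH finite_cedges[of c] by simp
  moreover have "card f = 2" if "f \<in> F \<union> cedges c" for f
    using that oc_cycle.IH[THEN conjunct2, THEN conjunct1] card_cedge[OF oc_cycle.hyps(3,2)]
    by (auto simp: cedges_def)
  moreover have "C \<union> set c \<subseteq> \<Union>(F \<union> cedges c)"
    using oc_cycle.IH[THEN conjunct2, THEN conjunct2, THEN conjunct1] Union_cedges[of c] by auto
  ultimately show ?case by (intro conjI ballI)
qed

text \<open>The set is dismantled by removing an edge with an end of degree 1 or, if there is none,
  a whole cycle, which then exists because all degrees are at least 2.\<close>

lemma noeven_oc: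
  assumes "finite F" "\<And>e. e \<in> F \<Longrightarrow> card e = 2" "noeven F"
  shows "\<exists>C. oc F C"
  using assms
proof (induction "card F" arbitrary: F rule: less_induct)
  case less
  have sub: "noeven F'" if "F' \<subseteq> F" for F'
    using less.prems(3) that unfolding noeven_def lcyc_def by blast
  consider "F = {}" | v where "v \<in> \<Union>F" "card {e \<in> F. v \<in> e} < 2"
    | "F \<noteq> {}" "\<And>v. v \<in> \<Union>F \<Longrightarrow> 2 \<le> card {e \<in> F. v \<in> e}" by (meson not_less)
  then show ?case
  proof cases
    case 1
    then show ?thesis using oc_empty by blast
  next
    case (2 v)
    let ?E = "{e \<in> F. v \<in> e}"
    have "finite ?E" "?E \<noteq> {}" using less.prems(1) 2(1) by auto
    then have "card ?E = 1" using 2(2) card_gt_0_iff[of ?E] by linarith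
    then obtain e where E: "?E = {e}" by (auto simp: card_1_singleton_iff)
    then have e: "e \<in> F" "v \<in> e" by auto
    obtain u where u: "e = {u, v}" "u \<noteq> v"
      using less.prems(2)[OF e(1)] e(2) by (auto simp: card_2_iff)
    let ?F = "F - {e}"
    have "card ?F < card F" by (rule card_Diff1_less[OF less.prems(1) e(1)])
    then obtain C where C: "oc ?F C"
      using less.hyps[of ?F] less.prems sub[of ?F] by auto
    have "u \<notin> C"
    proof
      assume "u \<in> C"
      then obtain c where c: "u \<in> set c" "vcyc ?F c" using oc_props[OF C] by blast
      then have "vcyc F c" by (auto simp: vcyc_def)
      then have "e \<in> cedges c" using vcyc_isolated[OF _ less.prems(3) c(1) e(1)] u by auto
      then show False using c by (auto simp: vcyc_def)
    qed
    moreover have "card {f \<in> ?F. u \<in> f} \<le> 2"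
    proof (rule ccontr)
      assume "\<not> ?thesis"
      then have "3 \<le> card {f \<in> ?F. u \<in> f}" by simp
      then obtain X where X: "X \<subseteq> {f \<in> ?F. u \<in> f}" "card X = 3" by (meson obtain_subset_with_card_n)
      then obtain a b c where abc: "X = {a, b, c}" "a \<noteq> b" "b \<noteq> c" "a \<noteq> c" by (auto simp: card_3_iff)
      let ?l = "[a, b, c, e]"
      have l: "set ?l \<subseteq> F" "distinct ?l" "\<And>x. x \<in> set ?l \<Longrightarrow> u \<in> x"
        using X(1) abc e u by auto
      have "u \<in> ?l ! i \<inter> ?l ! (Suc i mod length ?l)" if "i < length ?l" for i
        using l(3)[OF nth_mem[OF that]] l(3)[OF nth_mem, of "Suc i mod length ?l"]
        by (simp del: nth_mem)
      then have "lcyc F ?l" unfolding lcyc_def using l(1,2) by fastforce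
      then have "odd (length ?l)" using less.prems(3) unfolding noeven_def by blast
      then show False by simp
    qed
    moreover have "v \<notin> \<Union>?F" using E by auto
    moreover have "insert {u, v} ?F = F" using e u by auto
    ultimately show ?thesis using oc_leaf[OF C, of v u] u by metis
  next
    case 3
    obtain c where c: "vcyc F c" using exists_cycle[OF less.prems(1) 3(1) less.prems(2) 3(2)] by blast
    then have cc: "3 \<le> length c" "distinct c" "cedges c \<subseteq> F" by (auto simp: vcyc_def)
    let ?F = "F - cedges c"
    have "cedges c \<noteq> {}" using cc by (auto simp: cedges_def lessThan_empty_iff)
    then have "card ?F < card F" using less.prems(1) cc(3) by (intro psubset_card_mono) auto
    then obtain C where C: "oc ?F C"
      using less.hyps[of ?F] less.prems sub[of ?F] by auto
    have "set c \<inter> \<Union>?F = {}" using vcyc_isolated[OF c less.prems(3)] by auto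
    then have "oc (?F \<union> cedges c) (C \<union> set c)"
      using oc_cycle[OF C cc(1,2) vcyc_odd[OF c less.prems(3)]] by blast
    moreover have "?F \<union> cedges c = F" using cc by auto
    ultimately show ?thesis by metis
  qed
qed

lemma finite_Union_oc: "oc F C \<Longrightarrow> finite (\<Union>F)"
  using oc_props[of F C] by (intro finite_Union_2) auto

text \<open>A leaf edge brings at least one vertex. If \<open>u\<close> is old, it lies outside
  \<open>C\<close>, so the inequality was already strict; if \<open>u\<close> is new, two vertices
  arrive with one edge. A cycle brings equally many vertices and edges. Hence every tree costs
  slack.\<close>

lemma oc_card:
  assumes "oc F C"
  shows "card F \<le> card (\<Union>F) \<and> (\<Union>F \<noteq> C \<longrightarrow> card F < card (\<Union>F))"
  using assms
proof induction
  case (oc_leaf F C v u)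
  have f: "finite F" "finite (\<Union>F)" "C \<subseteq> \<Union>F" using oc_props[OF oc_leaf(1)] finite_Union_oc[OF oc_leaf(1)] by auto
  have "card (insert {u, v} F) = Suc (card F)" using f oc_leaf by (subst card_insert_disjoint) auto
  moreover have "card F + 2 \<le> card (insert u (insert v (\<Union>F)))"
  proof (cases "u \<in> \<Union>F")
    case True
    then have "insert u (insert v (\<Union>F)) = insert v (\<Union>F)" by auto
    moreover have "card F < card (\<Union>F)" using oc_leaf True by blast
    ultimately show ?thesis using f oc_leaf by simp
  next
    case False
    then show ?thesis using f oc_leaf by simp
  qed
  moreover have "\<Union>(insert {u, v} F) = insert u (insert v (\<Union>F))" by auto
  ultimately show ?case by simp
next
  case (oc_cycle F C c)
  have f: "finite F" "finite (\<Union>F)" "C \<subseteq> \<Union>F" using oc_props[OF oc_cycle(1)] finite_Union_oc[OF oc_cycle(1)] by auto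
  have "card (F \<union> cedges c) \<le> card F + length c"
    using card_Un_le[of F "cedges c"] card_cedges[of c] oc_cycle by simp
  moreover have "card (\<Union>(F \<union> cedges c)) = card (\<Union>F) + length c"
    using f oc_cycle distinct_card[of c] by (simp add: Union_cedges card_Un_disjoint inf_commute)
  moreover have "\<Union>(F \<union> cedges c) \<noteq> C \<union> set c \<Longrightarrow> \<Union>F \<noteq> C" by (auto simp: Union_cedges)
  ultimately show ?case using oc_cycle.IH by linarith
qed simp

lemma oc_full:
  assumes "oc F C" "finite V" "\<Union>F \<subseteq> V" "card V \<le> card F"
  shows "C = V"
  using oc_card[OF assms(1)] card_mono[OF assms(2,3)] card_subset_eq[OF assms(2,3)] assms(4)
  by (metis le_antisym le_trans linorder_not_le)

lemma oc_family:
  assumes "finite A" "\<And>c. c \<in> A \<Longrightarrow> distinct c \<and> 3 \<le> length c \<and> odd (length c)"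
    "\<And>c d. c \<in> A \<Longrightarrow> d \<in> A \<Longrightarrow> c \<noteq> d \<Longrightarrow> set c \<inter> set d = {}"
  shows "oc (\<Union>c\<in>A. cedges c) (\<Union>c\<in>A. set c)"
  using assms
proof (induction A)
  case empty
  then show ?case using oc_empty by simp
next
  case (insert c A)
  have "set c \<inter> \<Union>(\<Union>c\<in>A. cedges c) = {}"
  proof -
    have e: "\<Union>(\<Union>c\<in>A. cedges c) = (\<Union>c\<in>A. \<Union>(cedges c))" by blast
    have "set c \<inter> set d = {}" if "d \<in> A" for d
      by (rule insert.prems(2)) (use that insert.hyps(2) in auto)
    then show ?thesis unfolding e Union_cedges by blast
  qed
  moreover have "oc (\<Union>c\<in>A. cedges c) (\<Union>c\<in>A. set c)" using insert by simp
  ultimately have "oc ((\<Union>c\<in>A. cedges c) \<union> cedges c) ((\<Union>c\<in>A. set c) \<union> set c)"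
    using insert.prems(1)[of c] by (intro oc_cycle) auto
  then show ?case by (simp add: Un_commute)
qed

text \<open>The second claim describes the cycle through \<open>v\<close> as the least
  neighbour-closed set containing \<open>v\<close>. Its oddness can then be exploited by exhibiting
  closed sets, without handling lists.\<close>

lemma oc_regular:
  assumes oc: "oc F C" and v: "v \<in> C"
  shows "card {w. {v, w} \<in> F} = 2"
    "\<exists>X. v \<in> X \<and> odd (card X) \<and> (\<forall>x\<in>X. \<forall>w. {x, w} \<in> F \<longrightarrow> w \<in> X) \<and>
      (\<forall>Y. v \<in> Y \<longrightarrow> (\<forall>x\<in>Y. \<forall>w. {x, w} \<in> F \<longrightarrow> w \<in> Y) \<longrightarrow> X \<subseteq> Y)"
proof -
  obtain c where c: "v \<in> set c" "vcyc F c" "odd (length c)" "\<forall>f\<in>F. f \<inter> set c \<noteq> {} \<longrightarrow> f \<in> cedges c"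
    using oc_props[OF oc] v by blast
  then have cc: "3 \<le> length c" "distinct c" "cedges c \<subseteq> F" by (auto simp: vcyc_def)
  let ?n = "length c"
  obtain j where j: "j < ?n" "c ! j = v" using c(1) by (auto simp: in_set_conv_nth)
  define s where "s = Suc j mod ?n"
  define p where "p = (if j = 0 then ?n - 1 else j - 1)"
  have "s = (if Suc j = ?n then 0 else Suc j)" using j by (simp add: s_def Suc_mod)
  then have sp: "s < ?n" "p < ?n" "s \<noteq> p" using j cc by (auto simp: p_def split: if_splits)
  have ps: "Suc p mod ?n = j" using j cc by (auto simp: p_def)
  have "{w. {v, w} \<in> F} = {c ! s, c ! p}"
  proof (intro set_eqI iffI)
    fix w assume "w \<in> {w. {v, w} \<in> F}"
    then have "{v, w} \<in> cedges c" using c by auto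
    then obtain k where k: "k < ?n" "{v, w} = {c ! k, c ! (Suc k mod ?n)}" by (auto simp: cedges_def cedge_def)
    then have "v = c ! k \<and> w = c ! (Suc k mod ?n) \<or> w = c ! k \<and> v = c ! (Suc k mod ?n)"
      by (auto simp: doubleton_eq_iff)
    then show "w \<in> {c ! s, c ! p}"
    proof
      assume a: "v = c ! k \<and> w = c ! (Suc k mod ?n)"
      then have "k = j" using j k cc by (metis nth_eq_iff_index_eq)
      then show ?thesis using a by (simp add: s_def)
    next
      assume a: "w = c ! k \<and> v = c ! (Suc k mod ?n)"
      moreover have "Suc k mod ?n < ?n" using cc by (intro mod_less_divisor) linarith
      ultimately have "Suc k mod ?n = j" using j cc by (metis nth_eq_iff_index_eq)
      then have "k = p" using k sp ps mod_add_inj[of k ?n p 1] by simp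
      then show ?thesis using a by simp
    qed
  next
    fix w assume "w \<in> {c ! s, c ! p}"
    moreover have "{v, c ! s} \<in> cedges c" using j by (auto simp: cedges_def cedge_def s_def)
    moreover have "{v, c ! p} \<in> cedges c"
      using sp(2) ps j unfolding cedges_def cedge_def by (metis (no_types, lifting) image_eqI insert_commute lessThan_iff)
    ultimately show "w \<in> {w. {v, w} \<in> F}" using cc by auto
  qed
  moreover have "c ! s \<noteq> c ! p" using sp cc by (simp add: nth_eq_iff_index_eq)
  ultimately show "card {w. {v, w} \<in> F} = 2" by simp
  show "\<exists>X. v \<in> X \<and> odd (card X) \<and> (\<forall>x\<in>X. \<forall>w. {x, w} \<in> F \<longrightarrow> w \<in> X) \<and>
      (\<forall>Y. v \<in> Y \<longrightarrow> (\<forall>x\<in>Y. \<forall>w. {x, w} \<in> F \<longrightarrow> w \<in> Y) \<longrightarrow> X \<subseteq> Y)"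
  proof (intro exI[of _ "set c"] conjI allI impI ballI c(1))
    show "odd (card (set c))" using c cc by (simp add: distinct_card)
    fix x w assume "x \<in> set c" "{x, w} \<in> F"
    then have "{x, w} \<in> cedges c" using c(4) by auto
    then show "w \<in> set c" using Union_cedges[of c] by blast
  next
    fix Y assume vY: "v \<in> Y" and Y: "\<forall>x\<in>Y. \<forall>w. {x, w} \<in> F \<longrightarrow> w \<in> Y"
    have "c ! ((j + i) mod ?n) \<in> Y" for i
    proof (induction i)
      case 0
      then show ?case using vY j by simp
    next
      case (Suc i)
      have "(j + i) mod ?n < ?n" using cc by (intro mod_less_divisor) linarith
      then have "cedge c ((j + i) mod ?n) \<in> F" using cc by (auto simp: cedges_def)
      then have "{c ! ((j + i) mod ?n), c ! ((j + Suc i) mod ?n)} \<in> F"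
        by (simp add: cedge_def mod_Suc_eq)
      then show ?case using Suc Y by blast
    qed
    note this[of "k + (?n - j)" for k]
    then have "c ! k \<in> Y" if "k < ?n" for k
      using that j by (metis add.commute add.left_commute le_add_diff_inverse less_imp_le mod_add_self2 mod_less)
    then show "set c \<subseteq> Y" by (auto simp: in_set_conv_nth)
  qed
qed

section \<open>Certificates for the absence of even cycles\<close>

text \<open>Here \<open>cy\<close> marks the edges on odd cycles and \<open>r\<close> is the position on the cycle, or the depth in a tree;
  \<open>lb\<close> names the cycle of an edge and \<open>tp\<close> is the last position on it.\<close>

definition cert :: "'b set \<Rightarrow> ('b \<Rightarrow> 'b \<Rightarrow> bool) \<Rightarrow> ('b \<Rightarrow> bool) \<Rightarrow> ('b \<Rightarrow> nat) \<Rightarrow> ('b \<Rightarrow> nat) \<Rightarrow> ('b \<Rightarrow> nat) \<Rightarrow> bool" where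
  "cert U adj cy r lb tp \<longleftrightarrow>
    (\<forall>e\<in>U. \<forall>f\<in>U. adj e f \<longrightarrow> cy e = cy f) \<and>
    (\<forall>e\<in>U. \<forall>f\<in>U. adj e f \<and> cy e \<longrightarrow> lb e = lb f \<and> tp e = tp f \<and>
       (r f = Suc (r e) \<or> r e = Suc (r f) \<or>
        even (tp e) \<and> (r e = 0 \<and> r f = tp e \<or> r f = 0 \<and> r e = tp e))) \<and>
    (\<forall>e\<in>U. \<forall>f\<in>U. cy e \<and> cy f \<and> lb e = lb f \<and> r e = r f \<longrightarrow> e = f) \<and>
    (\<forall>e\<in>U. \<forall>f\<in>U. \<forall>g\<in>U. \<not> cy e \<and> adj e f \<and> adj e g \<and> f \<noteq> g \<and> r f \<le> r e \<and> r g \<le> r e \<longrightarrow>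
       r f = r e \<and> (\<forall>h\<in>U. adj f h \<and> r h \<le> r f \<longrightarrow> h = e \<or> h = g) \<or>
       r g = r e \<and> (\<forall>h\<in>U. adj g h \<and> r h \<le> r g \<longrightarrow> h = e \<or> h = f))"

lemma certD:
  assumes "cert U adj cy r lb tp"
  shows "e \<in> U \<Longrightarrow> f \<in> U \<Longrightarrow> adj e f \<Longrightarrow> cy e = cy f"
    "e \<in> U \<Longrightarrow> f \<in> U \<Longrightarrow> adj e f \<Longrightarrow> cy e \<Longrightarrow> lb e = lb f \<and> tp e = tp f \<and>
       (r f = Suc (r e) \<or> r e = Suc (r f) \<or>
        even (tp e) \<and> (r e = 0 \<and> r f = tp e \<or> r f = 0 \<and> r e = tp e))"
    "e \<in> U \<Longrightarrow> f \<in> U \<Longrightarrow> cy e \<Longrightarrow> cy f \<Longrightarrow> lb e = lb f \<Longrightarrow> r e = r f \<Longrightarrow> e = f"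
    "e \<in> U \<Longrightarrow> f \<in> U \<Longrightarrow> g \<in> U \<Longrightarrow> \<not> cy e \<Longrightarrow> adj e f \<Longrightarrow> adj e g \<Longrightarrow> f \<noteq> g \<Longrightarrow> r f \<le> r e \<Longrightarrow> r g \<le> r e \<Longrightarrow>
       r f = r e \<and> (\<forall>h\<in>U. adj f h \<and> r h \<le> r f \<longrightarrow> h = e \<or> h = g) \<or>
       r g = r e \<and> (\<forall>h\<in>U. adj g h \<and> r h \<le> r g \<longrightarrow> h = e \<or> h = f)"
proof -
  note c = assms[unfolded cert_def]
  show "e \<in> U \<Longrightarrow> f \<in> U \<Longrightarrow> adj e f \<Longrightarrow> cy e = cy f"
    by (rule c[THEN conjunct1, rule_format])
  show "e \<in> U \<Longrightarrow> f \<in> U \<Longrightarrow> adj e f \<Longrightarrow> cy e \<Longrightarrow> lb e = lb f \<and> tp e = tp f \<and>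
       (r f = Suc (r e) \<or> r e = Suc (r f) \<or>
        even (tp e) \<and> (r e = 0 \<and> r f = tp e \<or> r f = 0 \<and> r e = tp e))"
    by (rule c[THEN conjunct2, THEN conjunct1, rule_format, OF _ _ conjI])
  show "e \<in> U \<Longrightarrow> f \<in> U \<Longrightarrow> cy e \<Longrightarrow> cy f \<Longrightarrow> lb e = lb f \<Longrightarrow> r e = r f \<Longrightarrow> e = f"
    by (rule c[THEN conjunct2, THEN conjunct2, THEN conjunct1, rule_format]) simp_all
  show "e \<in> U \<Longrightarrow> f \<in> U \<Longrightarrow> g \<in> U \<Longrightarrow> \<not> cy e \<Longrightarrow> adj e f \<Longrightarrow> adj e g \<Longrightarrow> f \<noteq> g \<Longrightarrow> r f \<le> r e \<Longrightarrow> r g \<le> r e \<Longrightarrow>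
       r f = r e \<and> (\<forall>h\<in>U. adj f h \<and> r h \<le> r f \<longrightarrow> h = e \<or> h = g) \<or>
       r g = r e \<and> (\<forall>h\<in>U. adj g h \<and> r h \<le> r g \<longrightarrow> h = e \<or> h = f)"
    by (rule c[THEN conjunct2, THEN conjunct2, THEN conjunct2, THEN bspec, THEN bspec, THEN bspec, THEN mp]) simp_all
qed

text \<open>A cycle avoiding \<open>cy\<close> is a triangle around its element of largest rank; a cycle inside \<open>cy\<close>
  contains every rank from 0 to \<open>tp\<close> exactly once.\<close>

lemma cert_sound:
  assumes cert: "cert U adj cy r lb tp" and sym: "\<And>e f. e \<in> U \<Longrightarrow> f \<in> U \<Longrightarrow> adj e f \<Longrightarrow> adj f e"
    and c: "3 \<le> length c" "distinct c" "set c \<subseteq> U"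
    and adj: "\<And>i. i < length c \<Longrightarrow> adj (c ! i) (c ! (Suc i mod length c))"
  shows "odd (length c)"
proof -
  define n where "n = length c"
  have n: "3 \<le> n" "0 < n" using c by (auto simp: n_def)
  define h where "h i = c ! (i mod n)" for i
  have hin: "h i \<in> set c" for i using n by (simp add: h_def n_def)
  have hU: "h i \<in> U" for i using hin c(3) by blast
  have hadj: "adj (h i) (h (Suc i))" for i
    using adj[of "i mod n"] n by (simp add: h_def n_def mod_Suc_eq)
  have heq: "a = b" if "a < n" "b < n" "h (i + a) = h (i + b)" for a b i
  proof (rule mod_add_inj[OF that(1,2)])
    have "(i + a) mod n < length c" "(i + b) mod n < length c" using n by (auto simp: n_def)
    then show "(i + a) mod n = (i + b) mod n"
      using that(3) c(2) by (simp add: h_def nth_eq_iff_index_eq)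
  qed
  have d1: "h i \<noteq> h (Suc i)" and d2: "h i \<noteq> h (Suc (Suc i))" for i
    using heq[of 0 1 i] heq[of 0 2 i] n by (auto simp: numeral_2_eq_2)
  have d3: "n = 3" if "h i = h (Suc (Suc (Suc i)))" for i
    using heq[of 0 3 i] that n by (cases "n = 3") (auto simp: numeral_3_eq_3)
  note cyc = certD(1)[OF cert] and lab = certD(2)[OF cert] and inj = certD(3)[OF cert] and tri = certD(4)[OF cert]
  have cy0: "cy (h i) = cy (h 0)" for i
    by (induction i) (use cyc[OF hU hU hadj] in auto)
  \<comment> \<open>With an index of the form \<open>Suc (Suc i)\<close>, the preceding elements of
    the cycle can be named without subtraction.\<close>
  have hsur: "\<exists>i. x = h (Suc (Suc i))" if x: "x \<in> set c" for x
  proof -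
    obtain k where k: "k < n" "x = c ! k" using x by (auto simp: in_set_conv_nth n_def)
    have "Suc (Suc (k + (n - 2))) = k + n" using n by simp
    moreover have "x = h (k + n)" using k by (simp add: h_def)
    ultimately have "x = h (Suc (Suc (k + (n - 2))))" by (simp only:)
    then show ?thesis by blast
  qed
  have "Max (r ` set c) \<in> r ` set c" using hin[of 0] by (intro Max_in) auto
  then obtain e where e: "e \<in> set c" "r e = Max (r ` set c)" by auto
  have mx: "r x \<le> r e" if "x \<in> set c" for x unfolding e(2) using that by (intro Max_ge) auto
  obtain i where i: "e = h (Suc (Suc i))" using hsur[OF e(1)] by blast
  let ?g = "h (Suc i)" let ?f = "h (Suc (Suc (Suc i)))"
  show ?thesis
  proof (cases "cy (h 0)")
    case False
    have "n = 3"
      using tri[of e ?f ?g]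
    proof (elim meta_impE disjE conjE)
      show "adj e ?g" unfolding i by (rule sym[OF hU hU hadj])
      assume a: "r ?f = r e" "\<forall>h\<in>U. adj ?f h \<and> r h \<le> r ?f \<longrightarrow> h = e \<or> h = ?g"
      \<comment> \<open>\<open>?f\<close> has maximal rank as well, so its next neighbour on the
        cycle must be \<open>e\<close> or \<open>?g\<close>. It cannot be \<open>e\<close>, two
        places back; being \<open>?g\<close>, three places back, means length 3.\<close>
      have "h (Suc (Suc (Suc (Suc i)))) = e \<or> h (Suc (Suc (Suc (Suc i)))) = ?g"
        using a(2) hU hadj mx[OF hin] a(1) by simp
      then show "n = 3" using d2[of "Suc (Suc i)"] d3[of "Suc i"] unfolding i by metis
    next
      assume a: "r ?g = r e" "\<forall>h\<in>U. adj ?g h \<and> r h \<le> r ?g \<longrightarrow> h = e \<or> h = ?f"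
      have "h i = e \<or> h i = ?f"
        using a(2) hU sym[OF hU hU hadj] mx[OF hin] a(1) by simp
      then show "n = 3" using d2[of i] d3[of i] unfolding i by metis
    qed (use cy0 False hU hadj mx[OF hin] i d2[of "Suc i"] in auto)
    then show ?thesis by (simp add: n_def)
  next
    case True
    have cy: "cy (h j)" for j using cy0 True by simp
    have idc: "lb (h j) = lb (h 0) \<and> tp (h j) = tp (h 0)" for j
      by (induction j) (use lab[OF hU hU hadj cy] in auto)
    have rinj: "x = y" if "x \<in> set c" "y \<in> set c" "r x = r y" for x y
      using that inj[of x y] hsur[of x] hsur[of y] hU cy idc by metis
    define m where "m = tp (h 0)"
    have st: "r (h (Suc j)) = Suc (r (h j)) \<or> r (h j) = Suc (r (h (Suc j))) \<or>
        even m \<and> (r (h j) = 0 \<and> r (h (Suc j)) = m \<or> r (h (Suc j)) = 0 \<and> r (h j) = m)" for j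
      using lab[OF hU hU hadj cy] idc unfolding m_def by metis
    have rd: "r (h j) \<noteq> r (h (Suc j))" "r (h j) \<noteq> r (h (Suc (Suc j)))" for j
      using rinj[OF hin hin] d1 d2 by blast+
    \<comment> \<open>The neighbours of \<open>e\<close> have different ranks below the maximum, so
      not both are one less. One of them is joined to \<open>e\<close> by the wrap-around, which
      gives \<open>r e = m\<close> with \<open>m\<close> even, and the other has rank
      \<open>m - 1\<close>.\<close>
    have re: "r e = m \<and> even m \<and> (\<exists>x\<in>set c. Suc (r x) = m)"
    proof -
      have "r ?g \<le> r e" "r ?f \<le> r e" "r ?g \<noteq> r e" "r ?f \<noteq> r e" "r ?g \<noteq> r ?f"
        using mx[OF hin] rd[of "Suc i"] rd[of "Suc (Suc i)"] unfolding i by auto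
      moreover have "r e = Suc (r ?g) \<or> r ?g = Suc (r e) \<or> even m \<and> (r ?g = 0 \<and> r e = m \<or> r e = 0 \<and> r ?g = m)"
        using st[of "Suc i"] unfolding i .
      moreover have "r ?f = Suc (r e) \<or> r e = Suc (r ?f) \<or> even m \<and> (r e = 0 \<and> r ?f = m \<or> r ?f = 0 \<and> r e = m)"
        using st[of "Suc (Suc i)"] unfolding i .
      ultimately have "r e = m \<and> even m \<and> (Suc (r ?g) = m \<or> Suc (r ?f) = m)" by linarith
      then show ?thesis using hin by blast
    qed
    have down: "\<exists>x\<in>set c. r x = m - k" for k
    proof (induction k)
      case 0
      then show ?case using re e(1) by auto
    next
      case (Suc k)
      then obtain x where x: "x \<in> set c" "r x = m - k" by blast
      show ?case
      proof (cases "k = 0 \<or> r x = 0")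
        case True
        then show ?thesis
        proof
          assume "k = 0"
          then show ?thesis using re by (metis diff_Suc_1 One_nat_def)
        next
          assume "r x = 0"
          then show ?thesis using x by (intro bexI[of _ x]) auto
        qed
      next
        case False
        \<comment> \<open>Strictly between 0 and \<open>m\<close> there is no wrap-around, and two
          neighbours of different ranks cannot both be one higher.\<close>
        obtain j where j: "x = h (Suc (Suc j))" using hsur[OF x(1)] by blast
        let ?y = "h (Suc j)" let ?z = "h (Suc (Suc (Suc j)))"
        have "r ?y \<noteq> r ?z" using rd by blast
        moreover have "r x = Suc (r ?y) \<or> r ?y = Suc (r x) \<or> even m \<and> (r ?y = 0 \<and> r x = m \<or> r x = 0 \<and> r ?y = m)"
          using st[of "Suc j"] unfolding j .
        moreover have "r ?z = Suc (r x) \<or> r x = Suc (r ?z) \<or> even m \<and> (r x = 0 \<and> r ?z = m \<or> r ?z = 0 \<and> r x = m)"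
          using st[of "Suc (Suc j)"] unfolding j .
        moreover have "0 < r x" "r x \<noteq> m" using False x by auto
        ultimately have "r x = Suc (r ?y) \<or> r x = Suc (r ?z)" by linarith
        then have "r ?y = m - Suc k \<or> r ?z = m - Suc k" using x(2) by auto
        then show ?thesis using hin by blast
      qed
    qed
    have "r ` set c = {..m}"
    proof (intro set_eqI iffI)
      fix k assume "k \<in> {..m}"
      then have "m - (m - k) = k" by simp
      then show "k \<in> r ` set c" using down[of "m - k"] by (metis imageI)
    qed (use mx re in auto)
    moreover have "card (r ` set c) = n"
      unfolding n_def using c(2) rinj by (subst card_image) (auto intro!: inj_onI simp: distinct_card)
    ultimately have "n = Suc m" by simp
    then show ?thesis using re by (simp add: n_def)
  qed
qed

section \<open>Existence of the labels\<close>

definition tlab :: "'a set set \<Rightarrow> 'a set \<Rightarrow> ('a \<Rightarrow> nat) \<Rightarrow> bool" where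
  "tlab F C d \<longleftrightarrow> (\<forall>a b. {a, b} \<in> F \<and> a \<notin> C \<longrightarrow> b \<notin> C \<and> (d b = Suc (d a) \<or> d a = Suc (d b))) \<and>
    (\<forall>a b b'. a \<notin> C \<and> {a, b} \<in> F \<and> {a, b'} \<in> F \<and> d b < d a \<and> d b' < d a \<longrightarrow> b = b') \<and>
    (\<forall>a. a \<notin> C \<longrightarrow> card {e \<in> F. a \<in> e} \<le> 3) \<and> (\<forall>a. d a \<le> card F)"

lemma tlabD:
  assumes "tlab F C d"
  shows "{a, b} \<in> F \<Longrightarrow> a \<notin> C \<Longrightarrow> b \<notin> C \<and> (d b = Suc (d a) \<or> d a = Suc (d b))"
    "a \<notin> C \<Longrightarrow> {a, b} \<in> F \<Longrightarrow> {a, b'} \<in> F \<Longrightarrow> d b < d a \<Longrightarrow> d b' < d a \<Longrightarrow> b = b'"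
    "a \<notin> C \<Longrightarrow> card {e \<in> F. a \<in> e} \<le> 3" "d a \<le> card F"
  using assms unfolding tlab_def by (simp_all del: split_paired_All)

text \<open>\<open>d\<close> is the depth of a vertex in its tree, so a new leaf \<open>v\<close> is
  placed one below \<open>u\<close>; the second clause of \<open>tlab\<close> expresses that parents
  are unique.\<close>

lemma oc_tree_labels:
  assumes "oc F C"
  shows "\<exists>d. tlab F C d"
  using assms
proof induction
  case oc_empty
  show ?case unfolding tlab_def by (intro exI[of _ "\<lambda>_. 0"]) simp
next
  case (oc_leaf F C v u)
  have fin: "finite F" "C \<subseteq> \<Union>F" using oc_props[OF oc_leaf(1)] by auto
  obtain d where d: "tlab F C d" using oc_leaf.IH by blast
  note d1 = tlabD(1)[OF d] and d2 = tlabD(2)[OF d] and d3 = tlabD(3)[OF d] and d4 = tlabD(4)[OF d]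
  have vF: "{v, x} \<notin> F" "{x, v} \<notin> F" for x using oc_leaf.hyps(2) by auto
  have vC: "v \<notin> C" using oc_leaf.hyps(2) fin by blast
  have c: "card (insert {u, v} F) = Suc (card F)" using fin vF by simp
  let ?d = "d(v := Suc (d u))"
  have new: "{a, b} \<in> insert {u, v} F \<longleftrightarrow> {a, b} \<in> F \<or> a = u \<and> b = v \<or> a = v \<and> b = u" for a b
    by (auto simp: doubleton_eq_iff)
  show ?case
    unfolding tlab_def
  proof (intro exI[of _ ?d] conjI allI impI; (elim conjE)?)
    fix a b assume "{a, b} \<in> insert {u, v} F" "a \<notin> C"
    then show "b \<notin> C" "?d b = Suc (?d a) \<or> ?d a = Suc (?d b)"
      unfolding new using d1[of a b] vF vC oc_leaf.hyps(3,4) by (auto simp: insert_commute)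
  next
    fix a b b' assume a: "a \<notin> C" "{a, b} \<in> insert {u, v} F" "{a, b'} \<in> insert {u, v} F" "?d b < ?d a" "?d b' < ?d a"
    show "b = b'"
    proof (cases "a = v")
      case True
      then show ?thesis using a(2,3) vF unfolding new by auto
    next
      case False
      have "b \<noteq> v" "b' \<noteq> v" using a(2-5) False vF oc_leaf.hyps(3) unfolding new by auto
      then show ?thesis using a False d2[of a b b'] unfolding new by auto
    qed
  next
    fix a assume a: "a \<notin> C"
    have "{e \<in> insert {u, v} F. a \<in> e} \<subseteq> insert {u, v} {e \<in> F. a \<in> e}" by auto
    then have l: "card {e \<in> insert {u, v} F. a \<in> e} \<le> Suc (card {e \<in> F. a \<in> e})"
    proof -
      have "card {e \<in> insert {u, v} F. a \<in> e} \<le> card (insert {u, v} {e \<in> F. a \<in> e})"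
        using fin(1) by (intro card_mono) auto
      also have "\<dots> \<le> Suc (card {e \<in> F. a \<in> e})" using fin(1) by (simp add: card_insert_if)
      finally show ?thesis .
    qed
    consider "a = v" | "a = u" | "a \<noteq> u" "a \<noteq> v" by blast
    then show "card {e \<in> insert {u, v} F. a \<in> e} \<le> 3"
    proof cases
      case 1
      then have "{e \<in> F. a \<in> e} = {}" using oc_leaf.hyps(2) by auto
      then have "card {e \<in> F. a \<in> e} = 0" by (simp only: card.empty)
      then show ?thesis using l by linarith
    next
      case 2
      then show ?thesis using l oc_leaf.hyps(5) by auto
    next
      case 3
      then have "{e \<in> insert {u, v} F. a \<in> e} = {e \<in> F. a \<in> e}" by auto
      then show ?thesis using d3[OF a] by simp
    qed
  next
    fix a show "?d a \<le> card (insert {u, v} F)" using d4 c by (simp add: le_SucI)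
  qed
next
  case (oc_cycle F C c)
  have fin: "finite F" "C \<subseteq> \<Union>F" using oc_props[OF oc_cycle(1)] by auto
  obtain d where d: "tlab F C d" using oc_cycle.IH by blast
  note d1 = tlabD(1)[OF d] and d2 = tlabD(2)[OF d] and d3 = tlabD(3)[OF d] and d4 = tlabD(4)[OF d]
  have c: "e \<subseteq> set c" if "e \<in> cedges c" for e using that Union_cedges[of c] by auto
  have cF: "e \<inter> set c = {}" if "e \<in> F" for e using that oc_cycle.hyps(5) by auto
  have new: "{a, b} \<in> F \<and> b \<notin> set c" if "{a, b} \<in> F \<union> cedges c" "a \<notin> C \<union> set c" for a b
    using that c[of "{a, b}"] cF[of "{a, b}"] by auto
  show ?case
    unfolding tlab_def
  proof (intro exI[of _ d] conjI allI impI; (elim conjE)?)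
    fix a b assume "{a, b} \<in> F \<union> cedges c" "a \<notin> C \<union> set c"
    then show "b \<notin> C \<union> set c" "d b = Suc (d a) \<or> d a = Suc (d b)"
      using new[of a b] d1[of a b] by auto
  next
    fix a b b' assume "a \<notin> C \<union> set c" "{a, b} \<in> F \<union> cedges c" "{a, b'} \<in> F \<union> cedges c" "d b < d a" "d b' < d a"
    then show "b = b'" using new[of a b] new[of a b'] d2[of a b b'] by auto
  next
    fix a assume "a \<notin> C \<union> set c"
    moreover from this have "{e \<in> F \<union> cedges c. a \<in> e} = {e \<in> F. a \<in> e}" using c by auto
    ultimately show "card {e \<in> F \<union> cedges c. a \<in> e} \<le> 3" using d3[of a] by simp
  next
    fix a show "d a \<le> card (F \<union> cedges c)"
      using d4[of a] card_mono[of "F \<union> cedges c" F] fin finite_cedges[of c] by (simp add: le_trans)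
  qed
qed

lemma oc_cycle_labels:
  assumes "oc F C"
  shows "\<exists>r lb tp. (\<forall>e\<in>F. e \<subseteq> C \<longrightarrow> r e \<le> card F \<and> lb e \<le> card F \<and> tp e \<le> card F) \<and>
    (\<forall>e\<in>F. \<forall>f\<in>F. e \<subseteq> C \<and> f \<subseteq> C \<and> e \<noteq> f \<and> e \<inter> f \<noteq> {} \<longrightarrow> lb e = lb f \<and> tp e = tp f \<and>
       (r f = Suc (r e) \<or> r e = Suc (r f) \<or>
        even (tp e) \<and> (r e = 0 \<and> r f = tp e \<or> r f = 0 \<and> r e = tp e))) \<and>
    (\<forall>e\<in>F. \<forall>f\<in>F. e \<subseteq> C \<and> f \<subseteq> C \<and> lb e = lb f \<and> r e = r f \<longrightarrow> e = f)"
    (is "\<exists>r lb tp. ?A F C r lb tp \<and> ?B F C r lb tp \<and> ?D F C r lb")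
  using assms
proof induction
  case oc_empty
  show ?case by simp
next
  case (oc_leaf F C v u)
  have fin: "finite F" "C \<subseteq> \<Union>F" using oc_props[OF oc_leaf(1)] by auto
  have new: "e \<in> F" if "e \<in> insert {u, v} F" "e \<subseteq> C" for e
    using that oc_leaf.hyps(4) by auto
  have "card F \<le> card (insert {u, v} F)" by (rule card_insert_le)
  moreover obtain r lb tp where *: "?A F C r lb tp" "?B F C r lb tp" "?D F C r lb"
    using oc_leaf.IH by (elim exE conjE) (rule that)
  ultimately have "?A (insert {u, v} F) C r lb tp" using new by (meson le_trans)
  moreover have "?B (insert {u, v} F) C r lb tp"
    by (intro ballI impI; rule *(2)[rule_format]) (use new in auto)
  moreover have "?D (insert {u, v} F) C r lb"
    by (intro ballI impI; rule *(3)[rule_format]) (use new in auto)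
  ultimately show ?case by (intro exI conjI)
next
  case (oc_cycle F C c)
  have fin: "finite F" "C \<subseteq> \<Union>F" "\<forall>e\<in>F. card e = 2" using oc_props[OF oc_cycle(1)] by auto
  obtain r lb tp where A: "?A F C r lb tp" and B: "?B F C r lb tp" and D: "?D F C r lb"
    using oc_cycle.IH by (elim exE conjE) (rule that)
  let ?n = "length c" let ?F = "F \<union> cedges c"
  have sub: "e \<subseteq> set c" if "e \<in> cedges c" for e using that Union_cedges[of c] by auto
  have cF: "e \<inter> set c = {}" if "e \<in> F" for e using that oc_cycle.hyps(5) by auto
  have nF: "e \<notin> F" if "e \<in> cedges c" for e
    using that cF[of e] sub[of e] by (auto simp: cedges_def cedge_def)
  have old: "e \<in> F \<and> e \<subseteq> C \<and> e \<notin> cedges c" if "e \<in> ?F" "e \<subseteq> C \<union> set c" "e \<notin> cedges c" for e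
    using that cF[of e] by auto
  have cardF: "card ?F = card F + ?n"
    using fin(1) finite_cedges[of c] nF card_cedges[OF oc_cycle.hyps(3,2)] by (subst card_Un_disjoint) auto
  define ix where "ix e = inv_into {..<?n} (cedge c) e" for e
  have inj: "inj_on (cedge c) {..<?n}"
    using cedge_eq[OF oc_cycle.hyps(3,2)] by (auto intro!: inj_onI)
  have ix: "ix e < ?n" "e = cedge c (ix e)" if "e \<in> cedges c" for e
    using that inv_into_into[of e "cedge c" "{..<?n}"] f_inv_into_f[of e "cedge c" "{..<?n}"]
    unfolding ix_def cedges_def by auto
  define r' where "r' e = (if e \<in> cedges c then ix e else r e)" for e
  \<comment> \<open>Old labels are at most \<open>card F\<close>, so this one is new; it respects
    the new bound because the cycle adds edges.\<close>
  define lb' where "lb' e = (if e \<in> cedges c then Suc (card F) else lb e)" for e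
  define tp' where "tp' e = (if e \<in> cedges c then ?n - 1 else tp e)" for e
  have "?A ?F (C \<union> set c) r' lb' tp'"
  proof (intro ballI impI)
    fix e assume e: "e \<in> ?F" "e \<subseteq> C \<union> set c"
    show "r' e \<le> card ?F \<and> lb' e \<le> card ?F \<and> tp' e \<le> card ?F"
    proof (cases "e \<in> cedges c")
      case True
      then show ?thesis using ix(1)[OF True] oc_cycle.hyps(2) by (simp add: r'_def lb'_def tp'_def cardF)
    next
      case False
      then show ?thesis using old[OF e False] A by (auto simp: r'_def lb'_def tp'_def cardF)
    qed
  qed
  moreover have "?B ?F (C \<union> set c) r' lb' tp'"
  proof (intro ballI impI; elim conjE)
    fix e f assume e: "e \<in> ?F" "e \<subseteq> C \<union> set c" and f: "f \<in> ?F" "f \<subseteq> C \<union> set c" and ef: "e \<noteq> f" "e \<inter> f \<noteq> {}"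
    consider "e \<in> cedges c" "f \<in> cedges c" | "e \<notin> cedges c" "f \<notin> cedges c"
      | "e \<in> cedges c" "f \<in> F" | "e \<in> F" "f \<in> cedges c" using e(1) f(1) by blast
    then show "lb' e = lb' f \<and> tp' e = tp' f \<and>
       (r' f = Suc (r' e) \<or> r' e = Suc (r' f) \<or>
        even (tp' e) \<and> (r' e = 0 \<and> r' f = tp' e \<or> r' f = 0 \<and> r' e = tp' e))"
    proof cases
      case 1
      have "ix e \<noteq> ix f" using ix[OF 1(1)] ix[OF 1(2)] ef(1) by metis
      then have "ix f = Suc (ix e) \<or> ix e = Suc (ix f) \<or> ix e = 0 \<and> Suc (ix f) = ?n \<or> ix f = 0 \<and> Suc (ix e) = ?n"
        using cedge_meet[OF oc_cycle.hyps(3,2) ix(1)[OF 1(1)] ix(1)[OF 1(2)]] ix(2)[OF 1(1)] ix(2)[OF 1(2)] ef(2) by metis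
      then show ?thesis using 1 oc_cycle.hyps(4) by (auto simp: r'_def lb'_def tp'_def)
    next
      case 2
      then show ?thesis using old[OF e 2(1)] old[OF f 2(2)] B ef by (simp add: r'_def lb'_def tp'_def)
    next
      case 3
      then show ?thesis using sub[of e] cF[of f] ef(2) by blast
    next
      case 4
      then show ?thesis using sub[of f] cF[of e] ef(2) by blast
    qed
  qed
  moreover have "?D ?F (C \<union> set c) r' lb'"
  proof (intro ballI impI; elim conjE)
    fix e f assume e: "e \<in> ?F" "e \<subseteq> C \<union> set c" and f: "f \<in> ?F" "f \<subseteq> C \<union> set c"
      and ef: "lb' e = lb' f" "r' e = r' f"
    have big: "lb g \<le> card F" if "g \<in> ?F" "g \<subseteq> C \<union> set c" "g \<notin> cedges c" for g
      using old[OF that] A by auto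
    show "e = f"
    proof (cases "e \<in> cedges c"; cases "f \<in> cedges c")
      assume a: "e \<in> cedges c" "f \<in> cedges c"
      then show ?thesis using ef(2) ix(2)[OF a(1)] ix(2)[OF a(2)] by (simp add: r'_def)
    next
      assume a: "e \<notin> cedges c" "f \<notin> cedges c"
      then show ?thesis using old[OF e a(1)] old[OF f a(2)] D ef by (simp add: r'_def lb'_def)
    next
      assume a: "e \<in> cedges c" "f \<notin> cedges c"
      then show ?thesis using big[OF f a(2)] ef(1) by (simp add: lb'_def)
    next
      assume a: "e \<notin> cedges c" "f \<in> cedges c"
      then show ?thesis using big[OF e a(1)] ef(1) by (simp add: lb'_def)
    qed
  qed
  ultimately show ?case by (intro exI conjI)
qed

text \<open>The rank of a tree edge is the depth of its lower end, so its neighbours of no larger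
  rank all meet it at the upper end \<open>a\<close>. Since \<open>a\<close> has at most three
  edges, \<open>e\<close> and two such neighbours \<open>f\<close>, \<open>g\<close> are all of
  them. Only one edge at \<open>a\<close> leads to the parent, so \<open>f\<close> or
  \<open>g\<close> has the same rank as \<open>e\<close>, and its own neighbours of low rank are
  again among the edges at \<open>a\<close>.\<close>

lemma oc_cert:
  assumes oc: "oc F C"
  shows "\<exists>r lb tp. cert F (\<lambda>e f. e \<noteq> f \<and> e \<inter> f \<noteq> {}) (\<lambda>e. e \<subseteq> C) r lb tp \<and>
    (\<forall>e\<in>F. r e \<le> card F \<and> lb e \<le> card F \<and> tp e \<le> card F)"
proof -
  have fin: "finite F" and two: "\<And>e. e \<in> F \<Longrightarrow> card e = 2" using oc_props[OF oc] by auto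
  obtain d where d: "tlab F C d" using oc_tree_labels[OF oc] by blast
  note d1 = tlabD(1)[OF d] and d2 = tlabD(2)[OF d] and d3 = tlabD(3)[OF d] and d4 = tlabD(4)[OF d]
  obtain r lb tp where A: "\<forall>e\<in>F. e \<subseteq> C \<longrightarrow> r e \<le> card F \<and> lb e \<le> card F \<and> tp e \<le> card F"
    and B: "\<forall>e\<in>F. \<forall>f\<in>F. e \<subseteq> C \<and> f \<subseteq> C \<and> e \<noteq> f \<and> e \<inter> f \<noteq> {} \<longrightarrow> lb e = lb f \<and> tp e = tp f \<and>
       (r f = Suc (r e) \<or> r e = Suc (r f) \<or>
        even (tp e) \<and> (r e = 0 \<and> r f = tp e \<or> r f = 0 \<and> r e = tp e))"
    and D: "\<forall>e\<in>F. \<forall>f\<in>F. e \<subseteq> C \<and> f \<subseteq> C \<and> lb e = lb f \<and> r e = r f \<longrightarrow> e = f"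
    using oc_cycle_labels[OF oc] by (elim exE conjE) (rule that)
  define R where "R e = (if e \<subseteq> C then r e else Max (d ` e))" for e
  define I where "I e = (if e \<subseteq> C then lb e else 0)" for e
  define T where "T e = (if e \<subseteq> C then tp e else 0)" for e
  have split: "e \<subseteq> C \<or> e \<inter> C = {}" if e: "e \<in> F" for e
  proof -
    obtain a b where "e = {a, b}" using two[OF e] by (auto simp: card_2_iff)
    then show ?thesis using d1[of a b] d1[of b a] e by (auto simp: insert_commute)
  qed
  have same: "e \<subseteq> C \<longleftrightarrow> f \<subseteq> C" if "e \<in> F" "f \<in> F" "e \<inter> f \<noteq> {}" for e f
    using split[OF that(1)] split[OF that(2)] that(3) by blast
  have shape: "\<exists>a b. e = {a, b} \<and> a \<noteq> b \<and> a \<notin> C \<and> b \<notin> C \<and> d b = Suc (d a) \<and> R e = d b"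
    if e: "e \<in> F" "\<not> e \<subseteq> C" for e
  proof -
    obtain a b where ab: "e = {a, b}" "a \<noteq> b" using two[OF e(1)] by (auto simp: card_2_iff)
    have "a \<notin> C" "b \<notin> C" using split[OF e(1)] e(2) ab by auto
    moreover have "d b = Suc (d a) \<or> d a = Suc (d b)" using d1[of a b] e ab calculation by auto
    moreover have "R e = Max (d ` e)" using e(2) by (simp add: R_def)
    then have "R e = max (d a) (d b)" by (simp add: ab(1))
    ultimately show ?thesis using ab by (metis insert_commute lessI max.absorb3 max.absorb4)
  qed
  have low: "a \<in> f" if "{a, b} \<in> F" "b \<notin> C" "d b = Suc (d a)" and fF: "f \<in> F" and "f \<noteq> {a, b}" "{a, b} \<inter> f \<noteq> {}" "R f \<le> d b" for a b f
  proof (rule ccontr)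
    assume "a \<notin> f"
    then have bf: "b \<in> f" using that(6) by auto
    then have "\<not> f \<subseteq> C" using that(2) by auto
    then obtain x y where xy: "f = {x, y}" "x \<noteq> y" "d y = Suc (d x)" "R f = d y" using shape[OF fF] by blast
    have "b = y" using bf xy that(7) by auto
    then have "x = a" using d2[of b x a] that xy by (auto simp: insert_commute)
    then show False using \<open>a \<notin> f\<close> xy by simp
  qed
  have "cert F (\<lambda>e f. e \<noteq> f \<and> e \<inter> f \<noteq> {}) (\<lambda>e. e \<subseteq> C) R I T"
    unfolding cert_def
  proof (intro conjI ballI impI; elim conjE)
    fix e f assume "e \<in> F" "f \<in> F" "e \<inter> f \<noteq> {}" then show "e \<subseteq> C \<longleftrightarrow> f \<subseteq> C" by (rule same)
  next
    fix e f assume ef: "e \<in> F" "f \<in> F" "e \<subseteq> C" "e \<noteq> f" "e \<inter> f \<noteq> {}"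
    then have "f \<subseteq> C" using same by blast
    then show "I e = I f" "T e = T f" "R f = Suc (R e) \<or> R e = Suc (R f) \<or>
        even (T e) \<and> (R e = 0 \<and> R f = T e \<or> R f = 0 \<and> R e = T e)"
      using B[rule_format, of e f] ef unfolding R_def I_def T_def by auto
  next
    fix e f assume "e \<in> F" "f \<in> F" "e \<subseteq> C" "f \<subseteq> C" "I e = I f" "R e = R f"
    then show "e = f" using D unfolding R_def I_def by simp
  next
    fix e f g assume e: "e \<in> F" "\<not> e \<subseteq> C" and f: "f \<in> F" "e \<noteq> f" "e \<inter> f \<noteq> {}" "R f \<le> R e"
      and g: "g \<in> F" "e \<noteq> g" "e \<inter> g \<noteq> {}" "R g \<le> R e" and fg: "f \<noteq> g"
    obtain a b where ab: "e = {a, b}" "a \<notin> C" "b \<notin> C" "d b = Suc (d a)" "R e = d b"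
      using shape[OF e] by blast
    have af: "a \<in> f" "a \<in> g" using low[of a b f] low[of a b g] e f g ab by auto
    have deg: "h = e \<or> h = f \<or> h = g" if "h \<in> F" "a \<in> h" for h
    proof (rule ccontr)
      assume h: "\<not> (h = e \<or> h = f \<or> h = g)"
      have "card {h, e, f, g} \<le> card {e \<in> F. a \<in> e}"
        by (rule card_mono) (use fin that e f g ab af in auto)
      moreover have "card {h, e, f, g} = 4" using h f(2) g(2) fg by auto
      ultimately show False using d3[OF ab(2)] by simp
    qed
    have deg': "h = e \<or> h = g \<or> h = f" if "h \<in> F" "a \<in> h" for h
      using deg[OF that] by blast
    have key: "R f' = R e \<and> (\<forall>h\<in>F. (f' \<noteq> h \<and> f' \<inter> h \<noteq> {}) \<and> R h \<le> R f' \<longrightarrow> h = e \<or> h = g')"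
      if f': "f' \<in> F" "a \<in> f'" "x \<notin> C" "f' = {a, x}" "d x = Suc (d a)" "\<And>h. h \<in> F \<Longrightarrow> a \<in> h \<Longrightarrow> h = e \<or> h = f' \<or> h = g'" for f' g' x
    proof -
      have R: "R f' = d x" using f' ab(2) by (auto simp: R_def)
      show ?thesis
      proof (intro conjI ballI impI; (elim conjE)?)
        show "R f' = R e" using R ab f' by simp
        fix h assume h: "h \<in> F" "f' \<noteq> h" "f' \<inter> h \<noteq> {}" "R h \<le> R f'"
        then have "a \<in> h" using low[of a x h] f' R by auto
        then show "h = e \<or> h = g'" using f'(6)[OF h(1)] h(2) by blast
      qed
    qed
    obtain x where x: "f = {a, x}" "x \<noteq> a" using two[OF f(1)] af(1) by (auto simp: card_2_iff)
    obtain y where y: "g = {a, y}" "y \<noteq> a" using two[OF g(1)] af(2) by (auto simp: card_2_iff)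
    have dx: "x \<notin> C \<and> (d x = Suc (d a) \<or> d a = Suc (d x))" using d1[of a x] f x ab by simp
    have dy: "y \<notin> C \<and> (d y = Suc (d a) \<or> d a = Suc (d y))" using d1[of a y] g y ab by simp
    have "d x = Suc (d a) \<or> d y = Suc (d a)"
      using dx dy d2[of a x y] ab f(1) g(1) x y fg by auto
    then show "R f = R e \<and> (\<forall>h\<in>F. (f \<noteq> h \<and> f \<inter> h \<noteq> {}) \<and> R h \<le> R f \<longrightarrow> h = e \<or> h = g) \<or>
       R g = R e \<and> (\<forall>h\<in>F. (g \<noteq> h \<and> g \<inter> h \<noteq> {}) \<and> R h \<le> R g \<longrightarrow> h = e \<or> h = f)"
    proof
      assume "d x = Suc (d a)"
      then show ?thesis by (intro disjI1 key[OF f(1) af(1) conjunct1[OF dx] x(1)] deg)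
    next
      assume "d y = Suc (d a)"
      then show ?thesis
        by (intro disjI2 key[OF g(1) af(2) conjunct1[OF dy] y(1)] deg')
    qed
  qed
  moreover have "R e \<le> card F \<and> I e \<le> card F \<and> T e \<le> card F" if "e \<in> F" for e
  proof (cases "e \<subseteq> C")
    case True
    then show ?thesis using A that by (simp add: R_def I_def T_def)
  next
    case False
    moreover obtain b where "R e = d b" using shape[OF \<open>e \<in> F\<close> False] by blast
    ultimately show ?thesis using d4 by (simp add: I_def T_def)
  qed
  ultimately show ?thesis by blast
qed

text \<open>The converse of \<open>noeven_oc\<close> comes from soundness of the certificates, so no
  separate analysis of line graph cycles inside the components is made.\<close>

lemma oc_noeven:
  assumes "oc F C"
  shows "noeven F"
  unfolding noeven_def
proof (intro allI impI)
  fix c assume c: "lcyc F c"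
  obtain r lb tp where "cert F (\<lambda>e f. e \<noteq> f \<and> e \<inter> f \<noteq> {}) (\<lambda>e. e \<subseteq> C) r lb tp"
    using oc_cert[OF assms] by blast
  then show "odd (length c)"
  proof (rule cert_sound)
    fix i assume i: "i < length c"
    have "Suc i mod length c < length c" using i by (intro mod_less_divisor) linarith
    moreover have "i \<noteq> Suc i mod length c" using i c by (auto simp: Suc_mod lcyc_def)
    ultimately show "c ! i \<noteq> c ! (Suc i mod length c) \<and> c ! i \<inter> c ! (Suc i mod length c) \<noteq> {}"
      using i c by (auto simp: lcyc_def nth_eq_iff_index_eq)
  qed (use c in \<open>auto simp: lcyc_def\<close>)
qed

text \<open>This carries labels from root edges to their numbers and, with the identity as
  \<open>g\<close>, replaces labels by equal ones.\<close>

lemma cert_map: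
  assumes c: "cert (g ` U) adj cy r lb tp" and inj: "inj_on g U"
    and adj: "\<And>e f. e \<in> U \<Longrightarrow> f \<in> U \<Longrightarrow> adj' e f = adj (g e) (g f)"
    and eq: "\<And>e. e \<in> U \<Longrightarrow> cy' e = cy (g e) \<and> r' e = r (g e) \<and> lb' e = lb (g e) \<and> tp' e = tp (g e)"
  shows "cert U adj' cy' r' lb' tp'"
proof -
  have q: "cy' e = cy (g e)" "r' e = r (g e)" "lb' e = lb (g e)" "tp' e = tp (g e)" if "e \<in> U" for e
    using eq[OF that] by auto
  note c1 = certD(1)[OF c] and c2 = certD(2)[OF c] and c3 = certD(3)[OF c] and c4 = certD(4)[OF c]
  show ?thesis
    unfolding cert_def
  proof (intro conjI ballI impI; (elim conjE)?)
    fix e f assume ef: "e \<in> U" "f \<in> U" and a: "adj' e f"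
    show "cy' e = cy' f" using c1[of "g e" "g f"] ef a by (simp add: q adj)
    assume "cy' e"
    then show "lb' e = lb' f" "tp' e = tp' f" "r' f = Suc (r' e) \<or> r' e = Suc (r' f) \<or>
        even (tp' e) \<and> (r' e = 0 \<and> r' f = tp' e \<or> r' f = 0 \<and> r' e = tp' e)"
      using c2[of "g e" "g f"] ef a by (auto simp: q adj)
  next
    fix e f assume ef: "e \<in> U" "f \<in> U" and a: "cy' e" "cy' f" "lb' e = lb' f" "r' e = r' f"
    then have "g e = g f" using c3[of "g e" "g f"] by (simp add: q)
    then show "e = f" using inj_onD[OF inj] ef by blast
  next
    fix e f k assume u: "e \<in> U" "f \<in> U" "k \<in> U" and a: "\<not> cy' e" "adj' e f" "adj' e k" "f \<noteq> k" "r' f \<le> r' e" "r' k \<le> r' e"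
    have "g f \<noteq> g k" using inj_onD[OF inj] u a(4) by blast
    then have "r (g f) = r (g e) \<and> (\<forall>h\<in>g ` U. adj (g f) h \<and> r h \<le> r (g f) \<longrightarrow> h = g e \<or> h = g k) \<or>
       r (g k) = r (g e) \<and> (\<forall>h\<in>g ` U. adj (g k) h \<and> r h \<le> r (g k) \<longrightarrow> h = g e \<or> h = g f)"
      using c4[of "g e" "g f" "g k"] u a by (simp add: q adj)
    moreover have "g h = g y \<longleftrightarrow> h = y" if "h \<in> U" "y \<in> U" for h y using inj_onD[OF inj] that by blast
    ultimately show "r' f = r' e \<and> (\<forall>h\<in>U. adj' f h \<and> r' h \<le> r' f \<longrightarrow> h = e \<or> h = k) \<or>
       r' k = r' e \<and> (\<forall>h\<in>U. adj' k h \<and> r' h \<le> r' k \<longrightarrow> h = e \<or> h = f)"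
      using u by (simp add: q adj)
  qed
qed

section \<open>The gadget graph of a tiling problem\<close>

text \<open>Every pair of a cell and a tile has a pentagon \<open>Pn\<close> and a wire \<open>Wv\<close> of even length, and the edge of the
  pentagon between 4 and 0 may be replaced by the detour through the wire. For every vertex \<open>h\<close> of the
  wire there is a hexagon \<open>Hx\<close>; being even, it has to be enlarged to a heptagon by that vertex or
  by an element \<open>El\<close>. So the odd cycles cover the elements by those tiles whose wires are used as
  detours. For a forbidden tile the edge from 0 into the wire leads
  to 2 instead, which blocks the detour.\<close>

datatype vx = El nat | Pn nat nat | Wv nat nat | Hx nat nat nat
datatype ed = EP nat nat | ES nat | ET nat | EW nat nat | EH nat nat nat | EL nat nat nat

lemma less_5: "(i::nat) < 5 \<longleftrightarrow> i = 0 \<or> i = 1 \<or> i = 2 \<or> i = 3 \<or> i = 4" by auto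
lemma less_6: "(i::nat) < 6 \<longleftrightarrow> i = 0 \<or> i = 1 \<or> i = 2 \<or> i = 3 \<or> i = 4 \<or> i = 5" by auto
lemma less_4: "(i::nat) < 4 \<longleftrightarrow> i = 0 \<or> i = 1 \<or> i = 2 \<or> i = 3" by auto

lemma two_of_two: "card S = 2 \<Longrightarrow> S \<subseteq> {a, b} \<Longrightarrow> a \<in> S \<and> b \<in> S"
  by (auto simp: card_2_iff)

lemma two_eq: "card S = 2 \<Longrightarrow> a \<in> S \<Longrightarrow> b \<in> S \<Longrightarrow> a \<noteq> b \<Longrightarrow> S = {a, b}"
  by (auto simp: card_2_iff)

lemma two_of_three:
  assumes "card S = 2" "S \<subseteq> {a, b, c}" "a \<in> S" "a \<noteq> b" "a \<noteq> c" "b \<noteq> c"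
  shows "b \<in> S \<longleftrightarrow> c \<notin> S"
  using assms by (auto simp: card_2_iff)

locale gadget =
  fixes N W K Q :: nat and lf rt up dn :: "nat \<Rightarrow> nat" and A :: "nat \<Rightarrow> nat \<Rightarrow> bool"
  assumes pos: "0 < N" "0 < Q"
    and col: "\<And>v. v < Q \<Longrightarrow> lf v < K" "\<And>v. v < Q \<Longrightarrow> rt v < K" "\<And>v. v < Q \<Longrightarrow> up v < K" "\<And>v. v < Q \<Longrightarrow> dn v < K"
begin

text \<open>One element for each colour at the left and at the lower border, and two for the cell
  itself. As \<open>M\<close> is even, a pentagon enlarged by the \<open>M\<close> vertices of a
  wire stays odd.\<close>

definition M :: nat where "M = 2 * K + 2"

text \<open>The torus is wound up as a helix: the last cell of a row is followed by the first one of
  the next row, so neighbours are given by addition modulo \<open>N\<close>, without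
  coordinates.\<close>

definition sol :: "(nat \<Rightarrow> nat) \<Rightarrow> bool" where
  "sol f \<longleftrightarrow> (\<forall>z<N. f z < Q \<and> A z (f z) \<and> rt (f z) = lf (f ((z + 1) mod N)) \<and> up (f z) = dn (f ((z + W) mod N)))"

text \<open>Choosing tile \<open>v\<close> at \<open>z\<close> covers the cell of \<open>z\<close> (elements 0 and 1, so that M is even), at its
  left and lower borders all colours except its own, and its own colour at its right and upper
  borders.  All elements are covered exactly once iff the colours match.\<close>

definition sl :: "nat \<Rightarrow> nat \<Rightarrow> nat \<times> nat" where
  "sl v h = (if h = 2 + lf v then (1, 2 + rt v) else if h = K + 2 + dn v then (W, K + 2 + up v) else (0, h))"

definition elm :: "nat \<Rightarrow> nat \<Rightarrow> nat \<Rightarrow> nat \<times> vx" where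
  "elm z v h = ((z + fst (sl v h)) mod N, El (snd (sl v h)))"

fun okE :: "ed \<Rightarrow> bool" where
  "okE (EP i v) = (i < 5 \<and> v < Q)"
| "okE (ES v) = (v < Q)"
| "okE (ET v) = (v < Q)"
| "okE (EW v h) = (v < Q \<and> Suc h < M)"
| "okE (EH i v h) = (i < 6 \<and> v < Q \<and> h < M)"
| "okE (EL s v h) = (s < 4 \<and> v < Q \<and> h < M)"

fun okV :: "vx \<Rightarrow> bool" where
  "okV (El j) = (j < M)"
| "okV (Pn i v) = (i < 5 \<and> v < Q)"
| "okV (Wv v h) = (v < Q \<and> h < M)"
| "okV (Hx i v h) = (i < 6 \<and> v < Q \<and> h < M)"

fun end1 :: "nat \<Rightarrow> ed \<Rightarrow> nat \<times> vx" where
  "end1 z (EP i v) = (z, Pn i v)"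
| "end1 z (ES v) = (z, Pn 0 v)"
| "end1 z (ET v) = (z, Pn 4 v)"
| "end1 z (EW v h) = (z, Wv v h)"
| "end1 z (EH i v h) = (z, Hx i v h)"
| "end1 z (EL s v h) = (z, Hx (if s = 0 then 0 else if s = 1 then 1 else if s = 2 then 3 else 4) v h)"

fun end2 :: "nat \<Rightarrow> ed \<Rightarrow> nat \<times> vx" where
  "end2 z (EP i v) = (z, Pn (if i = 4 then 0 else Suc i) v)"
| "end2 z (ES v) = (z, if A z v then Wv v 0 else Pn 2 v)"
| "end2 z (ET v) = (z, Wv v (M - 1))"
| "end2 z (EW v h) = (z, Wv v (Suc h))"
| "end2 z (EH i v h) = (z, Hx (if i = 5 then 0 else Suc i) v h)"
| "end2 z (EL s v h) = (if s < 2 then (z, Wv v h) else elm z v h)"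

definition E :: "(nat \<times> vx) set set" where
  "E = {{end1 z \<epsilon>, end2 z \<epsilon>} | z \<epsilon>. z < N \<and> okE \<epsilon>}"

definition Vs :: "(nat \<times> vx) set" where
  "Vs = {..<N} \<times> {\<alpha>. okV \<alpha>}"

lemma finite_okV: "finite {\<alpha>. okV \<alpha>}"
proof -
  have "{\<alpha>. okV \<alpha>} \<subseteq> El ` {..<M} \<union> (\<lambda>(i, v). Pn i v) ` ({..<5} \<times> {..<Q}) \<union> (\<lambda>(v, h). Wv v h) ` ({..<Q} \<times> {..<M})
     \<union> (\<lambda>(i, v, h). Hx i v h) ` ({..<6} \<times> {..<Q} \<times> {..<M})"
  proof
    fix \<alpha> assume "\<alpha> \<in> {\<alpha>. okV \<alpha>}"
    then show "\<alpha> \<in> El ` {..<M} \<union> (\<lambda>(i, v). Pn i v) ` ({..<5} \<times> {..<Q}) \<union> (\<lambda>(v, h). Wv v h) ` ({..<Q} \<times> {..<M})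
     \<union> (\<lambda>(i, v, h). Hx i v h) ` ({..<6} \<times> {..<Q} \<times> {..<M})"
      by (cases \<alpha>) (auto simp: image_iff)
  qed
  then show ?thesis by (rule finite_subset) auto
qed

lemma finite_Vs: "finite Vs" unfolding Vs_def using finite_okV by simp

lemma M_pos: "0 < M" "2 \<le> M" by (auto simp: M_def)

lemma sl_less: "v < Q \<Longrightarrow> h < M \<Longrightarrow> snd (sl v h) < M"
  using col(2,3)[of v] by (auto simp: sl_def M_def)

lemma elm_Vs: "v < Q \<Longrightarrow> h < M \<Longrightarrow> elm z v h \<in> Vs"
  using sl_less pos by (auto simp: elm_def Vs_def)

lemma E_Vs: "\<Union>E \<subseteq> Vs"
proof -
  have "end1 z \<epsilon> \<in> Vs \<and> end2 z \<epsilon> \<in> Vs" if "z < N" "okE \<epsilon>" for z \<epsilon>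
    using that M_pos elm_Vs by (cases \<epsilon>) (auto simp: Vs_def)
  then show ?thesis unfolding E_def by auto
qed

lemma ends_neq: "okE \<epsilon> \<Longrightarrow> end1 z \<epsilon> \<noteq> end2 z \<epsilon>"
  by (cases \<epsilon>) (auto simp: elm_def)

lemma E_card: "e \<in> E \<Longrightarrow> card e = 2"
  using ends_neq by (auto simp: E_def card_insert_if)

text \<open>Edges can therefore be counted and numbered by cell and name. This includes
  \<open>ES\<close> for a forbidden tile, which is a chord of the pentagon.\<close>

lemma ends_inj:
  assumes "z < N" "z' < N" "okE \<epsilon>" "okE \<epsilon>'" "{end1 z \<epsilon>, end2 z \<epsilon>} = {end1 z' \<epsilon>', end2 z' \<epsilon>'}"
  shows "z = z' \<and> \<epsilon> = \<epsilon>'"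
  using assms
  by (cases \<epsilon>; cases \<epsilon>') (auto simp: doubleton_eq_iff elm_def less_4 split: if_splits)

lemma E_I: "z < N \<Longrightarrow> okE \<epsilon> \<Longrightarrow> {end1 z \<epsilon>, end2 z \<epsilon>} \<in> E"
  unfolding E_def by blast

lemma nbE:
  assumes "{x, y} \<in> E"
  shows "\<exists>z \<epsilon>. z < N \<and> okE \<epsilon> \<and> (x = end1 z \<epsilon> \<and> y = end2 z \<epsilon> \<or> y = end1 z \<epsilon> \<and> x = end2 z \<epsilon>)"
  using assms unfolding E_def by (auto simp: doubleton_eq_iff)

text \<open>An upper bound for the neighbourhoods; where it has two elements, degree 2 forces both
  edges.\<close>

fun nbs :: "nat \<Rightarrow> vx \<Rightarrow> (nat \<times> vx) set" where
  "nbs z (Pn i v) = {(z, Pn (if i = 4 then 0 else Suc i) v), (z, Pn (if i = 0 then 4 else i - 1) v)} \<union>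
     (if i = 0 then {end2 z (ES v)} else if i = 4 then {(z, Wv v (M - 1))} else if i = 2 then {(z, Pn 0 v)} else {})"
| "nbs z (Wv v h) = {(z, Hx 0 v h), (z, Hx 1 v h), (if h = 0 then (z, Pn 0 v) else (z, Wv v (h - 1))),
     (if h = M - 1 then (z, Pn 4 v) else (z, Wv v (Suc h)))}"
| "nbs z (Hx i v h) = {(z, Hx (if i = 5 then 0 else Suc i) v h), (z, Hx (if i = 0 then 5 else i - 1) v h)} \<union>
     (if i < 2 then {(z, Wv v h)} else if i = 3 \<or> i = 4 then {elm z v h} else {})"
| "nbs z (El j) = {(z', Hx i v h) | z' i v h. z' < N \<and> v < Q \<and> h < M \<and> (i = 3 \<or> i = 4) \<and> elm z' v h = (z, El j)}"

lemma E_nbs: "{(z, \<alpha>), y} \<in> E \<Longrightarrow> y \<in> nbs z \<alpha>"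
proof (drule nbE, elim exE conjE)
  fix z' \<epsilon> assume "z' < N" "okE \<epsilon>" "(z, \<alpha>) = end1 z' \<epsilon> \<and> y = end2 z' \<epsilon> \<or> y = end1 z' \<epsilon> \<and> (z, \<alpha>) = end2 z' \<epsilon>"
  then show "y \<in> nbs z \<alpha>"
    by (cases \<epsilon>) (auto simp: elm_def less_4 less_5 less_6 split: if_splits)
qed

end

section \<open>From odd 2-factors to tilings\<close>

context gadget begin

text \<open>Vertices with only two edges in \<open>E\<close> use both. This leaves one binary choice
  at each pentagon and one at either of two opposite edges of each hexagon; parity couples the
  latter two, and the wire couples all hexagons of a tile with its pentagon. That elements have
  degree 2 then makes the chosen tiles an exact cover.\<close>

lemma two_factor_sol:
  assumes F: "F \<subseteq> E" and deg: "\<And>x. x \<in> Vs \<Longrightarrow> card {w. {x, w} \<in> F} = 2"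
    and par: "\<And>x. x \<in> Vs \<Longrightarrow> \<exists>X. x \<in> X \<and> odd (card X) \<and> (\<forall>u\<in>X. \<forall>w. {u, w} \<in> F \<longrightarrow> w \<in> X) \<and>
      (\<forall>Y. x \<in> Y \<longrightarrow> (\<forall>u\<in>Y. \<forall>w. {u, w} \<in> F \<longrightarrow> w \<in> Y) \<longrightarrow> X \<subseteq> Y)"
  shows "\<exists>f. sol f"
proof -
  define nb where "nb x = {w. {x, w} \<in> F}" for x
  have sym: "y \<in> nb x \<longleftrightarrow> x \<in> nb y" for x y by (simp add: nb_def insert_commute)
  define cl where "cl Y \<longleftrightarrow> (\<forall>u\<in>Y. \<forall>w. {u, w} \<in> F \<longrightarrow> w \<in> Y)" for Y
  have clI: "cl Y" if "\<And>u. u \<in> Y \<Longrightarrow> nb u \<subseteq> Y" for Y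
    using that unfolding cl_def nb_def by auto
  have clD: "w \<in> Y" if "cl Y" "u \<in> Y" "w \<in> nb u" for Y u w
    using that unfolding cl_def nb_def by blast
  note par = par[folded cl_def]
  have symD: "x \<in> nb y" if "y \<in> nb x" for x y using that sym by blast
  have nbs': "nb (z, \<alpha>) \<subseteq> nbs z \<alpha>" for z \<alpha> using E_nbs F by (auto simp: nb_def)
  have deg': "card (nb (z, \<alpha>)) = 2" if "z < N" "okV \<alpha>" for z \<alpha>
    using deg[of "(z, \<alpha>)"] that by (simp add: nb_def Vs_def)
  define chosen where "chosen z v \<longleftrightarrow> end2 z (ES v) \<in> nb (z, Pn 0 v)" for z v
  define cov where "cov z v h \<longleftrightarrow> elm z v h \<in> nb (z, Hx 3 v h)" for z v h
  have pent: "chosen z v \<longleftrightarrow> (z, Wv v (M - 1)) \<in> nb (z, Pn 4 v)" and allowed: "chosen z v \<Longrightarrow> A z v"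
    if z: "z < N" and v: "v < Q" for z v
  proof -
    let ?p = "\<lambda>i. (z, Pn i v)"
    have d: "card (nb (?p i)) = 2" if "i < 5" for i using deg'[OF z] v that by simp
    \<comment> \<open>\<open>Pn 1\<close> and \<open>Pn 3\<close> have no other edges, so
      \<open>Pn 2\<close> is saturated from both sides, and the edge that \<open>ES\<close> becomes
      for a forbidden tile cannot be used.\<close>
    have 1: "?p 2 \<in> nb (?p 1)" "?p 0 \<in> nb (?p 1)"
      using two_of_two[OF d[of 1], of "?p 2" "?p 0"] nbs'[of z "Pn 1 v"] by (auto simp: numeral_2_eq_2)
    have 3: "?p 4 \<in> nb (?p 3)" "?p 2 \<in> nb (?p 3)"
      using two_of_two[OF d[of 3], of "?p 4" "?p 2"] nbs'[of z "Pn 3 v"] by auto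
    have 2: "nb (?p 2) = {?p 1, ?p 3}"
      by (rule two_eq[OF d]) (use 1 3 sym in auto)
    have p2: "end2 z (ES v) = ?p 2 \<Longrightarrow> \<not> chosen z v"
      unfolding chosen_def sym[of _ "?p 0"] by (simp only: 2) simp
    show "A z v" if "chosen z v"
    proof (rule ccontr)
      assume "\<not> A z v"
      then have "end2 z (ES v) = ?p 2" by simp
      then show False using p2 that by blast
    qed
    have "?p 4 \<in> nb (?p 0) \<longleftrightarrow> end2 z (ES v) \<notin> nb (?p 0)"
    proof (rule two_of_three[OF d, of _ "?p 1"])
      show "nb (?p 0) \<subseteq> {?p 1, ?p 4, end2 z (ES v)}" using nbs'[of z "Pn 0 v"] by auto
      show "?p 1 \<in> nb (?p 0)" using 1 sym by blast
    qed auto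
    moreover have "?p 0 \<in> nb (?p 4) \<longleftrightarrow> (z, Wv v (M - 1)) \<notin> nb (?p 4)"
    proof (rule two_of_three[OF d, of _ "?p 3"])
      show "nb (?p 4) \<subseteq> {?p 3, ?p 0, (z, Wv v (M - 1))}" using nbs'[of z "Pn 4 v"] by auto
      show "?p 3 \<in> nb (?p 4)" using 3 sym by blast
    qed auto
    ultimately show "chosen z v \<longleftrightarrow> (z, Wv v (M - 1)) \<in> nb (z, Pn 4 v)"
      unfolding chosen_def using sym by blast
  qed
  have cov4: "elm z v h \<in> nb (z, Hx 4 v h) \<longleftrightarrow> cov z v h" and covc: "cov z v h \<longleftrightarrow> chosen z v"
    if z: "z < N" and v: "v < Q" and h: "h < M" for z v h
  proof -
    have base: "((z, Wv v h) \<in> nb (z, Hx 0 v h) \<longleftrightarrow> (z, Wv v h) \<in> nb (z, Hx 1 v h)) \<and>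
      (elm z v h \<in> nb (z, Hx 4 v h) \<longleftrightarrow> cov z v h) \<and> (cov z v h \<longleftrightarrow> (z, Wv v h) \<notin> nb (z, Hx 0 v h))"
      if h: "h < M" for h
    proof -
      let ?h = "\<lambda>i. (z, Hx i v h)" and ?w = "(z, Wv v h)" and ?e = "elm z v h"
      have d: "card (nb (?h i)) = 2" if "i < 6" for i using deg'[OF z] v h that by simp
      have 2: "?h 3 \<in> nb (?h 2)" "?h 1 \<in> nb (?h 2)"
        using two_of_two[OF d[of 2], of "?h 3" "?h 1"] nbs'[of z "Hx 2 v h"] by (auto simp: numeral_3_eq_3)
      have 5: "?h 0 \<in> nb (?h 5)" "?h 4 \<in> nb (?h 5)"
        using two_of_two[OF d[of 5], of "?h 0" "?h 4"] nbs'[of z "Hx 5 v h"] by auto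
      have e: "?e \<noteq> ?h i" "?e \<noteq> ?w" for i by (auto simp: elm_def)
      have sub: "nb (?h 0) \<subseteq> {?h 5, ?h 1, ?w}" "nb (?h 1) \<subseteq> {?h 2, ?h 0, ?w}"
        "nb (?h 3) \<subseteq> {?h 2, ?h 4, ?e}" "nb (?h 4) \<subseteq> {?h 5, ?h 3, ?e}"
        subgoal using nbs'[of z "Hx 0 v h"] by auto
        subgoal using nbs'[of z "Hx 1 v h"] by (auto simp: numeral_2_eq_2)
        subgoal using nbs'[of z "Hx 3 v h"] by auto
        subgoal using nbs'[of z "Hx 4 v h"] by auto
        done
      have 0: "?h 1 \<in> nb (?h 0) \<longleftrightarrow> ?w \<notin> nb (?h 0)"
        by (rule two_of_three[OF d sub(1)]) (use symD[OF 5(1)] in auto)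
      have 1: "?h 0 \<in> nb (?h 1) \<longleftrightarrow> ?w \<notin> nb (?h 1)"
        by (rule two_of_three[OF d sub(2)]) (use symD[OF 2(2)] in auto)
      have 3: "?h 4 \<in> nb (?h 3) \<longleftrightarrow> ?e \<notin> nb (?h 3)"
        by (rule two_of_three[OF d sub(3)]) (use symD[OF 2(1)] e e[symmetric] in auto)
      have 4: "?h 3 \<in> nb (?h 4) \<longleftrightarrow> ?e \<notin> nb (?h 4)"
        by (rule two_of_three[OF d sub(4)]) (use symD[OF 5(2)] e e[symmetric] in auto)
      have w: "?w \<in> nb (?h 0) \<longleftrightarrow> ?w \<in> nb (?h 1)" and ee: "?e \<in> nb (?h 4) \<longleftrightarrow> ?e \<in> nb (?h 3)"
        using 0 1 3 4 sym by blast+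
      \<comment> \<open>Without either detour the hexagon closes as a 6-cycle, with both it closes
        as an 8-cycle; so exactly one of the two is taken.\<close>
      have "cov z v h \<longleftrightarrow> ?w \<notin> nb (?h 0)"
      proof (rule ccontr)
        assume "\<not> ?thesis"
        then have same: "?e \<in> nb (?h 3) \<longleftrightarrow> ?w \<in> nb (?h 0)" unfolding cov_def by blast
        have "?h 5 \<in> Vs" using z v h by (simp add: Vs_def)
        from par[OF this] obtain X where X: "?h 5 \<in> X" "odd (card X)" "cl X"
          and Xm: "\<forall>Y. ?h 5 \<in> Y \<longrightarrow> cl Y \<longrightarrow> X \<subseteq> Y" by (elim exE conjE) (rule that)
        note cX = clD[OF X(3)]
        have X04: "?h 0 \<in> X" "?h 4 \<in> X" using cX[OF X(1)] 5 by blast+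
        let ?Y = "{?h 0, ?h 1, ?h 2, ?h 3, ?h 4, ?h 5}"
        have nb2: "nb (?h 2) = {?h 3, ?h 1}" by (rule two_eq[OF d]) (use 2 in auto)
        have nb5: "nb (?h 5) = {?h 0, ?h 4}" by (rule two_eq[OF d]) (use 5 in auto)
        show False
        proof (cases "?w \<in> nb (?h 0)")
          case False
          have "cl ?Y"
          proof (rule clI)
            fix u assume "u \<in> ?Y"
            then consider "u = ?h 0" | "u = ?h 1" | "u = ?h 2" | "u = ?h 3" | "u = ?h 4" | "u = ?h 5" by blast
            then show "nb u \<subseteq> ?Y"
            proof cases
              case 1 then show ?thesis unfolding 1 using sub(1) False by blast
            next
              case 2 then show ?thesis unfolding 2 using sub(2) False w by blast
            next
              case 3 then show ?thesis unfolding 3 nb2 by blast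
            next
              case 4 then show ?thesis unfolding 4 using sub(3) False same by blast
            next
              case 5 then show ?thesis unfolding 5 using sub(4) False same ee by blast
            next
              case 6 then show ?thesis unfolding 6 nb5 by blast
            qed
          qed
          then have "X \<subseteq> ?Y" by (intro Xm[rule_format]) simp_all
          moreover have "?h 1 \<in> X" "?h 3 \<in> X"
            using cX[OF X04(1)] cX[OF X04(2)] 0 4 False same ee by blast+
          moreover have "?h 2 \<in> X" using cX[OF \<open>?h 1 \<in> X\<close> symD[OF 2(2)]] .
          ultimately have "?Y \<subseteq> X" using X(1) X04 by (intro insert_subsetI) auto
          then have "X = ?Y" using \<open>X \<subseteq> ?Y\<close> by (intro equalityI)
          then have "card X = 6" by simp
          then show False using X(2) by simp
        next
          case True
          have wx: "?w \<in> X" using cX[OF X04(1) True] .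
          have ex: "?e \<in> X" using cX[OF X04(2)] True same ee by blast
          have h1: "?h 1 \<in> X" using cX[OF wx symD] True w by blast
          have h3: "?h 3 \<in> X" using cX[OF ex symD] True same by blast
          have h2: "?h 2 \<in> X" using cX[OF h1 symD[OF 2(2)]] .
          have nw: "nb ?w = {?h 0, ?h 1}"
            by (rule two_eq[OF _ symD symD]) (use deg'[OF z] v h True w in auto)
          obtain z' j where zj: "?e = (z', El j)" by (auto simp: elm_def)
          have "?e \<in> Vs" using elm_Vs v h by blast
          then have "card (nb ?e) = 2" unfolding nb_def by (rule deg)
          then have ne: "nb ?e = {?h 3, ?h 4}"
            by (rule two_eq[OF _ symD symD]) (use True same ee in auto)
          have "cl (insert ?w (insert ?e ?Y))"
          proof (rule clI)
            fix u assume "u \<in> insert ?w (insert ?e ?Y)"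
            then consider "u = ?w" | "u = ?e" | "u = ?h 0" | "u = ?h 1" | "u = ?h 2" | "u = ?h 3" | "u = ?h 4" | "u = ?h 5"
              by blast
            then show "nb u \<subseteq> insert ?w (insert ?e ?Y)"
            proof cases
              case 1 then show ?thesis unfolding 1 nw by blast
            next
              case 2 then show ?thesis unfolding 2 ne by blast
            next
              case 3 then show ?thesis unfolding 3 using sub(1) by blast
            next
              case 4 then show ?thesis unfolding 4 using sub(2) by blast
            next
              case 5 then show ?thesis unfolding 5 nb2 by blast
            next
              case 6 then show ?thesis unfolding 6 using sub(3) by blast
            next
              case 7 then show ?thesis unfolding 7 using sub(4) by blast
            next
              case 8 then show ?thesis unfolding 8 nb5 by blast
            qed
          qed
          then have "X \<subseteq> insert ?w (insert ?e ?Y)" by (intro Xm[rule_format]) simp_all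
          moreover have "insert ?w (insert ?e ?Y) \<subseteq> X"
            using X(1) X04 wx ex h1 h2 h3 by (intro insert_subsetI) auto
          ultimately have "X = insert ?w (insert ?e ?Y)" by (intro equalityI)
          moreover have "card (insert ?w (insert ?e ?Y)) = 8" using e by simp
          ultimately show False using X(2) by simp
        qed
      qed
      then show ?thesis using w ee unfolding cov_def by blast
    qed
    then show "elm z v h \<in> nb (z, Hx 4 v h) \<longleftrightarrow> cov z v h" using h by blast
    \<comment> \<open>Link \<open>h\<close> joins the wire vertices \<open>h - 1\<close> and
      \<open>h\<close>, where \<open>Pn 0\<close> precedes the wire and \<open>Pn 4\<close> follows
      it. A wire vertex either belongs to its hexagon or has both its links, so all links of a wire
      agree.\<close>
    define lk where "lk h \<longleftrightarrow> (if h = 0 then (z, Pn 0 v) else (z, Wv v (h - 1))) \<in>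
       nb (if h = M then (z, Pn 4 v) else (z, Wv v h))" for h
    have lks: "(lk h \<longleftrightarrow> (z, Wv v h) \<notin> nb (z, Hx 0 v h)) \<and> (lk (Suc h) \<longleftrightarrow> (z, Wv v h) \<notin> nb (z, Hx 0 v h))" if h: "h < M" for h
    proof -
      let ?w = "(z, Wv v h)"
      let ?a = "if h = 0 then (z, Pn 0 v) else (z, Wv v (h - 1))"
      let ?b = "if h = M - 1 then (z, Pn 4 v) else (z, Wv v (Suc h))"
      have d: "card (nb ?w) = 2" using deg'[OF z] v h by simp
      have sub: "nb ?w \<subseteq> {(z, Hx 0 v h), (z, Hx 1 v h), ?a, ?b}" using nbs'[of z "Wv v h"] by simp
      have la: "lk h \<longleftrightarrow> ?a \<in> nb ?w" using h by (simp add: lk_def)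
      have lb: "lk (Suc h) \<longleftrightarrow> ?b \<in> nb ?w" using h sym[of "?w"] by (auto simp: lk_def)
      have ws: "(z, Hx 0 v h) \<in> nb ?w \<longleftrightarrow> (z, Hx 1 v h) \<in> nb ?w" using base[OF h] sym by blast
      show ?thesis
      proof (cases "(z, Hx 0 v h) \<in> nb ?w")
        case True
        then have "nb ?w = {(z, Hx 0 v h), (z, Hx 1 v h)}" using ws by (intro two_eq[OF d]) auto
        moreover have "?a \<notin> {(z, Hx 0 v h), (z, Hx 1 v h)}" "?b \<notin> {(z, Hx 0 v h), (z, Hx 1 v h)}" by auto
        ultimately show ?thesis using la lb True sym[of "?w" "(z, Hx 0 v h)"] by metis
      next
        case False
        then have "nb ?w \<subseteq> {?a, ?b}" using sub ws by blast
        then have two: "?a \<in> nb ?w \<and> ?b \<in> nb ?w" by (rule two_of_two[OF d])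
        have "lk h" by (rule iffD2[OF la conjunct1[OF two]])
        moreover have "lk (Suc h)" by (rule iffD2[OF lb conjunct2[OF two]])
        moreover have "?w \<notin> nb (z, Hx 0 v h)" using False symD by blast
        ultimately show ?thesis by blast
      qed
    qed
    have "lk (M - k) \<longleftrightarrow> lk M" if "k \<le> M" for k
      using that
    proof (induction k)
      case (Suc k)
      then have "M - Suc k < M" "Suc (M - Suc k) = M - k" by auto
      then show ?case using lks[of "M - Suc k"] Suc by simp
    qed simp
    from this[of "M - h"] have "lk h \<longleftrightarrow> lk M" using h by simp
    moreover have "lk M \<longleftrightarrow> chosen z v" using pent[OF z v] M_pos by (simp add: lk_def)
    ultimately show "cov z v h \<longleftrightarrow> chosen z v" using lks[OF h] base[OF h] by blast
  qed
  have uniq: "z1 = z2 \<and> v1 = v2 \<and> h1 = h2"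
    if 1: "z1 < N" "v1 < Q" "h1 < M" "chosen z1 v1" and 2: "z2 < N" "v2 < Q" "h2 < M" "chosen z2 v2"
      and eq: "elm z1 v1 h1 = elm z2 v2 h2" for z1 v1 h1 z2 v2 h2
  proof -
    let ?e = "elm z1 v1 h1"
    have "?e \<in> Vs" using elm_Vs 1 by blast
    then have "card (nb ?e) = 2" unfolding nb_def by (rule deg)
    moreover have "(z1, Hx 3 v1 h1) \<in> nb ?e" "(z1, Hx 4 v1 h1) \<in> nb ?e"
      using cov4[OF 1(1-3)] covc[OF 1(1-3)] 1(4) sym unfolding cov_def by blast+
    ultimately have "nb ?e = {(z1, Hx 3 v1 h1), (z1, Hx 4 v1 h1)}" by (intro two_eq) auto
    moreover have "(z2, Hx 3 v2 h2) \<in> nb ?e"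
      using covc[OF 2(1-3)] 2(4) sym eq unfolding cov_def by metis
    ultimately show ?thesis by auto
  qed
  \<comment> \<open>Element 0 of a cell is covered by tiles at that very cell only, through
    \<open>h = 0\<close>, because the values that \<open>sl\<close> shifts to other cells are at
    least 2. It has to be covered, so some tile is chosen.\<close>
  have ex: "\<exists>v<Q. chosen z v" if z: "z < N" for z
  proof -
    have "card (nb (z, El 0)) = 2" using deg'[OF z] M_pos by simp
    then obtain y where y: "y \<in> nb (z, El 0)" by (metis card.empty equals0I zero_neq_numeral)
    then obtain z' i v h where *: "y = (z', Hx i v h)" "z' < N" "v < Q" "h < M" "i = 3 \<or> i = 4" "elm z' v h = (z, El 0)"
      using nbs'[of z "El 0"] by auto
    then have "h = 0" "z' = z" by (auto simp: elm_def sl_def split: if_splits)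
    moreover have "elm z' v h \<in> nb (z', Hx i v h)" using y * sym by metis
    ultimately have "cov z v 0" using cov4[of z v 0] * unfolding cov_def by metis
    then show ?thesis using covc[of z v 0] * z M_pos by blast
  qed
  define f where "f z = (SOME v. v < Q \<and> chosen z v)" for z
  have f: "f z < Q \<and> chosen z (f z)" if "z < N" for z
    using someI_ex[OF ex[OF that]] unfolding f_def .
  have "rt (f z) = lf (f ((z + 1) mod N)) \<and> up (f z) = dn (f ((z + W) mod N))" if z: "z < N" for z
  proof
    let ?z = "(z + 1) mod N" and ?v = "f z"
    have z': "?z < N" using pos by simp
    have v: "lf ?v < K" "rt ?v < K" "lf (f ?z) < K" using col f[OF z] f[OF z'] by auto
    show "rt ?v = lf (f ?z)"
    proof (rule ccontr)
      assume ne: "rt ?v \<noteq> lf (f ?z)"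
      \<comment> \<open>If the colours differ, the colour \<open>rt ?v\<close> at the left border of
        \<open>?z\<close> is covered twice: by \<open>?v\<close> from the left, and by
        \<open>f ?z\<close>, which covers all colours there except its own.\<close>
      have "elm z ?v (2 + lf ?v) = elm ?z (f ?z) (2 + rt ?v)"
        using v ne by (simp add: elm_def sl_def)
      then have "z = ?z \<and> ?v = f ?z \<and> 2 + lf ?v = 2 + rt ?v"
        using f[OF z] f[OF z'] v by (intro uniq z z') (auto simp: M_def)
      then show False using ne by (metis add_left_imp_eq)
    qed
    let ?y = "(z + W) mod N"
    have y': "?y < N" using pos by simp
    have w: "dn ?v < K" "up ?v < K" "lf ?v < K" "lf (f ?y) < K" using col f[OF z] f[OF y'] by auto
    show "up ?v = dn (f ?y)"
    proof (rule ccontr)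
      assume ne: "up ?v \<noteq> dn (f ?y)"
      have "elm z ?v (K + 2 + dn ?v) = elm ?y (f ?y) (K + 2 + up ?v)"
        using w ne by (simp add: elm_def sl_def)
      then have "z = ?y \<and> ?v = f ?y \<and> K + 2 + dn ?v = K + 2 + up ?v"
        using f[OF z] f[OF y'] w by (intro uniq z y') (auto simp: M_def)
      then show False using ne by (metis add_left_imp_eq)
    qed
  qed
  then have "sol f" unfolding sol_def using f allowed by blast
  then show ?thesis by blast
qed

end

section \<open>From tilings to odd 2-factors\<close>

lemma oc_family_card:
  assumes "finite A" "\<And>c. c \<in> A \<Longrightarrow> distinct c \<and> 3 \<le> length c"
    "\<And>c d. c \<in> A \<Longrightarrow> d \<in> A \<Longrightarrow> c \<noteq> d \<Longrightarrow> set c \<inter> set d = {}"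
  shows "card (\<Union>c\<in>A. cedges c) = card (\<Union>c\<in>A. set c)"
proof -
  have "card (\<Union>c\<in>A. cedges c) = (\<Sum>c\<in>A. card (cedges c))"
  proof (rule card_UN_disjoint[OF assms(1)]; intro ballI impI)
    fix c d assume "c \<in> A" "d \<in> A" "c \<noteq> d"
    then have "set c \<inter> set d = {}" by (rule assms(3))
    moreover have "e \<noteq> {}" if "e \<in> cedges c" for e using that by (auto simp: cedges_def cedge_def)
    moreover have "e \<subseteq> set x" if "e \<in> cedges x" for e x using that Union_cedges[of x] by blast
    ultimately show "cedges c \<inter> cedges d = {}" by blast
  qed (rule finite_cedges)
  also have "\<dots> = (\<Sum>c\<in>A. card (set c))"
    using assms(2) by (intro sum.cong refl) (simp add: card_cedges distinct_card)
  also have "\<dots> = card (\<Union>c\<in>A. set c)"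
    by (rule card_UN_disjoint[symmetric, OF assms(1)]) (use assms(3) in auto)
  finally show ?thesis .
qed

lemma less_7: "(i::nat) < 7 \<longleftrightarrow> i = 0 \<or> i = 1 \<or> i = 2 \<or> i = 3 \<or> i = 4 \<or> i = 5 \<or> i = 6" by auto

context gadget begin

lemma shift_ex:
  assumes "z < N"
  shows "\<exists>y<N. (y + a) mod N = z"
proof -
  have "a mod N \<le> N" using pos by (simp add: less_imp_le)
  then have "(z + (N - a mod N) + a) mod N = (z + (N - a mod N + a mod N)) mod N"
    by (metis add.assoc mod_add_right_eq)
  also have "\<dots> = z" using \<open>a mod N \<le> N\<close> assms by simp
  finally show ?thesis using pos
    by (intro exI[of _ "(z + (N - a mod N)) mod N"]) (simp add: mod_add_left_eq)
qed

text \<open>Matching colours make \<open>\<phi>\<close> a permutation of the elements, so each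
  element is taken up by exactly one heptagon. The cycles in \<open>Fam\<close> are then disjoint
  and cover all vertices, and disjoint cycles have as many edges as vertices.\<close>

lemma sol_two_factor:
  assumes f: "sol f"
  shows "\<exists>F C. F \<subseteq> E \<and> oc F C \<and> card Vs \<le> card F"
proof -
  have fQ: "f z < Q" "A z (f z)" "rt (f z) = lf (f ((z + 1) mod N))" "up (f z) = dn (f ((z + W) mod N))" if "z < N" for z
    using f that unfolding sol_def by blast+
  define \<phi> where "\<phi> = (\<lambda>(z, h). ((z + fst (sl (f z) h)) mod N, snd (sl (f z) h)))"
  let ?X = "{..<N} \<times> {..<M}"
  have \<phi>_in: "\<phi> ` ?X \<subseteq> ?X"
    using fQ(1) sl_less pos by (auto simp: \<phi>_def)
  \<comment> \<open>The tile at \<open>z\<close> skips its own left colour, but the left neighbour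
    \<open>y\<close> covers it, having this colour on its right; likewise for the lower colour.
    Injectivity follows by finiteness.\<close>
  have \<phi>_sur: "?X \<subseteq> \<phi> ` ?X"
  proof
    fix p assume "p \<in> ?X"
    then obtain z j where p: "p = (z, j)" "z < N" "j < M" by auto
    have c: "lf (f z) < K" "dn (f z) < K" using col fQ(1)[OF p(2)] by auto
    show "p \<in> \<phi> ` ?X"
    proof (cases "j = 2 + lf (f z) \<or> j = K + 2 + dn (f z)")
      case False
      then have "\<phi> (z, j) = p" using p by (simp add: \<phi>_def sl_def)
      then show ?thesis using p by (metis SigmaI image_eqI lessThan_iff)
    next
      case True
      then show ?thesis
      proof
        assume j: "j = 2 + lf (f z)"
        obtain y where y: "y < N" "(y + 1) mod N = z" using shift_ex[OF p(2)] by blast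
        have "lf (f y) < K" using col fQ(1)[OF y(1)] by auto
        moreover have "\<phi> (y, 2 + lf (f y)) = p" using fQ(3)[OF y(1)] y j p by (simp add: \<phi>_def sl_def)
        ultimately show ?thesis using y by (intro image_eqI[of _ _ "(y, 2 + lf (f y))"]) (auto simp: M_def)
      next
        assume j: "j = K + 2 + dn (f z)"
        obtain y where y: "y < N" "(y + W) mod N = z" using shift_ex[OF p(2)] by blast
        have l: "lf (f y) < K" "dn (f y) < K" using col fQ(1)[OF y(1)] by auto
        moreover have "\<phi> (y, K + 2 + dn (f y)) = p" using l fQ(4)[OF y(1)] y j p by (simp add: \<phi>_def sl_def)
        ultimately show ?thesis using y by (intro image_eqI[of _ _ "(y, K + 2 + dn (f y))"]) (auto simp: M_def)
      qed
    qed
  qed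
  have \<phi>_inj: "inj_on \<phi> ?X"
    by (rule eq_card_imp_inj_on) (use \<phi>_in \<phi>_sur in \<open>auto intro: arg_cong[of _ _ card]\<close>)
  have elm_eq: "z = z' \<and> h = h'" if "z < N" "h < M" "z' < N" "h' < M" "elm z (f z) h = elm z' (f z') h'" for z h z' h'
    using inj_onD[OF \<phi>_inj, of "(z, h)" "(z', h')"] that by (simp add: \<phi>_def elm_def)
  have elm_sur: "\<exists>z' h. z' < N \<and> h < M \<and> elm z' (f z') h = (z, El j)" if "z < N" "j < M" for z j
  proof -
    have "(z, j) \<in> \<phi> ` ?X" using \<phi>_sur that by blast
    then show ?thesis by (auto simp: \<phi>_def elm_def)
  qed
  \<comment> \<open>The wire is traversed backwards, from the vertex joined to \<open>Pn 4\<close>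
    to the one joined to \<open>Pn 0\<close>.\<close>
  define big where "big z v = map (Pair z) ([Pn 0 v, Pn 1 v, Pn 2 v, Pn 3 v, Pn 4 v]
     @ (if v = f z then map (Wv v) (rev [0..<M]) else []))" for z v
  define hc where "hc z v h = (if v = f z
     then [(z, Hx 0 v h), (z, Hx 1 v h), (z, Hx 2 v h), (z, Hx 3 v h), elm z v h, (z, Hx 4 v h), (z, Hx 5 v h)]
     else [(z, Hx 0 v h), (z, Wv v h), (z, Hx 1 v h), (z, Hx 2 v h), (z, Hx 3 v h), (z, Hx 4 v h), (z, Hx 5 v h)])" for z v h
  define Fam where "Fam = (\<lambda>(z, v). big z v) ` ({..<N} \<times> {..<Q}) \<union> (\<lambda>(z, v, h). hc z v h) ` ({..<N} \<times> {..<Q} \<times> {..<M})"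
  have finF: "finite Fam" by (auto simp: Fam_def)
  have sb: "set (big z v) = {(z, Pn 0 v), (z, Pn 1 v), (z, Pn 2 v), (z, Pn 3 v), (z, Pn 4 v)} \<union>
     (if v = f z then (\<lambda>h. (z, Wv v h)) ` {..<M} else {})" for z v
    by (auto simp: big_def)
  have sh: "set (hc z v h) = {(z, Hx 0 v h), (z, Hx 1 v h), (z, Hx 2 v h), (z, Hx 3 v h), (z, Hx 4 v h), (z, Hx 5 v h)} \<union>
     (if v = f z then {elm z v h} else {(z, Wv v h)})" for z v h
    by (auto simp: hc_def)
  have good: "distinct c \<and> 3 \<le> length c \<and> odd (length c)" if "c \<in> Fam" for c
  proof -
    have "distinct (big z v) \<and> 3 \<le> length (big z v) \<and> odd (length (big z v))" for z v
      by (auto simp: big_def distinct_map inj_on_def M_def)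
    moreover have "distinct (hc z v h) \<and> 3 \<le> length (hc z v h) \<and> odd (length (hc z v h))" for z v h
      by (auto simp: hc_def elm_def)
    ultimately show ?thesis using that unfolding Fam_def by auto
  qed
  have disj: "set c \<inter> set d = {}" if "c \<in> Fam" "d \<in> Fam" "c \<noteq> d" for c d
  proof -
    have bb: "set (big z v) \<inter> set (big z' v') = {}" if "(z, v) \<noteq> (z', v')" for z v z' v'
      using that unfolding sb by auto
    have bh: "set (big z v) \<inter> set (hc z' v' h) = {}" for z v z' v' h
      unfolding sb sh by (auto simp: elm_def)
    have hh: "set (hc z v h) \<inter> set (hc z' v' h') = {}"
      if "(z, v, h) \<noteq> (z', v', h')" "z < N" "h < M" "z' < N" "h' < M" for z v h z' v' h'
    proof -
      have "\<not> (v = f z \<and> v' = f z' \<and> elm z v h = elm z' v' h')" using elm_eq[of z h z' h'] that by auto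
      then show ?thesis using that(1) unfolding sh by (auto simp: elm_def)
    qed
    have "c \<in> (\<lambda>(z, v). big z v) ` ({..<N} \<times> {..<Q}) \<or> c \<in> (\<lambda>(z, v, h). hc z v h) ` ({..<N} \<times> {..<Q} \<times> {..<M})"
      "d \<in> (\<lambda>(z, v). big z v) ` ({..<N} \<times> {..<Q}) \<or> d \<in> (\<lambda>(z, v, h). hc z v h) ` ({..<N} \<times> {..<Q} \<times> {..<M})"
      using that(1,2) unfolding Fam_def by blast+
    then show ?thesis
    proof (elim disjE imageE; clarsimp)
      fix z v z' v' assume "c = big z v" "d = big z' v'"
      then show "set (big z v) \<inter> set (big z' v') = {}" using bb[of z v z' v'] \<open>c \<noteq> d\<close> by auto
    next
      fix z v z' v' h' show "set (big z v) \<inter> set (hc z' v' h') = {}" by (rule bh)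
    next
      fix z v h z' v' show "set (hc z v h) \<inter> set (big z' v') = {}" using bh[of z' v' z v h] by blast
    next
      fix z v h z' v' h' assume "c = hc z v h" "d = hc z' v' h'" "z < N" "h < M" "z' < N" "h' < M"
      then show "set (hc z v h) \<inter> set (hc z' v' h') = {}" using hh[of z v h z' v' h'] \<open>c \<noteq> d\<close> by auto
    qed
  qed
  have edge: "cedges c \<subseteq> E" if "c \<in> Fam" for c
  proof -
    have pn: "big z v ! i = (z, Pn i v)" if "i < 5" for i z v
      using that unfolding less_5 by (elim disjE) (simp_all add: big_def)
    have b: "cedge (big z v) i \<in> E" if z: "z < N" and v: "v < Q" and i: "i < length (big z v)" for z v i
    proof (cases "v = f z")
      case False
      then have len: "length (big z v) = 5" by (simp add: big_def)
      then have i5: "i < 5" using i by simp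
      then have "cedge (big z v) i = {end1 z (EP i v), end2 z (EP i v)}"
        using pn[of i z v] pn[of "Suc i mod 5" z v] by (simp add: cedge_def len Suc_mod)
      then show ?thesis using E_I[OF z, of "EP i v"] v i5 by simp
    next
      case True
      have nth: "big z v ! i = (if i < 5 then (z, Pn i v) else (z, Wv v (M - Suc (i - 5))))" if "i < 5 + M" for i
      proof (cases "i < 5")
        case True
        then show ?thesis using pn by simp
      next
        case False
        then show ?thesis using that \<open>v = f z\<close> by (auto simp: big_def nth_append rev_nth nth_Cons' )
      qed
      have len: "length (big z v) = 5 + M" using True by (simp add: big_def)
      then have i: "i < 5 + M" using i by simp
      consider "i < 4" | "i = 4" | "4 < i" "i < 4 + M" | "i = 4 + M" using i by linarith
      then show ?thesis
      proof cases
        case 1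
        then have "cedge (big z v) i = {end1 z (EP i v), end2 z (EP i v)}" by (simp add: cedge_def len nth)
        then show ?thesis using E_I[OF z, of "EP i v"] v 1 by simp
      next
        case 2
        then have "cedge (big z v) i = {end1 z (ET v), end2 z (ET v)}"
          using M_pos by (simp add: cedge_def len nth)
        then show ?thesis using E_I[OF z, of "ET v"] v by simp
      next
        case 3
        define h where "h = M - Suc (Suc i - 5)"
        have h: "M - Suc (i - 5) = Suc h" "Suc h < M" using 3 by (auto simp: h_def)
        have "big z v ! i = (z, Wv v (Suc h))" using nth[of i] 3 h(1) by simp
        moreover have "big z v ! (Suc i mod length (big z v)) = (z, Wv v h)"
          unfolding len h_def using nth[of "Suc i"] 3 by simp
        ultimately have "cedge (big z v) i = {end1 z (EW v h), end2 z (EW v h)}"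
          by (simp add: cedge_def insert_commute)
        then show ?thesis using E_I[OF z, of "EW v h"] v h by simp
      next
        case 4
        have "big z v ! i = (z, Wv v 0)" using nth[of i] 4 M_pos by simp
        moreover have "big z v ! (Suc i mod length (big z v)) = (z, Pn 0 v)"
          unfolding len using nth[of 0] 4 by simp
        moreover have "A z v" using fQ(2)[OF z] True by simp
        ultimately have "cedge (big z v) i = {end1 z (ES v), end2 z (ES v)}"
          by (simp add: cedge_def insert_commute)
        then show ?thesis using E_I[OF z, of "ES v"] v by simp
      qed
    qed
    have h: "cedge (hc z v h) i \<in> E" if z: "z < N" and v: "v < Q" and h: "h < M" and i: "i < length (hc z v h)" for z v h i
    proof -
      have "i < 7" using i by (auto simp: hc_def split: if_splits)
      moreover have "{(z, Hx 0 v h), (z, Hx 1 v h)} \<in> E" using E_I[OF z, of "EH 0 v h"] v h by simp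
      moreover have "{(z, Hx 1 v h), (z, Hx 2 v h)} \<in> E" using E_I[OF z, of "EH 1 v h"] v h by (simp add: numeral_2_eq_2)
      moreover have "{(z, Hx 2 v h), (z, Hx 3 v h)} \<in> E" using E_I[OF z, of "EH 2 v h"] v h by simp
      moreover have "{(z, Hx 3 v h), (z, Hx 4 v h)} \<in> E" using E_I[OF z, of "EH 3 v h"] v h by simp
      moreover have "{(z, Hx 4 v h), (z, Hx 5 v h)} \<in> E" using E_I[OF z, of "EH 4 v h"] v h by simp
      moreover have "{(z, Hx 5 v h), (z, Hx 0 v h)} \<in> E" using E_I[OF z, of "EH 5 v h"] v h by simp
      moreover have "{(z, Hx 0 v h), (z, Wv v h)} \<in> E" using E_I[OF z, of "EL 0 v h"] v h by simp
      moreover have "{(z, Hx 1 v h), (z, Wv v h)} \<in> E" using E_I[OF z, of "EL 1 v h"] v h by simp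
      moreover have "{(z, Hx 3 v h), elm z v h} \<in> E" using E_I[OF z, of "EL 2 v h"] v h by simp
      moreover have "{(z, Hx 4 v h), elm z v h} \<in> E" using E_I[OF z, of "EL 3 v h"] v h by simp
      ultimately show ?thesis unfolding less_7
        by (auto simp: hc_def cedge_def insert_commute)
    qed
    show ?thesis using that b h unfolding Fam_def cedges_def by auto
  qed
  have cover: "Vs \<subseteq> (\<Union>c\<in>Fam. set c)"
  proof
    fix x assume "x \<in> Vs"
    then obtain z \<alpha> where x: "x = (z, \<alpha>)" "z < N" "okV \<alpha>" by (auto simp: Vs_def)
    have bF: "big z v \<in> Fam" if "v < Q" for v using that x(2) by (auto simp: Fam_def)
    have hF: "hc z v h \<in> Fam" if "z < N" "v < Q" "h < M" for z v h using that by (force simp: Fam_def)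
    show "x \<in> (\<Union>c\<in>Fam. set c)"
    proof (cases \<alpha>)
      case (El j)
      then have "j < M" using x(3) by simp
      then obtain z' h where "z' < N" "h < M" "elm z' (f z') h = (z, El j)" using elm_sur[OF x(2)] by blast
      then show ?thesis using hF[of z' "f z'" h] fQ(1)[of z'] x El by (intro UN_I[of "hc z' (f z') h"]) (auto simp: sh)
    next
      case (Pn i v)
      then show ?thesis using bF[of v] x(1,3) by (intro UN_I[of "big z v"]) (auto simp: sb less_5)
    next
      case (Wv v h)
      show ?thesis
      proof (cases "v = f z")
        case True
        then show ?thesis using bF[of v] x(1,3) Wv by (intro UN_I[of "big z v"]) (auto simp: sb)
      next
        case False
        then show ?thesis using hF[of z v h] x Wv by (intro UN_I[of "hc z v h"]) (auto simp: sh)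
      qed
    next
      case (Hx i v h)
      then show ?thesis using hF[of z v h] x by (intro UN_I[of "hc z v h"]) (auto simp: sh less_6)
    qed
  qed
  let ?F = "\<Union>c\<in>Fam. cedges c"
  have "?F \<subseteq> E" using edge by blast
  moreover have "oc ?F (\<Union>c\<in>Fam. set c)" by (rule oc_family[OF finF good disj])
  moreover have "card Vs \<le> card ?F"
    using oc_family_card[OF finF _ disj] good card_mono[OF _ cover] finF by auto
  ultimately show ?thesis by blast
qed

end

section \<open>Encoded instances\<close>

definition bit :: "bool list \<Rightarrow> nat \<Rightarrow> bool" where
  "bit x i \<longleftrightarrow> word_cells x (int i) = 2"

lemma bit_iff: "bit x i \<longleftrightarrow> i < length x \<and> x ! i"
  by (auto simp: bit_def word_cells_def)

fun val :: "bool list \<Rightarrow> nat" where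
  "val [] = 0"
| "val (b # bs) = of_bool b + 2 * val bs"

lemma val_binary: "val (binary k) = k"
  by (induction k rule: binary.induct) (subst binary.simps, auto simp: odd_two_times_div_two_succ)

lemma val_pos: "bs \<noteq> [] \<Longrightarrow> last bs \<Longrightarrow> 0 < val bs"
  by (induction bs) (auto split: if_splits)

lemma binary_val: "bs = [] \<or> last bs \<Longrightarrow> binary (val bs) = bs"
proof (induction bs)
  case (Cons b bs)
  have "0 < val (b # bs)" using val_pos[of "b # bs"] Cons.prems by auto
  moreover have "binary (val bs) = bs" using Cons by (cases "bs = []") auto
  ultimately show ?case by (subst binary.simps) auto
qed (simp add: binary.simps)

lemma binary_last: "binary k = [] \<or> last (binary k)"
proof (induction k rule: binary.induct)
  case (1 k)
  show ?case
  proof (cases "k = 0")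
    case False
    have "binary k = odd k # binary (k div 2)" using False by (subst binary.simps) simp
    moreover have "binary (k div 2) = [] \<Longrightarrow> k = 1"
      using val_binary[of "k div 2"] False by (auto simp: div_eq_0_iff)
    ultimately show ?thesis using 1 False by auto
  qed (simp add: binary.simps)
qed

text \<open>The length of the initial run of \<open>True\<close>, written as a bounded sum to be
  visibly computable.\<close>

definition nn :: "bool list \<Rightarrow> nat" where
  "nn x = (\<Sum>i<length x. of_bool (\<forall>j<Suc i. bit x j))"

definition adjx :: "bool list \<Rightarrow> nat \<Rightarrow> nat \<Rightarrow> bool" where
  "adjx x i j \<longleftrightarrow> bit x (nn x + 1 + i * nn x + j)"

definition hdr :: "bool list \<Rightarrow> nat" where
  "hdr x = nn x + 1 + nn x * nn x"

text \<open>The most significant bit of the budget comes last; demanding that it is set excludes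
  redundant zeros, so that the valid words are exactly the encodings of instances.\<close>

definition valid :: "bool list \<Rightarrow> bool" where
  "valid x \<longleftrightarrow> hdr x \<le> length x \<and> (\<forall>i<nn x. \<not> adjx x i i) \<and> (\<forall>i<nn x. \<forall>j<nn x. adjx x i j = adjx x j i) \<and>
     (length x = hdr x \<or> bit x (length x - 1))"

definition kk :: "bool list \<Rightarrow> nat" where
  "kk x = val (drop (hdr x) x)"

definition graph :: "bool list \<Rightarrow> nat ugraph" where
  "graph x = \<lparr>verts = {..<nn x}, edges = {{i, j} | i j. i < nn x \<and> j < nn x \<and> adjx x i j}\<rparr>"

lemma nn_prefix: "nn (replicate n True @ False # y) = n"
proof -
  let ?x = "replicate n True @ False # y"
  have "(\<forall>j<Suc i. bit ?x j) \<longleftrightarrow> i < n" if "i < length ?x" for i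
  proof
    assume "\<forall>j<Suc i. bit ?x j"
    moreover have "\<not> bit ?x n" by (simp add: bit_iff nth_append)
    ultimately show "i < n" by (metis less_Suc_eq linorder_neqE_nat)
  qed (auto simp: bit_iff nth_append)
  then have "nn ?x = (\<Sum>i<length ?x. of_bool (i < n))" unfolding nn_def by (intro sum.cong) auto
  also have "\<dots> = card {i. i < n \<and> i < length ?x}" by (simp only: sum_of_bool_eq finite_lessThan) (simp add: Int_def conj_commute)
  also have "{i. i < n \<and> i < length ?x} = {..<n}" by auto
  finally show ?thesis by simp
qed

lemma nn_split:
  assumes "nn x < length x"
  shows "\<exists>y. x = replicate (nn x) True @ False # y"
proof -
  let ?a = "length (takeWhile (\<lambda>b. b) x)"
  have t: "takeWhile (\<lambda>b. b) x = replicate ?a True"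
    by (rule nth_equalityI) (auto dest!: nth_mem set_takeWhileD)
  have x: "x = replicate ?a True @ dropWhile (\<lambda>b. b) x" by (metis t takeWhile_dropWhile_id)
  show ?thesis
  proof (cases "dropWhile (\<lambda>b. b) x")
    case Nil
    then have "takeWhile (\<lambda>b. b) x = x" using takeWhile_dropWhile_id[of "\<lambda>b. b" x] by simp
    then obtain a where a: "x = replicate a True" using t by metis
    have "nn x = (\<Sum>i<a. 1)" unfolding nn_def a by (rule sum.cong) (auto simp: bit_iff)
    then show ?thesis using assms a by simp
  next
    case (Cons b y)
    then have "\<not> b" using hd_dropWhile[of "\<lambda>b. b" x] by auto
    then have "x = replicate ?a True @ False # y" using x Cons by simp
    then show ?thesis using nn_prefix by metis
  qed
qed

lemma concat_matrix:
  "concat (map (\<lambda>i. map (f i) [0..<n]) [0..<m]) = map (\<lambda>p. f (p div n) (p mod n)) [0..<m * n]"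
proof (induction m)
  case (Suc m)
  have "[0..<m * n + n] = [0..<m * n] @ [m * n..<m * n + n]" by (rule upt_add_eq_append) simp
  moreover have "[m * n..<m * n + n] = map (\<lambda>i. i + m * n) [0..<n]" by (simp add: map_add_upt add.commute)
  ultimately have "[0..<Suc m * n] = [0..<m * n] @ map (\<lambda>i. i + m * n) [0..<n]" by (simp add: add.commute)
  moreover have "map (\<lambda>p. f (p div n) (p mod n)) (map (\<lambda>i. i + m * n) [0..<n]) = map (f m) [0..<n]"
    by (cases "n = 0") auto
  ultimately show ?case using Suc by simp
qed simp

lemma encode_parse:
  assumes G: "simple_graph G" "verts G = {..<card (verts G)}" and x: "x = encode_instance G k"
  shows "valid x \<and> graph x = G \<and> kk x = k"
proof -
  define n where "n = card (verts G)"
  define f where "f i j \<longleftrightarrow> {i, j} \<in> edges G" for i j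
  have e: "e \<subseteq> {..<n}" "card e = 2" if "e \<in> edges G" for e
    using G that by (auto simp: simple_graph_def n_def)
  define y where "y = map (\<lambda>p. f (p div n) (p mod n)) [0..<n * n] @ binary k"
  have x: "x = replicate n True @ False # y"
    unfolding x encode_instance_def Let_def by (simp add: concat_matrix n_def f_def[abs_def] y_def)
  have lenx: "length x = Suc (n + length y)" unfolding x by simp
  have ly: "length y = n * n + length (binary k)" by (simp add: y_def)
  have xp: "x ! Suc (n + p) = y ! p" for p unfolding x by (simp add: nth_append)
  have yp: "y ! p = f (p div n) (p mod n)" if "p < n * n" for p using that by (simp add: y_def nth_append)
  have nn: "nn x = n" unfolding x by (rule nn_prefix)
  have hd: "hdr x = Suc (n + n * n)" by (simp add: hdr_def nn)
  have lt: "i * n + j < n * n" if "i < n" "j < n" for i j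
    using that mult_le_mono1[of "Suc i" n n] by simp
  have adj: "adjx x i j \<longleftrightarrow> f i j" if "i < n" "j < n" for i j
    using lt[OF that] that xp[of "i * n + j"] yp[OF lt[OF that]] lenx ly by (simp add: adjx_def nn bit_iff add.assoc)
  have dr: "drop (hdr x) x = binary k"
  proof -
    have "drop (Suc (n + n * n)) x = drop (n * n) y" unfolding x by simp
    then show ?thesis unfolding hd by (simp add: y_def)
  qed
  have sl: "\<not> f i i" for i using e[of "{i, i}"] by (auto simp: f_def)
  have "valid x"
    unfolding valid_def nn
  proof (intro conjI allI impI)
    show "hdr x \<le> length x" using hd lenx ly by simp
    show "\<not> adjx x i i" if "i < n" for i using adj that sl by simp
    show "adjx x i j = adjx x j i" if "i < n" "j < n" for i j
      using adj that by (simp add: f_def insert_commute)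
    show "length x = hdr x \<or> bit x (length x - 1)"
    proof (cases "binary k = []")
      case True
      then show ?thesis using hd lenx ly by simp
    next
      case False
      then have "y \<noteq> []" "last y" using binary_last[of k] by (simp_all add: y_def)
      then have "x \<noteq> []" "last x" unfolding x by simp_all
      then show ?thesis by (simp add: bit_iff last_conv_nth)
    qed
  qed
  moreover have "graph x = G"
  proof -
    have "edges G = {{i, j} | i j. i < n \<and> j < n \<and> f i j}"
    proof (intro set_eqI iffI)
      fix d assume d: "d \<in> edges G"
      then obtain i j where "d = {i, j}" using e(2)[OF d] by (auto simp: card_2_iff)
      then show "d \<in> {{i, j} | i j. i < n \<and> j < n \<and> f i j}" using e[OF d] d by (auto simp: f_def)
    qed (auto simp: f_def)
    moreover have "{{i, j} | i j. i < n \<and> j < n \<and> adjx x i j} = {{i, j} | i j. i < n \<and> j < n \<and> f i j}"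
      using adj by blast
    ultimately show ?thesis using G(2) by (cases G) (simp add: graph_def nn n_def)
  qed
  moreover have "kk x = k" by (simp add: kk_def dr val_binary)
  ultimately show ?thesis by blast
qed

lemma graph_simple:
  assumes "valid x"
  shows "simple_graph (graph x)" "verts (graph x) = {..<card (verts (graph x))}"
  using assms by (auto simp: simple_graph_def graph_def valid_def card_insert_if)

lemma graph_edge:
  assumes "valid x" "i < nn x" "j < nn x"
  shows "{i, j} \<in> edges (graph x) \<longleftrightarrow> adjx x i j"
  using assms by (auto simp: graph_def valid_def doubleton_eq_iff)

lemma parse_encode:
  assumes v: "valid x"
  shows "encode_instance (graph x) (kk x) = x"
proof -
  let ?n = "nn x"
  have h: "hdr x \<le> length x" using v by (simp add: valid_def)
  then have "nn x < length x" by (simp add: hdr_def)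
  then obtain y where y: "x = replicate ?n True @ False # y" using nn_split by blast
  have lenx: "length x = Suc (nn x + length y)" by (subst y) simp
  have yp: "x ! Suc (nn x + p) = y ! p" for p
    using arg_cong[OF y, of "\<lambda>l. l ! Suc (nn x + p)"] by (simp add: nth_append)
  have ly: "?n * ?n \<le> length y" using h lenx by (simp add: hdr_def)
  have dr: "drop (hdr x) x = drop (?n * ?n) y" by (subst (2) y) (simp add: hdr_def drop_Cons')
  have "drop (hdr x) x = [] \<or> last (drop (hdr x) x)"
  proof (cases "length x = hdr x")
    case False
    then have "bit x (length x - 1)" "hdr x < length x" using v h by (auto simp: valid_def)
    then show ?thesis by (auto simp: bit_iff last_conv_nth)
  qed simp
  then have b: "binary (kk x) = drop (?n * ?n) y" unfolding kk_def using binary_val dr by metis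
  have "map (\<lambda>p. {p div ?n, p mod ?n} \<in> edges (graph x)) [0..<?n * ?n] = take (?n * ?n) y"
  proof (rule nth_equalityI)
    fix p assume "p < length (map (\<lambda>p. {p div ?n, p mod ?n} \<in> edges (graph x)) [0..<?n * ?n])"
    then have p: "p < ?n * ?n" by simp
    then have n0: "0 < ?n" by (cases "?n = 0") auto
    have l: "p div ?n < ?n" "p mod ?n < ?n" using p n0 by (auto simp: less_mult_imp_div_less)
    have "adjx x (p div ?n) (p mod ?n) \<longleftrightarrow> bit x (?n + 1 + p)" by (simp add: adjx_def add.assoc)
    also have "\<dots> \<longleftrightarrow> y ! p" using p ly lenx yp by (simp add: bit_iff)
    finally show "map (\<lambda>p. {p div ?n, p mod ?n} \<in> edges (graph x)) [0..<?n * ?n] ! p = take (?n * ?n) y ! p"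
      using graph_edge[OF v l] p by simp
  qed (use ly in simp)
  moreover have "card (verts (graph x)) = ?n" by (simp add: graph_def)
  ultimately have "encode_instance (graph x) (kk x) = replicate ?n True @ False # take (?n * ?n) y @ drop (?n * ?n) y"
    unfolding encode_instance_def Let_def concat_matrix b by simp
  then show ?thesis using y by simp
qed

text \<open>Parsing inverts encoding in both directions, so graph and budget can be read off the
  word instead of being quantified.\<close>

lemma ect_on_iff:
  "x \<in> even_cycle_transversal_on P \<longleftrightarrow>
     valid x \<and> P (graph x) \<and> (\<exists>S. even_cycle_transversal (graph x) S \<and> card S \<le> kk x)"
proof
  assume "x \<in> even_cycle_transversal_on P"
  then obtain G k where "x = encode_instance G k" "simple_graph G" "verts G = {..<card (verts G)}" "P G"
    "\<exists>S. even_cycle_transversal G S \<and> card S \<le> k" unfolding even_cycle_transversal_on_def by blast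
  then show "valid x \<and> P (graph x) \<and> (\<exists>S. even_cycle_transversal (graph x) S \<and> card S \<le> kk x)"
    using encode_parse by metis
next
  assume a: "valid x \<and> P (graph x) \<and> (\<exists>S. even_cycle_transversal (graph x) S \<and> card S \<le> kk x)"
  then have "x = encode_instance (graph x) (kk x)" using parse_encode by simp
  then show "x \<in> even_cycle_transversal_on P"
    unfolding even_cycle_transversal_on_def using a graph_simple by blast
qed

text \<open>Deleting vertices of the line graph amounts to deleting edges of the root graph.\<close>

lemma ect_noeven:
  assumes inj: "inj_on ed {..<n}" and G: "verts G = {..<n}"
    and E: "\<And>i j. i < n \<Longrightarrow> j < n \<Longrightarrow> {i, j} \<in> edges G \<longleftrightarrow> i \<noteq> j \<and> ed i \<inter> ed j \<noteq> {}"
    and S: "S \<subseteq> {..<n}"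
  shows "even_cycle_transversal G S \<longleftrightarrow> noeven (ed ` ({..<n} - S))"
proof -
  have cyc: "is_cycle G c \<longleftrightarrow> lcyc (ed ` {..<n}) (map ed c)" if c: "set c \<subseteq> {..<n}" for c
  proof -
    have in_c: "c ! i < n" if "i < length c" for i using c nth_mem[OF that] by blast
    have d: "distinct (map ed c) \<longleftrightarrow> distinct c"
      using inj_on_subset[OF inj c] by (simp add: distinct_map)
    have m: "Suc i mod length c < length c" if "i < length c" for i using that by (intro mod_less_divisor) linarith
    have "{c ! i, c ! (Suc i mod length c)} \<in> edges G \<longleftrightarrow> ed (c ! i) \<inter> ed (c ! (Suc i mod length c)) \<noteq> {}"
      if "i < length c" "distinct c" "3 \<le> length c" for i
    proof -
      have "i \<noteq> Suc i mod length c" using that by (auto simp: Suc_mod)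
      then have "c ! i \<noteq> c ! (Suc i mod length c)" using that m[OF that(1)] by (simp add: nth_eq_iff_index_eq)
      then show ?thesis using E[OF in_c in_c] that(1) m[OF that(1)] by simp
    qed
    then show ?thesis unfolding is_cycle_def lcyc_def d using c G m by auto
  qed
  have lsub: "lcyc (ed ` ({..<n} - S)) (map ed c) \<longleftrightarrow> lcyc (ed ` {..<n}) (map ed c) \<and> set c \<inter> S = {}"
    if c: "set c \<subseteq> {..<n}" for c
  proof -
    have "ed ` set c \<subseteq> ed ` ({..<n} - S) \<longleftrightarrow> set c \<subseteq> {..<n} - S"
    proof
      assume a: "ed ` set c \<subseteq> ed ` ({..<n} - S)"
      show "set c \<subseteq> {..<n} - S"
      proof
        fix i assume i: "i \<in> set c"
        then obtain j where "j \<in> {..<n} - S" "ed i = ed j" using a by blast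
        then show "i \<in> {..<n} - S" using inj_onD[OF inj, of i j] i c by auto
      qed
    qed blast
    then show ?thesis using c unfolding lcyc_def by auto
  qed
  show ?thesis
  proof
    assume e: "even_cycle_transversal G S"
    show "noeven (ed ` ({..<n} - S))" unfolding noeven_def
    proof (intro allI impI)
      fix l assume l: "lcyc (ed ` ({..<n} - S)) l"
      define c where "c = map (inv_into {..<n} ed) l"
      have lm: "set l \<subseteq> ed ` {..<n}" using l by (auto simp: lcyc_def)
      then have lc: "map ed c = l" unfolding c_def by (auto simp: f_inv_into_f intro!: map_idI)
      have c: "set c \<subseteq> {..<n}"
      proof
        fix i assume "i \<in> set c"
        then obtain e where e: "e \<in> set l" "i = inv_into {..<n} ed e" by (auto simp: c_def)
        then have "e \<in> ed ` {..<n}" using lm by blast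
        then show "i \<in> {..<n}" unfolding e(2) by (rule inv_into_into)
      qed
      then have "is_cycle G c" "set c \<inter> S = {}" using l lsub[OF c] cyc[OF c] lc by auto
      then have "odd (length c)" using e unfolding even_cycle_transversal_def by blast
      then show "odd (length l)" using lc by (metis length_map)
    qed
  next
    assume ne: "noeven (ed ` ({..<n} - S))"
    show "even_cycle_transversal G S" unfolding even_cycle_transversal_def
    proof (intro conjI allI impI)
      show "S \<subseteq> verts G" using S G by simp
      fix c assume c: "is_cycle G c \<and> even (length c)"
      then have cn: "set c \<subseteq> {..<n}" using G by (simp add: is_cycle_def)
      show "S \<inter> set c \<noteq> {}"
      proof
        assume "S \<inter> set c = {}"
        then have "lcyc (ed ` ({..<n} - S)) (map ed c)" using lsub[OF cn] cyc[OF cn] c by blast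
        then have "odd (length (map ed c))" using ne unfolding noeven_def by blast
        then show False using c by simp
      qed
    qed
  qed
qed

lemma line_graphI:
  fixes ed :: "nat \<Rightarrow> nat set"
  assumes inj: "inj_on ed {..<n}" and G: "verts G = {..<n}"
    and E: "\<And>i j. i < n \<Longrightarrow> j < n \<Longrightarrow> {i, j} \<in> edges G \<longleftrightarrow> i \<noteq> j \<and> ed i \<inter> ed j \<noteq> {}"
    and c: "\<And>i. i < n \<Longrightarrow> card (ed i) = 2"
  shows "is_line_graph G"
proof -
  define H where "H = \<lparr>verts = (\<Union>e\<in>{..<n}. ed e), edges = ed ` {..<n}\<rparr>"
  have "finite (ed i)" if "i < n" for i using c[OF that] by (intro card_ge_0_finite) simp
  then have "simple_graph H" using c by (auto simp: simple_graph_def H_def)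
  moreover have "graph_iso G (line_graph H)"
    unfolding graph_iso_def
  proof (intro exI[of _ ed] conjI ballI)
    show "bij_betw ed (verts G) (verts (line_graph H))"
      using inj by (simp add: bij_betw_def G line_graph_def H_def)
    fix e f assume "e \<in> verts G" "f \<in> verts G"
    then have ef: "e < n" "f < n" by (auto simp: G)
    have "{ed e, ed f} \<in> edges (line_graph H) \<longleftrightarrow> ed e \<noteq> ed f \<and> ed e \<inter> ed f \<noteq> {}"
      using ef by (auto simp: line_graph_def H_def doubleton_eq_iff)
    also have "\<dots> \<longleftrightarrow> e \<noteq> f \<and> ed e \<inter> ed f \<noteq> {}" using inj_onD[OF inj, of e f] ef by auto
    finally show "{e, f} \<in> edges G \<longleftrightarrow> {ed e, ed f} \<in> edges (line_graph H)" using E[OF ef] by blast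
  qed
  ultimately show ?thesis unfolding is_line_graph_def by blast
qed

section \<open>Membership in NP\<close>

text \<open>A certificate is a table of functions: 0, 1 endpoints in the root graph, 2 the transversal,
  3--6 the labels of \<^term>\<open>cert\<close>, 7 lower bounds for the binary prefixes of the budget.\<close>

definition meets :: "(nat \<Rightarrow> nat \<Rightarrow> nat) \<Rightarrow> nat \<Rightarrow> nat \<Rightarrow> bool" where
  "meets F e f \<longleftrightarrow> F 0 e = F 0 f \<or> F 0 e = F 1 f \<or> F 1 e = F 0 f \<or> F 1 e = F 1 f"

definition root_ok :: "bool list \<Rightarrow> (nat \<Rightarrow> nat \<Rightarrow> nat) \<Rightarrow> bool" where
  "root_ok x F \<longleftrightarrow> (\<forall>e<nn x. F 0 e \<noteq> F 1 e) \<and>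
     (\<forall>e<nn x. \<forall>f<nn x. e \<noteq> f \<longrightarrow> \<not> (F 0 e = F 0 f \<and> F 1 e = F 1 f \<or> F 0 e = F 1 f \<and> F 1 e = F 0 f)) \<and>
     (\<forall>e<nn x. \<forall>f<nn x. adjx x e f = (e \<noteq> f \<and> meets F e f))"

text \<open>The budget may be exponential in the length of the word, while table entries are unary.
  Entry \<open>i\<close> therefore only bounds the number formed by the bits from \<open>i\<close>
  on from below, and one doubling step per bit certifies entry 0.\<close>

definition budget_ok :: "bool list \<Rightarrow> (nat \<Rightarrow> nat \<Rightarrow> nat) \<Rightarrow> bool" where
  "budget_ok x F \<longleftrightarrow> (\<Sum>e<nn x. of_bool (F 2 e \<noteq> 0)) \<le> F 7 0 \<and> F 7 (length x - hdr x) = 0 \<and>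
     (\<forall>i<length x - hdr x. F 7 i \<le> 2 * F 7 (Suc i) + of_bool (bit x (hdr x + i)))"

definition label_ok :: "bool list \<Rightarrow> (nat \<Rightarrow> nat \<Rightarrow> nat) \<Rightarrow> bool" where
  "label_ok x F \<longleftrightarrow> cert {e. e < nn x \<and> F 2 e = 0} (adjx x) (\<lambda>e. F 3 e \<noteq> 0) (F 4) (F 5) (F 6)"

text \<open>Large enough to number the at most \<open>2 * n\<close> ends of \<open>n\<close> root
  edges; all other entries are at most \<open>n\<close>.\<close>

definition size_bound :: "bool list \<Rightarrow> nat" where
  "size_bound x = 2 * length x + 1"

lemma budget_le:
  assumes "\<And>i. i < length bs \<Longrightarrow> h i \<le> 2 * h (Suc i) + of_bool (bs ! i)" "h (length bs) = (0::nat)"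
  shows "h 0 \<le> val bs"
  using assms
proof (induction bs arbitrary: h)
  case (Cons b bs)
  have "h 1 \<le> val bs" using Cons.IH[of "\<lambda>i. h (Suc i)"] Cons.prems(1)[of "Suc i" for i] Cons.prems(2) by simp
  then show ?case using Cons.prems(1)[of 0] by simp
qed simp

text \<open>If the number \<open>k\<close> is bounded by the value of the bits, then
  \<open>k\<close> minus the lowest bit, halved and rounded up, is bounded by the value of the
  remaining ones. Descending from \<open>k\<close> rather than from the full value keeps every entry
  at most \<open>k\<close>.\<close>

lemma budget_ge: "k \<le> val bs \<Longrightarrow> \<exists>h. h 0 = k \<and> h (length bs) = 0 \<and> (\<forall>i. h i \<le> k) \<and>
   (\<forall>i<length bs. h i \<le> 2 * h (Suc i) + of_bool (bs ! i))"
proof (induction bs arbitrary: k)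
  case Nil
  then show ?case by (intro exI[of _ "\<lambda>_. 0"]) simp
next
  case (Cons b bs)
  have "(k + 1 - of_bool b) div 2 \<le> val bs" using Cons.prems by (cases b) auto
  then obtain h where h: "h 0 = (k + 1 - of_bool b) div 2" "h (length bs) = 0" "\<forall>i. h i \<le> (k + 1 - of_bool b) div 2"
     "\<forall>i<length bs. h i \<le> 2 * h (Suc i) + of_bool (bs ! i)" using Cons.IH by blast
  let ?h = "case_nat k h"
  have "k \<le> 2 * ((k + 1 - of_bool b) div 2) + of_bool b" by (cases b) auto
  moreover have "(k + 1 - of_bool b) div 2 \<le> k" by (cases b) auto
  ultimately have "?h 0 = k \<and> ?h (length (b # bs)) = 0 \<and> (\<forall>i. ?h i \<le> k) \<and>
     (\<forall>i<length (b # bs). ?h i \<le> 2 * ?h (Suc i) + of_bool ((b # bs) ! i))"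
    using h by (auto simp: nth_Cons less_Suc_eq_0_disj split: nat.split intro: order_trans)
  then show ?case by blast
qed

lemma sum_of_bool_card: "(\<Sum>e<n. of_bool (P e)) = card {e. e < n \<and> P e}" for n :: nat
  by (simp only: sum_of_bool_eq finite_lessThan) (simp add: Int_def)

lemma line_I:
  assumes v: "valid x" and r: "root_ok x F"
  shows "is_line_graph (graph x)"
proof (rule line_graphI[of "\<lambda>e. {F 0 e, F 1 e}" "nn x"])
  show "inj_on (\<lambda>e. {F 0 e, F 1 e}) {..<nn x}"
  proof (rule inj_onI, rule ccontr)
    fix e f assume "e \<in> {..<nn x}" "f \<in> {..<nn x}" "{F 0 e, F 1 e} = {F 0 f, F 1 f}" "e \<noteq> f"
    then show False using r unfolding root_ok_def by (auto simp: doubleton_eq_iff)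
  qed
  fix e f assume ef: "e < nn x" "f < nn x"
  have "meets F e f \<longleftrightarrow> {F 0 e, F 1 e} \<inter> {F 0 f, F 1 f} \<noteq> {}" by (auto simp: meets_def)
  then show "{e, f} \<in> edges (graph x) \<longleftrightarrow> e \<noteq> f \<and> {F 0 e, F 1 e} \<inter> {F 0 f, F 1 f} \<noteq> {}"
    using graph_edge[OF v ef] r ef unfolding root_ok_def by blast
qed (use r in \<open>auto simp: graph_def root_ok_def\<close>)

lemma verifier_sound:
  assumes v: "valid x" and r: "root_ok x F" and b: "budget_ok x F" and l: "label_ok x F"
  shows "\<exists>S. even_cycle_transversal (graph x) S \<and> card S \<le> kk x"
proof -
  define S where "S = {e. e < nn x \<and> F 2 e \<noteq> 0}"
  have "even_cycle_transversal (graph x) S"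
    unfolding even_cycle_transversal_def
  proof (intro conjI allI impI)
    show "S \<subseteq> verts (graph x)" by (auto simp: S_def graph_def)
    fix c assume c: "is_cycle (graph x) c \<and> even (length c)"
    then have cn: "set c \<subseteq> {..<nn x}" by (simp add: is_cycle_def graph_def)
    show "S \<inter> set c \<noteq> {}"
    proof
      assume d: "S \<inter> set c = {}"
      have "odd (length c)"
      proof (rule cert_sound[OF l[unfolded label_ok_def]])
        show "3 \<le> length c" "distinct c" using c by (auto simp: is_cycle_def)
        show "set c \<subseteq> {e. e < nn x \<and> F 2 e = 0}" using cn d by (auto simp: S_def)
        fix i assume i: "i < length c"
        have "Suc i mod length c < length c" using i by (intro mod_less_divisor) linarith
        then have "c ! i \<in> {..<nn x}" "c ! (Suc i mod length c) \<in> {..<nn x}"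
          using nth_mem[of _ c] i cn by blast+
        then show "adjx x (c ! i) (c ! (Suc i mod length c))"
          using c i graph_edge[OF v] by (auto simp: is_cycle_def)
      next
        fix e f assume "e \<in> {e. e < nn x \<and> F 2 e = 0}" "f \<in> {e. e < nn x \<and> F 2 e = 0}" "adjx x e f"
        then show "adjx x f e" using v by (auto simp: valid_def)
      qed
      then show False using c by simp
    qed
  qed
  moreover have "card S \<le> kk x"
  proof -
    have "card S \<le> F 7 0" using b unfolding budget_ok_def sum_of_bool_card S_def by simp
    also have "F 7 0 \<le> val (drop (hdr x) x)"
    proof (rule budget_le)
      have h: "hdr x \<le> length x" using v by (simp add: valid_def)
      fix i assume "i < length (drop (hdr x) x)"
      then have i: "i < length x - hdr x" by simp
      then have "hdr x + i < length x" by linarith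
      then have "bit x (hdr x + i) = drop (hdr x) x ! i" using h by (simp add: bit_iff)
      moreover have "F 7 i \<le> 2 * F 7 (Suc i) + of_bool (bit x (hdr x + i))"
        using b i unfolding budget_ok_def by blast
      ultimately show "F 7 i \<le> 2 * F 7 (Suc i) + of_bool (drop (hdr x) x ! i)" by simp
    qed (use b in \<open>simp add: budget_ok_def\<close>)
    finally show ?thesis by (simp add: kk_def)
  qed
  ultimately show ?thesis by blast
qed

lemma nn_le: "valid x \<Longrightarrow> nn x < length x"
  by (simp add: valid_def hdr_def)

text \<open>The root graph may have large vertex numbers and isolated vertices. Only the ends of its
  edges are recorded, renumbered by \<open>\<psi>\<close> to be small.\<close>

lemma verifier_complete:
  assumes v: "valid x" and lg: "is_line_graph (graph x)"
    and S: "even_cycle_transversal (graph x) S" "card S \<le> kk x"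
  shows "\<exists>F. root_ok x F \<and> budget_ok x F \<and> label_ok x F \<and> (\<forall>c i. F c i \<le> size_bound x)"
proof -
  define n where "n = nn x"
  have nl: "n < length x" using nn_le[OF v] by (simp add: n_def)
  obtain H :: "nat ugraph" and \<phi> where H: "simple_graph H" and \<phi>: "bij_betw \<phi> (verts (graph x)) (verts (line_graph H))"
    and e\<phi>: "\<forall>u\<in>verts (graph x). \<forall>v\<in>verts (graph x). {u, v} \<in> edges (graph x) \<longleftrightarrow> {\<phi> u, \<phi> v} \<in> edges (line_graph H)"
    using lg unfolding is_line_graph_def graph_iso_def by blast
  have vg: "verts (graph x) = {..<n}" by (simp add: graph_def n_def)
  have inj: "inj_on \<phi> {..<n}" and im: "\<phi> ` {..<n} = edges H"
    using \<phi> by (auto simp: bij_betw_def vg line_graph_def)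
  have c2: "card (\<phi> e) = 2" if "e < n" for e
    using H im that by (auto simp: simple_graph_def)
  have adj: "adjx x e f \<longleftrightarrow> e \<noteq> f \<and> \<phi> e \<inter> \<phi> f \<noteq> {}" if "e < n" "f < n" for e f
  proof -
    have "adjx x e f \<longleftrightarrow> {\<phi> e, \<phi> f} \<in> edges (line_graph H)"
      using graph_edge[OF v] e\<phi> that vg by (simp add: n_def)
    also have "\<dots> \<longleftrightarrow> \<phi> e \<noteq> \<phi> f \<and> \<phi> e \<inter> \<phi> f \<noteq> {}"
    proof -
      have "\<phi> e \<in> edges H" "\<phi> f \<in> edges H" using im that by auto
      then show ?thesis by (simp add: line_graph_def) (metis doubleton_eq_iff inf_commute)
    qed
    finally show ?thesis using inj_onD[OF inj, of e f] that by auto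
  qed
  define X where "X = (\<Union>e<n. \<phi> e)"
  have "finite (\<phi> e)" if "e < n" for e using c2[OF that] by (intro card_ge_0_finite) simp
  then have fX: "finite X" by (auto simp: X_def)
  have "card X \<le> (\<Sum>e<n. card (\<phi> e))" unfolding X_def by (rule card_UN_le) simp
  also have "\<dots> = 2 * n" using c2 by simp
  finally have cX: "card X \<le> 2 * n" .
  define \<psi> where "\<psi> = to_nat_on X"
  have \<psi>: "inj_on \<psi> X" "\<psi> ` X = {..<card X}"
    using to_nat_on_finite[OF fX] by (auto simp: bij_betw_def \<psi>_def)
  have "\<forall>e. \<exists>p q. e < n \<longrightarrow> \<phi> e = {p, q} \<and> p \<noteq> q" using c2 by (metis card_2_iff)
  then obtain p q where pq: "\<And>e. e < n \<Longrightarrow> \<phi> e = {p e, q e} \<and> p e \<noteq> q e" by metis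
  have X: "p e \<in> X" "q e \<in> X" if "e < n" for e using pq[OF that] that by (auto simp: X_def)
  have \<psi>eq: "\<psi> a = \<psi> b \<longleftrightarrow> a = b" if "a \<in> X" "b \<in> X" for a b using inj_onD[OF \<psi>(1)] that by blast
  have \<psi>lt: "\<psi> a \<le> size_bound x" if "a \<in> X" for a
  proof -
    have "\<psi> a < card X" using \<psi>(2) that by blast
    then show ?thesis using cX nl by (simp add: size_bound_def)
  qed
  have Sn: "S \<subseteq> {..<n}" using S(1) by (simp add: even_cycle_transversal_def vg)
  let ?U = "{..<n} - S"
  have "noeven (\<phi> ` ?U)"
    using ect_noeven[OF inj vg _ Sn] S(1) graph_edge[OF v] adj by (simp add: n_def)
  then obtain C where oc: "oc (\<phi> ` ?U) C"
    using noeven_oc[of "\<phi> ` ?U"] c2 by auto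
  obtain r lb tp where ct: "cert (\<phi> ` ?U) (\<lambda>e f. e \<noteq> f \<and> e \<inter> f \<noteq> {}) (\<lambda>e. e \<subseteq> C) r lb tp"
    and bd: "\<forall>e\<in>\<phi> ` ?U. r e \<le> card (\<phi> ` ?U) \<and> lb e \<le> card (\<phi> ` ?U) \<and> tp e \<le> card (\<phi> ` ?U)"
    using oc_cert[OF oc] by blast
  have "card (\<phi> ` ?U) \<le> card ?U" by (rule card_image_le) simp
  also have "\<dots> \<le> card {..<n}" by (rule card_mono) auto
  finally have cU: "card (\<phi> ` ?U) \<le> size_bound x" using nl by (simp add: size_bound_def)
  obtain h where h: "h 0 = card S" "h (length (drop (hdr x) x)) = 0" "\<forall>i. h i \<le> card S"
    "\<forall>i<length (drop (hdr x) x). h i \<le> 2 * h (Suc i) + of_bool (drop (hdr x) x ! i)"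
    using budget_ge[of "card S" "drop (hdr x) x"] S(2) unfolding kk_def by blast
  have cS: "card S \<le> size_bound x"
    using card_mono[OF _ Sn] nl by (simp add: size_bound_def)
  \<comment> \<open>The bounds on the labels hold for the remaining edges only, so edges in
    \<open>S\<close> get 0 as rank, cycle name and last position.\<close>
  define F where "F c i = (if c = 7 then h i else if i < n then
      (if c = 0 then \<psi> (p i) else if c = 1 then \<psi> (q i) else if c = 2 then of_bool (i \<in> S)
       else if c = 3 then of_bool (\<phi> i \<subseteq> C) else if i \<in> S then 0 else if c = 4 then r (\<phi> i) else if c = 5 then lb (\<phi> i)
       else tp (\<phi> i)) else 0)" for c i :: nat
  have F: "F 0 e = \<psi> (p e)" "F 1 e = \<psi> (q e)" "F 2 e = of_bool (e \<in> S)" "F 3 e = of_bool (\<phi> e \<subseteq> C)" if "e < n" for e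
    using that by (simp_all add: F_def)
  have meets: "meets F e f \<longleftrightarrow> \<phi> e \<inter> \<phi> f \<noteq> {}" if "e < n" "f < n" for e f
  proof -
    have pe: "\<phi> e = {p e, q e}" and pf: "\<phi> f = {p f, q f}" using pq that by blast+
    have "meets F e f \<longleftrightarrow> p e = p f \<or> p e = q f \<or> q e = p f \<or> q e = q f"
      unfolding meets_def F[OF that(1)] F[OF that(2)] using X[OF that(1)] X[OF that(2)] by (simp only: \<psi>eq)
    also have "\<dots> \<longleftrightarrow> \<phi> e \<inter> \<phi> f \<noteq> {}" unfolding pe pf by blast
    finally show ?thesis .
  qed
  have "root_ok x F"
    unfolding root_ok_def n_def[symmetric]
  proof (intro conjI allI impI)
    show "F 0 e \<noteq> F 1 e" if "e < n" for e
      unfolding F[OF that] using \<psi>eq[OF X[OF that]] pq[OF that] by blast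
    show "\<not> (F 0 e = F 0 f \<and> F 1 e = F 1 f \<or> F 0 e = F 1 f \<and> F 1 e = F 0 f)" if "e < n" "f < n" "e \<noteq> f" for e f
    proof
      assume "F 0 e = F 0 f \<and> F 1 e = F 1 f \<or> F 0 e = F 1 f \<and> F 1 e = F 0 f"
      then have "p e = p f \<and> q e = q f \<or> p e = q f \<and> q e = p f"
        unfolding F[OF that(1)] F[OF that(2)] using X[OF that(1)] X[OF that(2)] by (simp only: \<psi>eq)
      moreover have "\<phi> e = {p e, q e}" "\<phi> f = {p f, q f}" using pq that by blast+
      ultimately have "\<phi> e = \<phi> f" by (metis insert_commute)
      then show False using inj_onD[OF inj, of e f] that by auto
    qed
    show "adjx x e f = (e \<noteq> f \<and> meets F e f)" if "e < n" "f < n" for e f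
      using adj meets that by simp
  qed
  moreover have "budget_ok x F"
    unfolding budget_ok_def sum_of_bool_card n_def[symmetric]
  proof (intro conjI allI impI)
    have "{e. e < n \<and> F 2 e \<noteq> 0} = S" using Sn by (auto simp: F)
    then show "card {e. e < n \<and> F 2 e \<noteq> 0} \<le> F 7 0" using h(1) by (simp add: F_def)
    show "F 7 (length x - hdr x) = 0" using h(2) by (simp add: F_def)
    fix i assume i: "i < length x - hdr x"
    then have "hdr x + i < length x" by linarith
    then have "bit x (hdr x + i) = drop (hdr x) x ! i" using v by (simp add: bit_iff valid_def)
    then show "F 7 i \<le> 2 * F 7 (Suc i) + of_bool (bit x (hdr x + i))" using h(4) i by (simp add: F_def)
  qed
  moreover have "label_ok x F"
  proof -
    have U: "{e. e < nn x \<and> F 2 e = 0} = ?U" by (auto simp: F n_def[symmetric])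
    show ?thesis
      unfolding label_ok_def U
      by (rule cert_map[OF ct]) (use inj adj inj_onD[OF inj] in \<open>auto simp: F_def inj_on_def\<close>)
  qed
  moreover have "F c i \<le> size_bound x" for c i
  proof -
    have "1 \<le> size_bound x" by (simp add: size_bound_def)
    moreover have "r (\<phi> i) \<le> size_bound x \<and> lb (\<phi> i) \<le> size_bound x \<and> tp (\<phi> i) \<le> size_bound x" if "i < n" "i \<notin> S"
      using bd that cU by (auto intro: order_trans)
    ultimately show ?thesis using \<psi>lt X h(3) cS by (auto simp: F_def intro: order_trans)
  qed
  ultimately show ?thesis by blast
qed

text \<open>Entries are unary, in blocks of \<open>m\<close> bits, so that decoding an entry is
  counting.\<close>

definition tab :: "nat \<Rightarrow> bool list \<Rightarrow> nat \<Rightarrow> nat \<Rightarrow> nat" where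
  "tab m u c i = (\<Sum>j<m. of_bool (bit u ((c * m + i) * m + j)))"

lemma tab_ex:
  assumes G: "\<And>c i. G c i \<le> m"
  shows "\<exists>u. length u = 8 * m * m \<and> (\<forall>c<8. \<forall>i<m. tab m u c i = G c i)"
proof -
  define u where "u = map (\<lambda>p. p mod m < G (p div m div m) (p div m mod m)) [0..<8 * m * m]"
  have "tab m u c i = G c i" if c: "c < 8" and i: "i < m" for c i
  proof -
    have b: "bit u ((c * m + i) * m + j) \<longleftrightarrow> j < G c i" if j: "j < m" for j
    proof -
      have *: "a * m + b < d * m" if "a < d" "b < m" for a b d
      proof -
        have "Suc a * m \<le> d * m" by (rule mult_le_mono1) (use that in simp)
        then show ?thesis using that(2) by (simp only: mult_Suc)
      qed
      have "(c * m + i) * m + j < 8 * m * m" by (intro * c i j)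
      moreover have "((c * m + i) * m + j) div m = c * m + i" "((c * m + i) * m + j) mod m = j" using j by simp_all
      moreover have "(c * m + i) div m = c" "(c * m + i) mod m = i" using i by simp_all
      ultimately show ?thesis by (simp add: bit_iff u_def)
    qed
    have "tab m u c i = card {j. j < m \<and> j < G c i}"
      unfolding tab_def sum_of_bool_card[symmetric] using b by (intro sum.cong) auto
    also have "{j. j < m \<and> j < G c i} = {..<G c i}" using G[of c i] by auto
    finally show ?thesis by simp
  qed
  then show ?thesis by (intro exI[of _ u]) (simp add: u_def)
qed

definition verify :: "bool list \<Rightarrow> bool list \<Rightarrow> bool" where
  "verify x u \<longleftrightarrow> valid x \<and> root_ok x (tab (size_bound x) u) \<and> budget_ok x (tab (size_bound x) u) \<and>
     label_ok x (tab (size_bound x) u)"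

lemma ect_verify:
  "x \<in> even_cycle_transversal_on is_line_graph \<longleftrightarrow>
     (\<exists>u. length u \<le> poly (smult 8 ([:1, 2:] * [:1, 2:])) (length x) \<and> verify x u)"
proof
  assume "x \<in> even_cycle_transversal_on is_line_graph"
  then have v: "valid x" and "is_line_graph (graph x)" "\<exists>S. even_cycle_transversal (graph x) S \<and> card S \<le> kk x"
    unfolding ect_on_iff by auto
  then obtain F where F: "root_ok x F" "budget_ok x F" "label_ok x F" "\<And>c i. F c i \<le> size_bound x"
    using verifier_complete by blast
  let ?m = "size_bound x"
  obtain u where u: "length u = 8 * ?m * ?m" "\<And>c i. c < 8 \<Longrightarrow> i < ?m \<Longrightarrow> tab ?m u c i = F c i"
    using tab_ex[of F, OF F(4)] by blast
  have m: "nn x < ?m" "i \<le> length x \<Longrightarrow> i < ?m" for i using nn_le[OF v] by (auto simp: size_bound_def)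
  have e: "tab ?m u c e = F c e" if "c < 8" "e < nn x" for c e using u(2)[OF that(1)] that(2) m(1) by simp
  have "root_ok x (tab ?m u)" using F(1) unfolding root_ok_def meets_def by (simp add: e)
  moreover have "budget_ok x (tab ?m u)"
  proof -
    have "(\<Sum>k<nn x. of_bool (tab ?m u 2 k \<noteq> 0)) = (\<Sum>k<nn x. of_bool (F 2 k \<noteq> 0) :: nat)"
      by (rule sum.cong) (simp_all add: e)
    moreover have "tab ?m u 7 i = F 7 i" if "i \<le> length x - hdr x" for i using u(2)[of 7 i] m(2)[of i] that by simp
    ultimately show ?thesis using F(2) unfolding budget_ok_def by simp
  qed
  moreover have "label_ok x (tab ?m u)"
  proof -
    have U: "{k. k < nn x \<and> tab ?m u 2 k = 0} = {k. k < nn x \<and> F 2 k = 0}" using e by auto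
    show ?thesis unfolding label_ok_def U
      by (rule cert_map[of "\<lambda>k. k"]) (use F(3) e in \<open>auto simp: label_ok_def\<close>)
  qed
  ultimately have "verify x u" unfolding verify_def using v by blast
  moreover have "length u \<le> poly (smult 8 ([:1, 2:] * [:1, 2:])) (length x)"
    by (simp add: u(1) size_bound_def algebra_simps)
  ultimately show "\<exists>u. length u \<le> poly (smult 8 ([:1, 2:] * [:1, 2:])) (length x) \<and> verify x u" by blast
next
  assume "\<exists>u. length u \<le> poly (smult 8 ([:1, 2:] * [:1, 2:])) (length x) \<and> verify x u"
  then show "x \<in> even_cycle_transversal_on is_line_graph"
    unfolding ect_on_iff verify_def using line_I verifier_sound by blast
qed

lemma dpred_bit:
  assumes "dfun F"
  shows "dpred (\<lambda>W s. bit (W 0) (F W s))" "dpred (\<lambda>W s. bit (W (Suc 0)) (F W s))"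
  unfolding bit_def by (intro DP_eq D_inp D_const assms)+

lemma dfun_nn: "dfun (\<lambda>W s. nn (W 0))"
  unfolding nn_def by (intro D_intros dpred_bit D_var D_const)

lemma dfun_hdr: "dfun (\<lambda>W s. hdr (W 0))"
  unfolding hdr_def by (intro D_intros dfun_nn D_const)

lemma dfun_size_bound: "dfun (\<lambda>W s. size_bound (W 0))"
  unfolding size_bound_def by (intro D_intros D_const)

lemma dpred_adjx:
  assumes "dfun F" "dfun G"
  shows "dpred (\<lambda>W s. adjx (W 0) (F W s) (G W s))"
  unfolding adjx_def by (intro D_intros dpred_bit dfun_nn D_const assms)

lemma dpred_valid: "dpred (\<lambda>W s. valid (W 0))"
  unfolding valid_def by (intro D_intros dpred_bit dpred_adjx dfun_nn dfun_hdr D_var D_const)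

lemma dfun_tab:
  assumes "dfun F"
  shows "dfun (\<lambda>W s. tab (size_bound (W 0)) (W (Suc 0)) c (F W s))"
  unfolding tab_def
  by (intro D_intros dpred_bit dfun_size_bound D_var D_const assms D_weak[OF assms])

lemma Ball_less: "(\<forall>e\<in>{e. e < n \<and> P e}. Q e) \<longleftrightarrow> (\<forall>e<n. P e \<longrightarrow> Q e)" for n :: nat
  by blast

lemma even_mod: "even n \<longleftrightarrow> n mod 2 = (0::nat)"
  by (rule even_iff_mod_2_eq_zero)

text \<open>After unfolding, the verifier consists of bounded quantifiers, arithmetic and table
  look-ups; this is why the certificate conditions were kept local.\<close>

lemma dpred_verify: "dpred (\<lambda>W s. verify (W 0) (W (Suc 0)))"
  unfolding verify_def root_ok_def meets_def budget_ok_def label_ok_def cert_def Ball_less even_mod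
  by (intro D_intros dpred_bit dpred_adjx dpred_valid dfun_nn dfun_hdr dfun_tab D_var D_const)

lemma ect_NP: "even_cycle_transversal_on is_line_graph \<in> NP"
proof -
  obtain e where e: "\<And>W s. eval e W s = of_bool (verify (W 0) (W (Suc 0)))"
    using D_ex[OF dpred_verify[unfolded dpred_def]] by blast
  show ?thesis
    by (rule NP_I[where e = e and p = "smult 8 ([:1, 2:] * [:1, 2:])"]) (simp only: ect_verify, simp add: e words_def)
qed

section \<open>Tilings of runs\<close>

text \<open>A run is tiled with one row per step: \<open>Cell q rs cs ir il\<close> is a tape position in state \<open>q\<close>, with scanned
  symbols \<open>rs\<close>, contents \<open>cs\<close> (with head flags), and heads entering to the right and to the left. The tiling is
  cyclic: \<open>Bd\<close> is the border column, and the lower border of an initial tile \<open>Ini\<close>, which guesses the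
  certificate, requires the accepting state in the row before it, that is, in the last one.\<close>

datatype lr = Sig "nat list" "bool list" "bool list" | Flg bool
datatype tile = Cell nat "nat list" "(nat \<times> bool) list" "bool list" "bool list"
  | Bd lr lr | Ini nat "(nat \<times> bool) list" "(nat \<times> bool) list" bool bool

fun calm :: "lr \<Rightarrow> bool" where
  "calm (Sig rs r l) = (True \<notin> set r \<union> set l)"
| "calm (Flg b) = True"

lemma act_Stay: "act (read_tape t, Stay) t = t"
  by (cases t) simp

locale tm =
  fixes T :: machine
  assumes T: "turing_machine T" and two: "2 \<le> num_tapes T"
begin

abbreviation kt :: nat where "kt \<equiv> num_tapes T"

text \<open>In a halting state nothing changes, so that tilings of a fixed height also describe runs
  that halt earlier.\<close>

definition mv :: "nat \<Rightarrow> nat list \<Rightarrow> nat \<times> (nat \<times> direction) list" where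
  "mv q rs = (if q = accept_state T \<or> q = reject_state T then (q, map (\<lambda>s. (s, Stay)) rs) else trans T q rs)"

lemma step_mv:
  "step T (q, ts) = (fst (mv q (map read_tape ts)), map2 act (snd (mv q (map read_tape ts))) ts)"
proof -
  have "map2 act (map (\<lambda>s. (s, Stay)) (map read_tape ts)) ts = ts"
    by (induction ts) (auto simp: act_Stay)
  then show ?thesis by (auto simp: step_def halted_def mv_def case_prod_unfold Let_def)
qed

lemma mv_ok:
  assumes "q < num_states T" "length rs = kt" "set rs \<subseteq> {..<num_symbols T}"
  shows "fst (mv q rs) < num_states T" "length (snd (mv q rs)) = kt"
    "fst ` set (snd (mv q rs)) \<subseteq> {..<num_symbols T}"
  using assms T by (auto simp: mv_def turing_machine_def)

text \<open>After \<open>n\<close> steps all heads are within distance \<open>n\<close> of the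
  origin, which confines \<open>R\<close> steps to the positions from \<open>-R\<close> to
  \<open>R\<close>.\<close>

definition wf_conf :: "nat \<Rightarrow> config \<Rightarrow> bool" where
  "wf_conf n c \<longleftrightarrow> fst c < num_states T \<and> length (snd c) = kt \<and>
     (\<forall>j<kt. (\<forall>p. fst (snd c ! j) p < num_symbols T) \<and> \<bar>snd (snd c ! j)\<bar> \<le> int n)"

lemma read_tape_eq: "read_tape t = fst t (snd t)"
  by (cases t) simp

lemma wf_sym: "wf_conf n c \<Longrightarrow> t \<in> set (snd c) \<Longrightarrow> fst t p < num_symbols T"
  by (auto simp: wf_conf_def in_set_conv_nth simp del: split_paired_All)

lemma wf_read:
  assumes "wf_conf n c"
  shows "length (map read_tape (snd c)) = kt" "set (map read_tape (snd c)) \<subseteq> {..<num_symbols T}"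
  using assms wf_sym[OF assms] by (auto simp: wf_conf_def read_tape_eq)

lemma act_eq: "act a t = ((fst t)(snd t := fst a), snd t + offset (snd a))"
  by (cases a; cases t) simp

lemma wf_step:
  assumes "wf_conf n c"
  shows "wf_conf (Suc n) (step T c)"
proof -
  obtain q ts where c: "c = (q, ts)" by (cases c)
  let ?m = "mv q (map read_tape ts)"
  have w: "q < num_states T" "length ts = kt" using assms by (auto simp: wf_conf_def c)
  note m = mv_ok[OF w(1), of "map read_tape ts"] wf_read[OF assms, unfolded c snd_conv]
  have off: "\<bar>offset d\<bar> \<le> 1" for d by (cases d) auto
  have "(\<forall>p. fst (act (snd ?m ! j) (ts ! j)) p < num_symbols T) \<and> \<bar>snd (act (snd ?m ! j) (ts ! j))\<bar> \<le> int (Suc n)"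
    if j: "j < kt" for j
  proof -
    have "snd ?m ! j \<in> set (snd ?m)" using m j by simp
    then have "fst (snd ?m ! j) < num_symbols T" using m by (auto simp del: nth_mem)
    moreover have "(\<forall>p. fst (ts ! j) p < num_symbols T) \<and> \<bar>snd (ts ! j)\<bar> \<le> int n"
      using assms j by (auto simp: wf_conf_def c)
    ultimately show ?thesis using off[of "snd (snd ?m ! j)"] by (auto simp: act_eq)
  qed
  then show ?thesis unfolding wf_conf_def c step_mv using m w by simp
qed

lemma wf_run: "length ws \<le> kt \<Longrightarrow> wf_conf n (run T ws n)"
proof (induction n)
  case 0
  have *: "word_cells w p < num_symbols T" for w p
    using T by (auto simp: turing_machine_def word_cells_def)
  have "(\<forall>p. fst (snd (init_config T ws) ! j) p < num_symbols T) \<and> \<bar>snd (snd (init_config T ws) ! j)\<bar> \<le> int 0"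
    if "j < kt" for j
    using that 0 * by (auto simp: init_config_def simp del: map_append)
  then show ?case using T 0 by (auto simp: wf_conf_def run_def init_config_def turing_machine_def)
next
  case (Suc n)
  then show ?case using wf_step[of n "run T ws n"] by (simp add: run_def)
qed

section \<open>Tiles, their colours and the rules for placing them\<close>

definition cellc :: "config \<Rightarrow> int \<Rightarrow> (nat \<times> bool) list" where
  "cellc c p = map (\<lambda>(f, h). (f p, h = p)) (snd c)"

definition outs :: "direction \<Rightarrow> nat \<Rightarrow> nat list \<Rightarrow> (nat \<times> bool) list \<Rightarrow> bool list" where
  "outs d q rs cs = map (\<lambda>j. snd (cs ! j) \<and> snd (snd (mv q rs) ! j) = d) [0..<kt]"

definition nxtc :: "nat \<Rightarrow> nat list \<Rightarrow> (nat \<times> bool) list \<Rightarrow> bool list \<Rightarrow> bool list \<Rightarrow> (nat \<times> bool) list" where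
  "nxtc q rs cs ir il = map (\<lambda>j. (if snd (cs ! j) then fst (snd (mv q rs) ! j) else fst (cs ! j),
     snd (cs ! j) \<and> snd (snd (mv q rs) ! j) = Stay \<or> ir ! j \<or> il ! j)) [0..<kt]"

text \<open>A vertical border carries the guessed vector of scanned symbols, which is thereby
  constant along a row, and the heads that cross it: those moving right, followed by those moving
  left.\<close>

fun lcol :: "tile \<Rightarrow> lr" where
  "lcol (Cell q rs cs ir il) = Sig rs ir (outs Lft q rs cs)"
| "lcol (Bd a b) = a"
| "lcol (Ini q cs cs' a b) = Flg a"

fun rcol :: "tile \<Rightarrow> lr" where
  "rcol (Cell q rs cs ir il) = Sig rs (outs Rgt q rs cs) il"
| "rcol (Bd a b) = b"
| "rcol (Ini q cs cs' a b) = Flg b"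

fun dcol :: "tile \<Rightarrow> (nat \<times> (nat \<times> bool) list) option" where
  "dcol (Cell q rs cs ir il) = Some (q, cs)"
| "dcol (Bd a b) = None"
| "dcol (Ini q cs cs' a b) = Some (q, cs)"

fun ucol :: "tile \<Rightarrow> (nat \<times> (nat \<times> bool) list) option" where
  "ucol (Cell q rs cs ir il) = Some (fst (mv q rs), nxtc q rs cs ir il)"
| "ucol (Bd a b) = None"
| "ucol (Ini q cs cs' a b) = Some (0, cs')"

definition symlists :: "nat list set" where
  "symlists = {rs. set rs \<subseteq> {..<num_symbols T} \<and> length rs = kt}"
definition boollists :: "bool list set" where
  "boollists = {bs. set bs \<subseteq> UNIV \<and> length bs = kt}"
definition cells :: "(nat \<times> bool) list set" where
  "cells = {cs. set cs \<subseteq> {..<num_symbols T} \<times> UNIV \<and> length cs = kt}"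

fun lr_ok :: "lr \<Rightarrow> bool" where
  "lr_ok (Sig rs r l) = (rs \<in> symlists \<and> r \<in> boollists \<and> l \<in> boollists)"
| "lr_ok (Flg b) = True"

text \<open>The last condition on \<open>Cell\<close> checks the guessed vector against the tape in
  the cell that holds the head.\<close>

fun tile_ok :: "tile \<Rightarrow> bool" where
  "tile_ok (Cell q rs cs ir il) = (q < num_states T \<and> rs \<in> symlists \<and> cs \<in> cells \<and> ir \<in> boollists \<and>
     il \<in> boollists \<and> (\<forall>j<kt. snd (cs ! j) \<longrightarrow> fst (cs ! j) = rs ! j))"
| "tile_ok (Bd a b) = (lr_ok a \<and> lr_ok b)"
| "tile_ok (Ini q cs cs' a b) = (q < num_states T \<and> cs \<in> cells \<and> cs' \<in> cells)"

definition tiles :: "tile set" where "tiles = {v. tile_ok v}"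

lemma finite_lists: "finite symlists" "finite boollists" "finite cells"
  unfolding symlists_def boollists_def cells_def by (intro finite_lists_length_eq; simp)+

lemma finite_tiles: "finite tiles"
proof -
  let ?L = "(\<lambda>(rs, r, l). Sig rs r l) ` (symlists \<times> boollists \<times> boollists) \<union> range Flg"
  have L: "a \<in> ?L" if "lr_ok a" for a
    using that by (cases a) (auto simp: image_iff)
  let ?T = "(\<lambda>(q, rs, cs, ir, il). Cell q rs cs ir il) ` ({..<num_states T} \<times> symlists \<times> cells \<times> boollists \<times> boollists)
    \<union> (\<lambda>(a, b). Bd a b) ` (?L \<times> ?L)
    \<union> (\<lambda>(q, cs, cs', a, b). Ini q cs cs' a b) ` ({..<num_states T} \<times> cells \<times> cells \<times> UNIV \<times> UNIV)"
  have "v \<in> ?T" if "tile_ok v" for v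
  proof (cases v)
    case (Cell q rs cs ir il)
    then show ?thesis using that by (intro UnI1 image_eqI[of _ _ "(q, rs, cs, ir, il)"]) auto
  next
    case (Bd a b)
    then show ?thesis using that L[of a] L[of b]
      by (intro UnI1 UnI2 image_eqI[of _ _ "(a, b)"]) (simp_all del: Un_iff)
  next
    case (Ini q cs cs' a b)
    then show ?thesis using that by (intro UnI2 image_eqI[of _ _ "(q, cs, cs', a, b)"]) auto
  qed
  then have "tiles \<subseteq> ?T" unfolding tiles_def by blast
  moreover have "finite ?T" using finite_lists by simp
  ultimately show ?thesis by (rule finite_subset)
qed

lemma tiles_nonempty: "tiles \<noteq> {}"
proof -
  have "Bd (Flg True) (Flg True) \<in> tiles" by (simp add: tiles_def)
  then show ?thesis by blast
qed

text \<open>\<open>t0\<close>, \<open>i0\<close>: bottom row, border column; \<open>ng\<close>, \<open>zr\<close>: negative position, position 0;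
  \<open>ip\<close>: position at which the certificate may be non-blank; \<open>sx\<close>: symbol of the instance.\<close>

definition ok :: "bool \<Rightarrow> bool \<Rightarrow> bool \<Rightarrow> bool \<Rightarrow> bool \<Rightarrow> nat \<Rightarrow> tile \<Rightarrow> bool" where
  "ok t0 i0 ng zr ip sx v \<longleftrightarrow> (case v of
     Bd a b \<Rightarrow> i0 \<and> calm a \<and> calm b
   | Ini q cs cs' a b \<Rightarrow> \<not> i0 \<and> t0 \<and> q = accept_state T \<and> (\<forall>j<kt. snd (cs' ! j) = zr) \<and> fst (cs' ! 0) = sx \<and>
       (\<forall>j<kt. 2 \<le> j \<longrightarrow> fst (cs' ! j) = 0) \<and>
       (if ng then a \<and> b \<and> fst (cs' ! 1) = 0
        else if b then a \<and> ip \<and> fst (cs' ! 1) \<in> {1, 2} else fst (cs' ! 1) = 0)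
   | Cell q rs cs ir il \<Rightarrow> \<not> i0 \<and> \<not> t0)"

definition okpos :: "bool list \<Rightarrow> nat \<Rightarrow> nat \<Rightarrow> nat \<Rightarrow> nat \<Rightarrow> tile \<Rightarrow> bool" where
  "okpos x P R t i = ok (t = 0) (i = 0) (i < R + 1) (i = R + 1) (i - (R + 1) < P)
     (if i < R + 1 then 0 else word_cells x (int (i - (R + 1))))"

text \<open>Row 0 starts the run and every later row makes one step. Column 0 separates the right
  end of one row from the left end of the next, which are neighbours on the helix.\<close>

definition tiling :: "bool list \<Rightarrow> nat \<Rightarrow> nat \<Rightarrow> (nat \<Rightarrow> nat \<Rightarrow> tile) \<Rightarrow> bool" where
  "tiling x P R g \<longleftrightarrow> (\<forall>t\<le>R. \<forall>i<2 * R + 2. g t i \<in> tiles \<and> okpos x P R t i (g t i) \<and>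
     rcol (g t i) = lcol (if Suc i < 2 * R + 2 then g t (Suc i) else if t < R then g (Suc t) 0 else g 0 0) \<and>
     ucol (g t i) = dcol (if t < R then g (Suc t) i else g 0 i))"

section \<open>Accepting runs correspond to tilings\<close>

abbreviation pos :: "nat \<Rightarrow> nat \<Rightarrow> int" where "pos R i \<equiv> int i - int (R + 1)"

lemma cellc_nth: "j < length (snd c) \<Longrightarrow> cellc c p ! j = (fst (snd c ! j) p, snd (snd c ! j) = p)"
  by (simp add: cellc_def case_prod_unfold)

lemma length_cellc: "length (cellc c p) = length (snd c)"
  by (simp add: cellc_def)

text \<open>A head is at \<open>p\<close> after the step iff it stayed there or came from an
  adjacent cell; \<open>ir\<close> and \<open>il\<close> report arrivals from the left and from the
  right.\<close>

lemma nxtc_step: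
  assumes wf: "wf_conf n c"
    and ir: "\<And>j. j < kt \<Longrightarrow> ir ! j = (snd (snd c ! j) = p - 1 \<and> snd (snd (mv (fst c) (map read_tape (snd c))) ! j) = Rgt)"
    and il: "\<And>j. j < kt \<Longrightarrow> il ! j = (snd (snd c ! j) = p + 1 \<and> snd (snd (mv (fst c) (map read_tape (snd c))) ! j) = Lft)"
  shows "nxtc (fst c) (map read_tape (snd c)) (cellc c p) ir il = cellc (step T c) p"
proof (rule nth_equalityI)
  obtain q ts where c: "c = (q, ts)" by (cases c)
  have w: "q < num_states T" "length ts = kt" using wf by (auto simp: wf_conf_def c)
  note m = mv_ok[OF w(1) wf_read[OF wf, unfolded c snd_conv]]
  show l: "length (nxtc (fst c) (map read_tape (snd c)) (cellc c p) ir il) = length (cellc (step T c) p)"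
    using m w by (simp add: nxtc_def length_cellc c step_mv)
  fix j assume "j < length (nxtc (fst c) (map read_tape (snd c)) (cellc c p) ir il)"
  then have j: "j < kt" by (simp add: nxtc_def)
  let ?a = "snd (mv q (map read_tape ts)) ! j"
  have s: "cellc (step T c) p ! j = (fst (act ?a (ts ! j)) p, snd (act ?a (ts ! j)) = p)"
    using m w j by (subst cellc_nth) (auto simp: c step_mv)
  show "nxtc (fst c) (map read_tape (snd c)) (cellc c p) ir il ! j = cellc (step T c) p ! j"
    unfolding s using j w ir[OF j] il[OF j]
    by (cases "snd ?a") (auto simp: nxtc_def cellc_nth c act_eq)
qed

lemma cellc_cells: "wf_conf n c \<Longrightarrow> cellc c p \<in> cells"
  using wf_sym[of n c] by (auto simp: cells_def cellc_def wf_conf_def case_prod_unfold)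

lemma init_nth:
  assumes "j < kt"
  shows "snd (run T [x, u] 0) ! j = (if j = 0 then word_cells x else if j = 1 then word_cells u else word_cells [], 0)"
proof -
  obtain k where k: "kt = Suc (Suc k)" using two by (metis add_2_eq_Suc le_Suc_ex)
  show ?thesis using assms by (cases j rule: nat.exhaust; cases "j - 1") (auto simp: run_def init_config_def k)
qed

text \<open>The border tile of a row takes over the right colour of the row before it, cyclically,
  and the left colour of its own row. Both are calm, since no head crosses the edge of the window
  within \<open>R\<close> steps.\<close>

lemma accept_tiling:
  assumes u: "length u \<le> P" and acc: "fst (run T [x, u] R) = accept_state T" and R: "0 < R"
  shows "\<exists>g. tiling x P R g"
proof -
  define c where "c = run T [x, u]"
  have wf: "wf_conf n (c n)" for n unfolding c_def by (rule wf_run) (use two in simp)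
  have cS: "c (Suc n) = step T (c n)" for n by (simp add: c_def run_def)
  define rs where "rs t = map read_tape (snd (c t))" for t
  define hd where "hd t j = snd (snd (c t) ! j)" for t j
  define mm where "mm t j = snd (snd (mv (fst (c t)) (rs t)) ! j)" for t j
  have hdb: "\<bar>hd t j\<bar> \<le> int t" if "j < kt" for t j using wf[of t] that by (auto simp: wf_conf_def hd_def)
  define ir where "ir t p = map (\<lambda>j. hd t j = p - 1 \<and> mm t j = Rgt) [0..<kt]" for t p
  define il where "il t p = map (\<lambda>j. hd t j = p + 1 \<and> mm t j = Lft) [0..<kt]" for t p
  define ce where "ce t i = Cell (fst (c t)) (rs t) (cellc (c t) (pos R i)) (ir t (pos R i)) (il t (pos R i))" for t i
  \<comment> \<open>The left flag says that the position is at most \<open>length u\<close>, the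
    right flag that it is below; so the flags of adjacent tiles agree.\<close>
  define ini where "ini i = Ini (fst (c R)) (cellc (c R) (pos R i)) (cellc (c 0) (pos R i))
     (pos R i \<le> int (length u)) (pos R i < int (length u))" for i
  define row where "row t i = (if t = 0 then ini i else ce (t - 1) i)" for t i
  define g where "g t i = (if i = 0 then Bd (rcol (row (if t = 0 then R else t - 1) (2 * R + 1))) (lcol (row t 1))
     else row t i)" for t i
  have len: "length (snd (c t)) = kt" for t using wf[of t] by (simp add: wf_conf_def)
  have cn: "cellc (c t) p ! j = (fst (snd (c t) ! j) p, hd t j = p)" if "j < kt" for t p j
    using that len[of t] by (simp add: cellc_nth hd_def)
  have outs: "outs d (fst (c t)) (rs t) (cellc (c t) p) = map (\<lambda>j. hd t j = p \<and> mm t j = d) [0..<kt]" for d t p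
    unfolding outs_def by (rule map_cong) (auto simp: cn mm_def)
  have rss: "rs t \<in> symlists" for t using wf_read[OF wf[of t]] by (simp add: rs_def symlists_def)
  have bl: "map f [0..<kt] \<in> boollists" for f by (simp add: boollists_def)
  have ce_tile: "ce t i \<in> tiles" for t i
  proof -
    have "\<forall>j<kt. snd (cellc (c t) (pos R i) ! j) \<longrightarrow> fst (cellc (c t) (pos R i) ! j) = rs t ! j"
      using len[of t] by (auto simp: cn rs_def read_tape_eq hd_def)
    moreover have "fst (c t) < num_states T" using wf[of t] by (simp add: wf_conf_def)
    ultimately show ?thesis using rss cellc_cells[OF wf] bl
      by (simp add: tiles_def ce_def ir_def il_def)
  qed
  have ini_tile: "ini i \<in> tiles" for i
  proof -
    have "fst (c R) < num_states T" using wf[of R] by (simp add: wf_conf_def)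
    then show ?thesis using cellc_cells[OF wf] by (simp add: tiles_def ini_def)
  qed
  have row_tile: "row t i \<in> tiles" for t i using ce_tile ini_tile by (simp add: row_def)
  have lc: "lcol (ce t i) = Sig (rs t) (ir t (pos R i)) (map (\<lambda>j. hd t j = pos R i \<and> mm t j = Lft) [0..<kt])"
    and rc: "rcol (ce t i) = Sig (rs t) (map (\<lambda>j. hd t j = pos R i \<and> mm t j = Rgt) [0..<kt]) (il t (pos R i))" for t i
    by (simp_all add: ce_def outs)
  have lrs: "lr_ok (lcol (row t i))" "lr_ok (rcol (row t i))" for t i
    using rss bl by (auto simp: row_def lc rc ir_def il_def ini_def)
  have calm: "calm (lcol (row t 1))" "calm (rcol (row t (2 * R + 1)))" if "t \<le> R" for t
  proof -
    have ne: "hd (t - 1) j \<noteq> - int R - 1" "hd (t - 1) j \<noteq> - int R" "hd (t - 1) j \<noteq> int R" "hd (t - 1) j \<noteq> int R + 1"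
      if "t \<noteq> 0" "j < kt" for j
      using hdb[OF that(2), of "t - 1"] that(1) \<open>t \<le> R\<close> by linarith+
    show "calm (lcol (row t 1))" "calm (rcol (row t (2 * R + 1)))"
      using ne by (auto simp: row_def lc rc ir_def il_def ini_def)
  qed
  have horiz: "rcol (row t i) = lcol (row t (Suc i))" for t i
    by (auto simp: row_def ini_def lc rc ir_def il_def algebra_simps)
  have vert: "ucol (row t i) = dcol (row (if t < R then Suc t else 0) i)" if "t \<le> R" for t i
  proof (cases "t = 0")
    case True
    then show ?thesis using R by (simp add: row_def ini_def ce_def c_def run_def init_config_def)
  next
    case False
    then obtain s where s: "t = Suc s" by (cases t) auto
    have "nxtc (fst (c s)) (rs s) (cellc (c s) (pos R i)) (ir s (pos R i)) (il s (pos R i)) = cellc (step T (c s)) (pos R i)"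
      unfolding rs_def by (rule nxtc_step[OF wf]) (simp_all add: ir_def il_def hd_def mm_def rs_def)
    moreover have "fst (mv (fst (c s)) (rs s)) = fst (step T (c s))"
      using step_mv[of "fst (c s)" "snd (c s)"] by (simp add: rs_def)
    ultimately have "ucol (row t i) = Some (fst (c t), cellc (c t) (pos R i))"
      by (simp add: row_def s ce_def cS)
    then show ?thesis using that by (auto simp: row_def ce_def ini_def)
  qed
  have okrow: "okpos x P R t i (row t i)" if "t \<le> R" "i \<noteq> 0" for t i
  proof (cases "t = 0")
    case False
    then show ?thesis using that by (simp add: okpos_def ok_def row_def ce_def)
  next
    case True
    have c0: "cellc (c 0) p ! j = (if j = 0 then word_cells x p else if j = 1 then word_cells u p else word_cells [] p, p = 0)"
      if "j < kt" for j p
      using cn[OF that, of 0 p] init_nth[OF that, of x u] by (auto simp: c_def hd_def)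
    have k: "0 < kt" "1 < kt" using two by auto
    show ?thesis using True that acc u k unfolding okpos_def ok_def row_def ini_def
      by (auto simp: c0 c_def[symmetric] word_cells_def of_nat_diff split: if_splits)
  qed
  have "tiling x P R g"
    unfolding tiling_def
  proof (intro allI impI conjI)
    fix t i assume ti: "t \<le> R" "i < 2 * R + 2"
    show "g t i \<in> tiles" using row_tile lrs by (auto simp: g_def tiles_def)
    show "okpos x P R t i (g t i)"
    proof (cases "i = 0")
      case True
      have "(if t = 0 then R else t - 1) \<le> R" using ti by auto
      then show ?thesis using True calm ti by (simp add: g_def okpos_def ok_def)
    next
      case False
      then show ?thesis using okrow[OF ti(1)] by (simp add: g_def)
    qed
    show "rcol (g t i) = lcol (if Suc i < 2 * R + 2 then g t (Suc i) else if t < R then g (Suc t) 0 else g 0 0)"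
    proof (cases "Suc i < 2 * R + 2")
      case True
      then show ?thesis using horiz[of t i] by (auto simp: g_def)
    next
      case False
      then have "i = 2 * R + 1" using ti by simp
      then show ?thesis using ti by (auto simp: g_def)
    qed
    show "ucol (g t i) = dcol (if t < R then g (Suc t) i else g 0 i)"
      using vert[OF ti(1), of i] by (auto simp: g_def)
  qed
  then show ?thesis by blast
qed

text \<open>By induction on the rows, upper borders spell out the configurations of the run: guessed
  symbols are checked where the heads are, and heads enter a cell from its neighbours only. As the
  top row meets row 0, the last state is the accepting one.\<close>

lemma tiling_accept:
  assumes g: "tiling x P R g" and R: "0 < R"
  shows "\<exists>u. length u \<le> P \<and> fst (run T [x, u] R) = accept_state T"
proof -
  have tile: "tile_ok (g t i)" and okp: "okpos x P R t i (g t i)"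
    and hor: "rcol (g t i) = lcol (if Suc i < 2 * R + 2 then g t (Suc i) else if t < R then g (Suc t) 0 else g 0 0)"
    and ver: "ucol (g t i) = dcol (if t < R then g (Suc t) i else g 0 i)" if "t \<le> R" "i < 2 * R + 2" for t i
    using g that unfolding tiling_def tiles_def by blast+
  have bord: "calm (lcol (g t 0)) \<and> calm (rcol (g t 0))" if "t \<le> R" for t
    using okp[OF that, of 0] by (cases "g t 0") (auto simp: okpos_def ok_def)
  have k: "0 < kt" "1 < kt" using two by auto
  define S where "S i = fst (snd (the (ucol (g 0 i))) ! 1)" for i
  define b where "b i \<longleftrightarrow> rcol (g 0 i) = Flg True" for i
  have ini: "\<exists>cs cs' a. g 0 i = Ini (accept_state T) cs cs' a (b i) \<and> cs' \<in> cells \<and> S i = fst (cs' ! 1) \<and>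
      (\<forall>j<kt. snd (cs' ! j) = (i = R + 1)) \<and>
      fst (cs' ! 0) = (if i < R + 1 then 0 else word_cells x (int (i - (R + 1)))) \<and> (\<forall>j<kt. 2 \<le> j \<longrightarrow> fst (cs' ! j) = 0) \<and>
      (if i < R + 1 then a \<and> b i \<and> S i = 0 else if b i then a \<and> i - (R + 1) < P \<and> S i \<in> {1, 2} else S i = 0)"
    if "0 < i" "i < 2 * R + 2" for i
    using okp[of 0 i] tile[of 0 i] that
    by (cases "g 0 i") (auto simp: okpos_def ok_def S_def b_def simp del: One_nat_def split: if_splits)
  \<comment> \<open>At nonnegative positions \<open>b i\<close> says that cell \<open>i\<close>
    belongs to the certificate. A marked tile also demands the flag on its left border, so the marks
    form an initial segment.\<close>
  have mono: "b i" if h: "b (Suc i)" "0 < i" "Suc i < 2 * R + 2" "R + 1 \<le> Suc i" for i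
  proof -
    obtain cs cs' a where I: "g 0 (Suc i) = Ini (accept_state T) cs cs' a (b (Suc i))"
      and c: "if Suc i < R + 1 then a \<and> b (Suc i) \<and> S (Suc i) = 0
        else if b (Suc i) then a \<and> Suc i - (R + 1) < P \<and> S (Suc i) \<in> {1, 2} else S (Suc i) = 0"
      using ini[OF zero_less_Suc h(3)] by blast
    have a using c h by (auto split: if_splits)
    moreover have "i < 2 * R + 2" using h(3) by simp
    then obtain cs2 cs2' a2 where "g 0 i = Ini (accept_state T) cs2 cs2' a2 (b i)"
      using ini[OF h(2)] by blast
    ultimately show ?thesis using hor[of 0 i] h I by simp
  qed
  \<comment> \<open>The length of the marked stretch; it is \<open>R + 1\<close> if the marks reach
    the right end of the window.\<close>
  define l where "l = (LEAST k. k = R + 1 \<or> \<not> b (R + 1 + k))"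
  have l: "l = R + 1 \<or> \<not> b (R + 1 + l)" unfolding l_def by (rule LeastI[of _ "R + 1"]) simp
  have lR: "l \<le> R + 1" unfolding l_def by (rule Least_le) simp
  have below: "b (R + 1 + k)" if "k < l" for k
    using not_less_Least[of k "\<lambda>k. k = R + 1 \<or> \<not> b (R + 1 + k)"] that unfolding l_def by blast
  have above: "\<not> b (R + 1 + (l + m))" if "l + m \<le> R" for m
    using that
  proof (induction m)
    case 0
    then show ?case using l by simp
  next
    case (Suc m)
    then show ?case using mono[of "R + 1 + (l + m)"] by auto
  qed
  have lP: "l \<le> P"
  proof (cases l)
    case (Suc k)
    then show ?thesis using below[of k] ini[of "R + 1 + k"] lR by auto
  qed simp
  define u where "u = map (\<lambda>k. S (R + 1 + k) = 2) [0..<l]"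
  have uS: "word_cells u (pos R i) = S i" if i: "0 < i" "i < 2 * R + 2" for i
  proof (cases "i < R + 1")
    case True
    then show ?thesis using ini[OF i] by (auto simp: word_cells_def)
  next
    case False
    then obtain k where k: "i = R + 1 + k" using le_Suc_ex not_less by blast
    show ?thesis
    proof (cases "k < l")
      case True
      then have "S i \<in> {1, 2}" using below[OF True] ini[OF i] k by auto
      then show ?thesis using True by (auto simp: word_cells_def u_def k)
    next
      case False
      then have "\<not> b i" using above[of "k - l"] k i(2) by simp
      then have "S i = 0" using ini[OF i] by (auto split: if_splits)
      then show ?thesis using False by (simp add: word_cells_def u_def k)
    qed
  qed
  define c where "c = run T [x, u]"
  have wf: "wf_conf n (c n)" for n unfolding c_def by (rule wf_run) (use two in simp)
  have cS: "c (Suc n) = step T (c n)" for n by (simp add: c_def run_def)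
  have len: "length (snd (c t)) = kt" for t using wf[of t] by (simp add: wf_conf_def)
  have claim: "\<forall>i. 0 < i \<and> i < 2 * R + 2 \<longrightarrow> ucol (g t i) = Some (fst (c t), cellc (c t) (pos R i))" if "t \<le> R" for t
    using that
  proof (induction t)
    case 0
    show ?case
    proof (intro allI impI, elim conjE)
      fix i assume i: "0 < i" "i < 2 * R + 2"
      obtain cs cs' a where I: "g 0 i = Ini (accept_state T) cs cs' a (b i)" "cs' \<in> cells" "S i = fst (cs' ! 1)"
        "\<forall>j<kt. snd (cs' ! j) = (i = R + 1)"
        "fst (cs' ! 0) = (if i < R + 1 then 0 else word_cells x (int (i - (R + 1))))" "\<forall>j<kt. 2 \<le> j \<longrightarrow> fst (cs' ! j) = 0"
        using ini[OF i] by blast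
      have "cs' = cellc (c 0) (pos R i)"
      proof (rule nth_equalityI)
        show "length cs' = length (cellc (c 0) (pos R i))" using I(2) len by (simp add: cells_def length_cellc)
        fix j assume "j < length cs'"
        then have j: "j < kt" using I(2) by (simp add: cells_def)
        have "cellc (c 0) (pos R i) ! j = (if j = 0 then word_cells x (pos R i) else if j = 1 then word_cells u (pos R i)
            else word_cells [] (pos R i), pos R i = 0)"
          using j len[of 0] init_nth[OF j, of x u] by (auto simp: cellc_nth c_def)
        moreover have "word_cells x (pos R i) = fst (cs' ! 0)"
          unfolding I(5) by (auto simp: word_cells_def of_nat_diff)
        moreover have "word_cells u (pos R i) = fst (cs' ! 1)" using uS[OF i] I(3) by simp
        moreover have "snd (cs' ! j) = (pos R i = 0)" using I(4) j by auto
        moreover have "j \<noteq> 0 \<Longrightarrow> j \<noteq> 1 \<Longrightarrow> fst (cs' ! j) = word_cells [] (pos R i)" using I(6) j by (simp add: word_cells_def)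
        ultimately show "cs' ! j = cellc (c 0) (pos R i) ! j" by (auto simp: prod_eq_iff)
      qed
      then show "ucol (g 0 i) = Some (fst (c 0), cellc (c 0) (pos R i))"
        by (simp add: I(1) c_def run_def init_config_def)
    qed
  next
    case (Suc t)
    define q where "q = fst (c t)"
    define cs where "cs i = cellc (c t) (pos R i)" for i
    define hd where "hd j = snd (snd (c t) ! j)" for j
    \<comment> \<open>The bound is strict because row \<open>Suc t\<close> makes the step from time
      \<open>t < R\<close>. So every head has a column of its own, and none leaves the
      window.\<close>
    have hdb: "\<bar>hd j\<bar> < int R" if "j < kt" for j
      using wf[of t] that Suc.prems by (auto simp: wf_conf_def hd_def)
    have cn: "cs i ! j = (fst (snd (c t) ! j) (pos R i), hd j = pos R i)" if "j < kt" for i j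
      using that len[of t] by (simp add: cs_def cellc_nth hd_def)
    define rs where "rs i = (case g (Suc t) i of Cell q rs cs ir il \<Rightarrow> rs)" for i
    define ir where "ir i = (case g (Suc t) i of Cell q rs cs ir il \<Rightarrow> ir)" for i
    define il where "il i = (case g (Suc t) i of Cell q rs cs ir il \<Rightarrow> il)" for i
    have ce: "g (Suc t) i = Cell q (rs i) (cs i) (ir i) (il i)" if i: "0 < i" "i < 2 * R + 2" for i
    proof -
      have "dcol (g (Suc t) i) = Some (q, cs i)"
        using ver[of t i] Suc i by (simp add: q_def cs_def)
      then show ?thesis using okp[of "Suc t" i] Suc.prems i
        by (cases "g (Suc t) i") (auto simp: okpos_def ok_def rs_def ir_def il_def)
    qed
    have tk: "rs i \<in> symlists" "ir i \<in> boollists" "il i \<in> boollists" "\<And>j. j < kt \<Longrightarrow> snd (cs i ! j) \<Longrightarrow> fst (cs i ! j) = rs i ! j"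
      if i: "0 < i" "i < 2 * R + 2" for i
      using tile[of "Suc t" i] Suc.prems i ce[OF i] by auto
    have nb: "rs i = rs (Suc i)" "ir (Suc i) = outs Rgt q (rs i) (cs i)" "il i = outs Lft q (rs (Suc i)) (cs (Suc i))"
      if i: "0 < i" "Suc i < 2 * R + 2" for i
      using hor[of "Suc t" i] Suc.prems i ce[of i] ce[of "Suc i"] by auto
    have rs1: "rs i = rs 1" if "0 < i" "i < 2 * R + 2" for i
      using that
    proof (induction i)
      case (Suc i)
      then show ?case using nb(1)[of i] by (cases "i = 0") auto
    qed simp
    have rs: "rs i = map read_tape (snd (c t))" if i: "0 < i" "i < 2 * R + 2" for i
    proof (rule nth_equalityI)
      show "length (rs i) = length (map read_tape (snd (c t)))" using tk(1)[OF i] len by (simp add: symlists_def)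
      fix j assume "j < length (rs i)"
      then have j: "j < kt" using tk(1)[OF i] by (simp add: symlists_def)
      let ?i = "nat (hd j + int (R + 1))"
      have i': "0 < ?i" "?i < 2 * R + 2" "pos R ?i = hd j" using hdb[OF j] by auto
      then have "fst (cs ?i ! j) = rs ?i ! j" using tk(4)[OF i'(1,2) j] cn[OF j, of ?i] by simp
      then show "rs i ! j = map read_tape (snd (c t)) ! j"
        using rs1[OF i] rs1[OF i'(1,2)] cn[OF j, of ?i] i'(3) j len[of t] by (simp add: read_tape_eq hd_def)
    qed
    show ?case
    proof (intro allI impI, elim conjE)
      fix i assume i: "0 < i" "i < 2 * R + 2"
      let ?rs = "map read_tape (snd (c t))"
      have noT: "\<not> bs ! j" if "bs \<in> boollists" "True \<notin> set bs" "j < kt" for bs j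
        using that by (auto simp: boollists_def in_set_conv_nth)
      have r: "ir i ! j = (hd j = pos R i - 1 \<and> snd (snd (mv q ?rs) ! j) = Rgt)" if j: "j < kt" for j
      proof (cases "i = 1")
        case True
        have "rcol (g (Suc t) 0) = lcol (g (Suc t) 1)" using hor[of "Suc t" 0] Suc.prems R by simp
        then have "True \<notin> set (ir 1)" using bord[OF Suc.prems] ce[of 1] i True by auto
        then have "\<not> ir i ! j" using noT tk(2)[OF i] True j by auto
        then show ?thesis using hdb[OF j] True by auto
      next
        case False
        then obtain i' where i': "i = Suc i'" "0 < i'" using i(1) by (cases i) auto
        then show ?thesis using nb(2)[of i'] i j cn[OF j, of i'] rs[of i'] by (simp add: outs_def algebra_simps)
      qed
      have l: "il i ! j = (hd j = pos R i + 1 \<and> snd (snd (mv q ?rs) ! j) = Lft)" if j: "j < kt" for j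
      proof (cases "Suc i < 2 * R + 2")
        case False
        then have i2: "i = 2 * R + 1" using i(2) by simp
        have "calm (rcol (g (Suc t) i))"
          using hor[OF Suc.prems i(2)] i2 bord[of "Suc (Suc t)"] bord[of 0] Suc.prems by (auto split: if_splits)
        then have "\<not> il i ! j" using noT tk(3)[OF i] ce[OF i] j by auto
        then show ?thesis using hdb[OF j] i2 by auto
      next
        case True
        then show ?thesis using nb(3)[OF i(1) True] j cn[OF j, of "Suc i"] rs[of "Suc i"] by (simp add: outs_def algebra_simps)
      qed
      have "nxtc q ?rs (cs i) (ir i) (il i) = cellc (step T (c t)) (pos R i)"
        unfolding q_def cs_def by (rule nxtc_step[OF wf]) (use r l in \<open>simp_all add: q_def hd_def\<close>)
      moreover have "fst (mv q ?rs) = fst (step T (c t))"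
        using step_mv[of "fst (c t)" "snd (c t)"] by (simp add: q_def)
      ultimately show "ucol (g (Suc t) i) = Some (fst (c (Suc t)), cellc (c (Suc t)) (pos R i))"
        using ce[OF i] rs[OF i] by (simp add: cS)
    qed
  qed
  have "ucol (g R 1) = Some (fst (c R), cellc (c R) (pos R 1))" using claim[of R] by simp
  moreover have "ucol (g R 1) = dcol (g 0 1)" using ver[of R 1] by simp
  ultimately have "fst (c R) = accept_state T" using ini[of 1] by auto
  then show ?thesis using lP by (intro exI[of _ u]) (simp add: c_def u_def)
qed

end

section \<open>The line graph of the gadget graph\<close>

lemma code_inj:
  assumes "a < m" "b < m" "z * m + a = y * m + (b::nat)"
  shows "z = y \<and> a = b"
proof -
  have "(z * m + a) div m = z" "(z * m + a) mod m = a" "(y * m + b) div m = y" "(y * m + b) mod m = b"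
    using assms(1,2) by simp_all
  then show ?thesis using assms(3) by metis
qed

context gadget begin

lemma noeven_iff_sol: "(\<exists>F\<subseteq>E. noeven F \<and> card Vs \<le> card F) \<longleftrightarrow> (\<exists>f. sol f)"
proof
  assume "\<exists>F\<subseteq>E. noeven F \<and> card Vs \<le> card F"
  then obtain F where F: "F \<subseteq> E" "noeven F" "card Vs \<le> card F" by blast
  have "finite E" using E_Vs finite_Vs by (meson Sup_upper finite_UnionD finite_subset)
  then have fF: "finite F" using F(1) finite_subset by blast
  obtain C where C: "oc F C" using noeven_oc[OF fF _ F(2)] E_card F(1) by blast
  have "\<Union>F \<subseteq> Vs" using E_Vs F(1) by blast
  then have "C = Vs" using oc_full[OF C finite_Vs _ F(3)] by blast
  then show "\<exists>f. sol f" using two_factor_sol[OF F(1) oc_regular(1)[OF C] oc_regular(2)[OF C]] by blast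
next
  assume "\<exists>f. sol f"
  then obtain f where "sol f" by blast
  then obtain F C where F: "F \<subseteq> E" "oc F C" "card Vs \<le> card F" using sol_two_factor by blast
  then show "\<exists>F\<subseteq>E. noeven F \<and> card Vs \<le> card F" using oc_noeven[OF F(2)] by blast
qed

text \<open>The names of edges in a single cell. They are the same for all cells and for all
  \<open>N\<close> and \<open>A\<close>, so that their number is a constant of the
  reduction.\<close>

definition LE :: "ed set" where "LE = {\<epsilon>. okE \<epsilon>}"
definition LV :: "vx set" where "LV = {\<alpha>. okV \<alpha>}"
definition E0 :: nat where "E0 = card LE"
definition V0 :: nat where "V0 = card LV"
definition els :: "nat \<Rightarrow> ed" where "els = from_nat_into LE"
definition num :: "vx \<Rightarrow> nat" where "num = to_nat_on LV"

lemma finite_LE: "finite LE"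
proof -
  have "LE \<subseteq> (\<lambda>(i, v). EP i v) ` ({..<5} \<times> {..<Q}) \<union> ES ` {..<Q} \<union> ET ` {..<Q} \<union> (\<lambda>(v, h). EW v h) ` ({..<Q} \<times> {..<M})
     \<union> (\<lambda>(i, v, h). EH i v h) ` ({..<6} \<times> {..<Q} \<times> {..<M}) \<union> (\<lambda>(i, v, h). EL i v h) ` ({..<4} \<times> {..<Q} \<times> {..<M})"
  proof
    fix \<epsilon> assume "\<epsilon> \<in> LE"
    then show "\<epsilon> \<in> (\<lambda>(i, v). EP i v) ` ({..<5} \<times> {..<Q}) \<union> ES ` {..<Q} \<union> ET ` {..<Q} \<union> (\<lambda>(v, h). EW v h) ` ({..<Q} \<times> {..<M})
     \<union> (\<lambda>(i, v, h). EH i v h) ` ({..<6} \<times> {..<Q} \<times> {..<M}) \<union> (\<lambda>(i, v, h). EL i v h) ` ({..<4} \<times> {..<Q} \<times> {..<M})"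
      by (cases \<epsilon>) (auto simp: LE_def image_iff)
  qed
  then show ?thesis by (rule finite_subset) auto
qed

lemma bij_els: "bij_betw els {..<E0} LE"
  unfolding els_def E0_def by (rule bij_betw_from_nat_into_finite[OF finite_LE])

lemma els_ok: "i < E0 \<Longrightarrow> okE (els i)"
  using bij_els by (auto simp: bij_betw_def LE_def)

lemma bij_num: "bij_betw num LV {..<V0}"
  unfolding num_def V0_def LV_def by (rule to_nat_on_finite[OF finite_okV])

lemma num_less: "okV \<alpha> \<Longrightarrow> num \<alpha> < V0"
  using bij_num by (auto simp: bij_betw_def LV_def)

lemma card_Vs: "card Vs = N * V0"
  unfolding Vs_def V0_def LV_def by (simp add: card_cartesian_product)

text \<open>It guarantees that \<open>n - N * V0\<close> is a true difference: deleting at most so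
  many edges is the same as keeping at least \<open>card Vs\<close> of them.\<close>

lemma V0_le_E0: "V0 \<le> E0"
proof -
  define i where "i \<alpha> = (case \<alpha> of El j \<Rightarrow> EL 1 0 j | Pn i v \<Rightarrow> EP i v | Wv v h \<Rightarrow> EL 0 v h | Hx i v h \<Rightarrow> EH i v h)" for \<alpha>
  have "inj i" by (rule injI) (auto simp: i_def split: vx.splits)
  then have "inj_on i LV" by (rule inj_on_subset) simp
  moreover have "i ` LV \<subseteq> LE" using pos by (auto simp: i_def LV_def LE_def split: vx.splits)
  ultimately show ?thesis unfolding V0_def E0_def by (rule card_inj_on_le[OF _ _ finite_LE])
qed

lemma E0_pos: "0 < E0"
proof -
  have "ES 0 \<in> LE" using pos by (simp add: LE_def)
  then show ?thesis unfolding E0_def using finite_LE card_gt_0_iff by blast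
qed

definition n :: nat where "n = N * E0"

definition edg :: "nat \<Rightarrow> (nat \<times> vx) set" where
  "edg e = {end1 (e div E0) (els (e mod E0)), end2 (e div E0) (els (e mod E0))}"

lemma div_less: "e < n \<Longrightarrow> e div E0 < N" and mod_less: "e mod E0 < E0"
  using E0_pos by (auto simp: n_def less_mult_imp_div_less)

lemma inj_edg: "inj_on edg {..<n}"
proof (rule inj_onI)
  fix e f assume ef: "e \<in> {..<n}" "f \<in> {..<n}" "edg e = edg f"
  then have "e div E0 = f div E0 \<and> els (e mod E0) = els (f mod E0)"
    using div_less mod_less els_ok unfolding edg_def by (intro ends_inj) auto
  moreover from this have "e mod E0 = f mod E0"
    using bij_els mod_less by (auto simp: bij_betw_def inj_on_def)
  ultimately show "e = f" by (metis div_mult_mod_eq)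
qed

lemma edg_image: "edg ` {..<n} = E"
proof
  show "edg ` {..<n} \<subseteq> E" using E_I div_less mod_less els_ok by (auto simp: edg_def)
  show "E \<subseteq> edg ` {..<n}"
  proof
    fix d assume "d \<in> E"
    then obtain z \<epsilon> where d: "d = {end1 z \<epsilon>, end2 z \<epsilon>}" "z < N" "okE \<epsilon>" unfolding E_def by blast
    have "\<epsilon> \<in> els ` {..<E0}" using bij_els d(3) by (simp add: bij_betw_def LE_def)
    then obtain i where i: "i < E0" "els i = \<epsilon>" by blast
    have "z * E0 + i < n" using d(2) i(1) mult_le_mono1[of "Suc z" N E0] by (simp add: n_def)
    moreover have "edg (z * E0 + i) = d" using i d by (simp add: edg_def)
    ultimately show "d \<in> edg ` {..<n}" by blast
  qed
qed

definition vnum :: "nat \<times> vx \<Rightarrow> nat" where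
  "vnum = (\<lambda>(z, \<alpha>). z * V0 + num \<alpha>)"

lemma inj_vnum: "inj_on vnum Vs"
proof (rule inj_onI)
  fix p q assume "p \<in> Vs" "q \<in> Vs" "vnum p = vnum q"
  moreover obtain z \<alpha> y \<beta> where pq: "p = (z, \<alpha>)" "q = (y, \<beta>)" by (cases p; cases q)
  ultimately have "okV \<alpha>" "okV \<beta>" "z * V0 + num \<alpha> = y * V0 + num \<beta>" by (auto simp: Vs_def vnum_def)
  then have "z = y" "num \<alpha> = num \<beta>" using code_inj num_less by blast+
  moreover have "\<alpha> = \<beta>" using bij_num \<open>okV \<alpha>\<close> \<open>okV \<beta>\<close> calculation(2) by (auto simp: bij_betw_def inj_on_def LV_def)
  ultimately show "p = q" using pq by simp
qed

text \<open>Tells how far the second end of an edge is shifted: 0 for the same cell, 1 for the next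
  cell, 2 for the cell \<open>W\<close> places on.\<close>

definition cls :: "ed \<Rightarrow> nat" where
  "cls \<epsilon> = (case \<epsilon> of EL s v h \<Rightarrow> if s < 2 then 0 else if h = 2 + lf v then 1 else if h = K + 2 + dn v then 2 else 0 | _ \<Rightarrow> 0)"

definition alt :: "bool \<Rightarrow> ed \<Rightarrow> vx" where
  "alt b \<epsilon> = (case \<epsilon> of EP i v \<Rightarrow> Pn (if i = 4 then 0 else Suc i) v
     | ES v \<Rightarrow> if b then Wv v 0 else Pn 2 v | ET v \<Rightarrow> Wv v (M - 1) | EW v h \<Rightarrow> Wv v (Suc h)
     | EH i v h \<Rightarrow> Hx (if i = 5 then 0 else Suc i) v h
     | EL s v h \<Rightarrow> if s < 2 then Wv v h else El (if h = 2 + lf v then 2 + rt v else if h = K + 2 + dn v then K + 2 + up v else h))"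

definition spv :: "ed \<Rightarrow> nat" where
  "spv \<epsilon> = (case \<epsilon> of ES v \<Rightarrow> v | _ \<Rightarrow> 0)"

lemma end2_alt:
  assumes "z < N"
  shows "end2 z \<epsilon> = ((z + (if cls \<epsilon> = 0 then 0 else if cls \<epsilon> = 1 then 1 else W)) mod N, alt (A z (spv \<epsilon>)) \<epsilon>)"
  using assms by (cases \<epsilon>) (auto simp: cls_def alt_def spv_def elm_def sl_def)

lemma end1_fst: "end1 z \<epsilon> = (z, snd (end1 0 \<epsilon>))"
  by (cases \<epsilon>) auto

text \<open>Shifting a cell shifts its edges, so that up to the cell number and the test \<open>A\<close> the ends of an edge
  are given by tables of constant size.\<close>

definition T1 :: "nat \<Rightarrow> nat" where "T1 i = num (snd (end1 0 (els i)))"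
definition T2 :: "nat \<Rightarrow> nat" where "T2 i = num (alt True (els i))"
definition T3 :: "nat \<Rightarrow> nat" where "T3 i = num (alt False (els i))"
definition TC :: "nat \<Rightarrow> nat" where "TC i = cls (els i)"
definition TS :: "nat \<Rightarrow> nat" where "TS i = spv (els i)"

lemma TS_less: "i < E0 \<Longrightarrow> TS i < Q"
  using els_ok[of i] pos by (auto simp: TS_def spv_def split: ed.splits)

definition code1 :: "nat \<Rightarrow> nat" where
  "code1 e = e div E0 * V0 + T1 (e mod E0)"

definition code2 :: "nat \<Rightarrow> nat" where
  "code2 e = (e div E0 + (if TC (e mod E0) = 0 then 0 else if TC (e mod E0) = 1 then 1 else W)) mod N * V0 +
     (if A (e div E0) (TS (e mod E0)) then T2 (e mod E0) else T3 (e mod E0))"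

definition adjn :: "nat \<Rightarrow> nat \<Rightarrow> bool" where
  "adjn i j \<longleftrightarrow> i \<noteq> j \<and> (code1 i = code1 j \<or> code1 i = code2 j \<or> code2 i = code1 j \<or> code2 i = code2 j)"

lemma vnum_edg: "e < n \<Longrightarrow> vnum ` edg e = {code1 e, code2 e}"
proof -
  assume e: "e < n"
  let ?z = "e div E0" and ?\<epsilon> = "els (e mod E0)"
  have "vnum (end1 ?z ?\<epsilon>) = code1 e"
    by (subst end1_fst) (simp add: vnum_def code1_def T1_def)
  moreover have "vnum (end2 ?z ?\<epsilon>) = code2 e"
    unfolding end2_alt[OF div_less[OF e]]
    by (simp add: vnum_def code2_def T2_def T3_def TC_def TS_def)
  ultimately show ?thesis by (simp add: edg_def)
qed

definition gr :: "nat ugraph" where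
  "gr = \<lparr>verts = {..<n}, edges = {{i, j} | i j. i < n \<and> j < n \<and> adjn i j}\<rparr>"

lemma gr_edge: "i < n \<Longrightarrow> j < n \<Longrightarrow> {i, j} \<in> edges gr \<longleftrightarrow> adjn i j"
  by (auto simp: gr_def doubleton_eq_iff adjn_def)

lemma edg_Vs: "e < n \<Longrightarrow> edg e \<subseteq> Vs"
  using edg_image E_Vs by blast

lemma adjn_edg:
  assumes "i < n" "j < n"
  shows "adjn i j \<longleftrightarrow> i \<noteq> j \<and> edg i \<inter> edg j \<noteq> {}" "adjn i j \<longleftrightarrow> i \<noteq> j \<and> vnum ` edg i \<inter> vnum ` edg j \<noteq> {}"
proof -
  show 2: "adjn i j \<longleftrightarrow> i \<noteq> j \<and> vnum ` edg i \<inter> vnum ` edg j \<noteq> {}"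
    unfolding vnum_edg[OF assms(1)] vnum_edg[OF assms(2)] adjn_def by blast
  have "vnum ` edg i \<inter> vnum ` edg j = vnum ` (edg i \<inter> edg j)"
    using inj_on_image_Int[OF inj_vnum edg_Vs edg_Vs] assms by simp
  then show "adjn i j \<longleftrightarrow> i \<noteq> j \<and> edg i \<inter> edg j \<noteq> {}" using 2 by simp
qed

lemma gr_simple: "simple_graph gr" "verts gr = {..<card (verts gr)}"
  by (auto simp: simple_graph_def gr_def adjn_def card_insert_if)

lemma gr_line: "is_line_graph gr"
proof (rule line_graphI[of "\<lambda>e. vnum ` edg e" n])
  show "inj_on (\<lambda>e. vnum ` edg e) {..<n}"
  proof (rule inj_onI)
    fix e f assume ef: "e \<in> {..<n}" "f \<in> {..<n}" "vnum ` edg e = vnum ` edg f"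
    then have "edg e = edg f" using inj_on_image_eq_iff[OF inj_vnum edg_Vs edg_Vs] by simp
    then show "e = f" using inj_onD[OF inj_edg] ef by blast
  qed
  show "card (vnum ` edg e) = 2" if "e < n" for e
    using card_image[OF inj_on_subset[OF inj_vnum edg_Vs[OF that]]] E_card edg_image that by auto
  show "{i, j} \<in> edges gr \<longleftrightarrow> i \<noteq> j \<and> vnum ` edg i \<inter> vnum ` edg j \<noteq> {}" if "i < n" "j < n" for i j
    using gr_edge adjn_edg(2) that by simp
qed (simp add: gr_def)

lemma gr_iff_sol: "(\<exists>S. even_cycle_transversal gr S \<and> card S \<le> n - N * V0) \<longleftrightarrow> (\<exists>f. sol f)"
proof -
  have le: "card Vs \<le> n" using V0_le_E0 by (simp add: card_Vs n_def)
  have ect: "even_cycle_transversal gr S \<longleftrightarrow> noeven (edg ` ({..<n} - S))" if "S \<subseteq> {..<n}" for S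
    by (rule ect_noeven[OF inj_edg _ _ that]) (simp_all add: gr_edge adjn_edg(1), simp add: gr_def)
  have cd: "card (edg ` ({..<n} - S)) = n - card S" if S: "S \<subseteq> {..<n}" for S
  proof -
    have "card (edg ` ({..<n} - S)) = card ({..<n} - S)"
      by (rule card_image) (rule inj_on_subset[OF inj_edg], blast)
    then show ?thesis using S by (simp add: card_Diff_subset finite_subset)
  qed
  have "(\<exists>S. even_cycle_transversal gr S \<and> card S \<le> n - N * V0) \<longleftrightarrow> (\<exists>F\<subseteq>E. noeven F \<and> card Vs \<le> card F)"
  proof
    assume "\<exists>S. even_cycle_transversal gr S \<and> card S \<le> n - N * V0"
    then obtain S where S: "even_cycle_transversal gr S" "card S \<le> n - card Vs" by (auto simp: card_Vs)
    have Sn: "S \<subseteq> {..<n}" using S(1) by (simp add: even_cycle_transversal_def gr_def)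
    have "edg ` ({..<n} - S) \<subseteq> E" using edg_image by blast
    moreover have "card Vs \<le> card (edg ` ({..<n} - S))" using cd[OF Sn] S(2) le by simp
    ultimately show "\<exists>F\<subseteq>E. noeven F \<and> card Vs \<le> card F" using ect[OF Sn] S(1) by blast
  next
    assume "\<exists>F\<subseteq>E. noeven F \<and> card Vs \<le> card F"
    then obtain F where F: "F \<subseteq> E" "noeven F" "card Vs \<le> card F" by blast
    define S where "S = {e. e < n \<and> edg e \<notin> F}"
    have Sn: "S \<subseteq> {..<n}" by (auto simp: S_def)
    have im: "edg ` ({..<n} - S) = F"
    proof
      show "F \<subseteq> edg ` ({..<n} - S)"
      proof
        fix d assume d: "d \<in> F"
        then have "d \<in> edg ` {..<n}" using F(1) edg_image by blast
        then obtain e where "e < n" "d = edg e" by blast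
        then show "d \<in> edg ` ({..<n} - S)" using d by (auto simp: S_def)
      qed
    qed (auto simp: S_def)
    have "card S \<le> n" using card_mono[OF _ Sn] by simp
    then have "card S \<le> n - card Vs" using cd[OF Sn] F(3) unfolding im by simp
    then show "\<exists>S. even_cycle_transversal gr S \<and> card S \<le> n - N * V0"
      using ect[OF Sn] F(2) unfolding im card_Vs by blast
  qed
  then show ?thesis using noeven_iff_sol by blast
qed

end

section \<open>NP-hardness\<close>

text \<open>The powers of two, expressed without exponentiation: all divisors except 1 are
  even.\<close>

definition pow2 :: "nat \<Rightarrow> bool" where
  "pow2 r \<longleftrightarrow> 0 < r \<and> (\<forall>d<Suc r. r mod d = 0 \<longrightarrow> d \<noteq> 1 \<longrightarrow> d mod 2 = 0)"

lemma pow2_double: "0 < r \<Longrightarrow> pow2 (2 * r) \<longleftrightarrow> pow2 r"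
proof
  assume r: "0 < r" and p: "pow2 (2 * r)"
  show "pow2 r" unfolding pow2_def
  proof (intro conjI allI impI)
    fix d assume d: "d < Suc r" "r mod d = 0" "d \<noteq> 1"
    then have "2 * r mod d = 0" by auto
    then show "d mod 2 = 0" using p d unfolding pow2_def by auto
  qed (rule r)
next
  assume r: "0 < r" and p: "pow2 r"
  show "pow2 (2 * r)" unfolding pow2_def
  proof (intro conjI allI impI)
    fix d assume d: "d < Suc (2 * r)" "2 * r mod d = 0" "d \<noteq> 1"
    show "d mod 2 = 0"
    proof (rule ccontr)
      assume "d mod 2 \<noteq> 0"
      then have "coprime d 2" by (simp add: even_iff_mod_2_eq_zero[symmetric])
      moreover have "d dvd 2 * r" using d(2) by auto
      ultimately have "d dvd r" using coprime_dvd_mult_right_iff by blast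
      then have "r mod d = 0" "d < Suc r" using r dvd_imp_le[of d r] by auto
      then show False using p[unfolded pow2_def, THEN conjunct2, rule_format, of d] d(3) \<open>d mod 2 \<noteq> 0\<close> by simp
    qed
  qed (use r in simp)
qed

lemma pow2_odd: "odd r \<Longrightarrow> pow2 r \<longleftrightarrow> r = 1"
proof
  assume "odd r" "pow2 r"
  then show "r = 1" unfolding pow2_def by (auto dest!: spec[of _ r] simp: even_iff_mod_2_eq_zero)
qed (auto simp: pow2_def)

text \<open>The powers of two up to \<open>k\<close> correspond to the bits of \<open>k\<close>,
  lowest first. Searching all \<open>r\<close> up to \<open>k\<close> is affordable because the
  budgets produced by the reduction are polynomial in the input length.\<close>

lemma binary_pow2:
  "binary k = concat (map (\<lambda>r. if pow2 r then [odd (k div r)] else []) [1..<Suc k])"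
proof (induction k rule: less_induct)
  case (less k)
  have cm: "concat (map (\<lambda>r. if P r then [f r] else []) xs) = map f (filter P xs)" for P f and xs :: "nat list"
    by (induction xs) auto
  show ?case
  proof (cases "k = 0")
    case True
    then show ?thesis by (simp add: binary.simps)
  next
    case False
    let ?h = "k div 2"
    have "filter pow2 [1..<Suc k] = 1 # map ((*) 2) (filter pow2 [1..<Suc ?h])"
    proof (rule sorted_distinct_set_unique)
      show "sorted (filter pow2 [1..<Suc k])" by (rule sorted_filter[of "\<lambda>x. x", simplified]) (simp del: upt_Suc)
      show "sorted (1 # map ((*) 2) (filter pow2 [1..<Suc ?h]))"
        by (auto simp: sorted_map simp del: upt_Suc intro!: sorted_wrt_mono_rel[OF _ sorted_filter[of "\<lambda>x. x", simplified]])
      show "distinct (1 # map ((*) 2) (filter pow2 [1..<Suc ?h]))"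
        by (auto simp: distinct_map inj_on_def simp del: upt_Suc)
      show "set (filter pow2 [1..<Suc k]) = set (1 # map ((*) 2) (filter pow2 [1..<Suc ?h]))"
      proof (intro set_eqI iffI)
        fix r assume "r \<in> set (filter pow2 [1..<Suc k])"
        then have r: "pow2 r" "0 < r" "r \<le> k" by auto
        show "r \<in> set (1 # map ((*) 2) (filter pow2 [1..<Suc ?h]))"
        proof (cases "even r")
          case True
          then obtain q where q: "r = 2 * q" by blast
          then have "0 < q" "q \<le> ?h" "pow2 q" using r pow2_double[of q] by auto
          then have "q \<in> set (filter pow2 [1..<Suc ?h])" by (simp del: upt_Suc)
          then show ?thesis using q by (simp del: upt_Suc)
        next
          case False
          then show ?thesis using r pow2_odd by auto
        qed
      next
        fix r assume "r \<in> set (1 # map ((*) 2) (filter pow2 [1..<Suc ?h]))"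
        then consider "r = 1" | q where "r = 2 * q" "pow2 q" "0 < q" "q \<le> ?h" by auto
        then show "r \<in> set (filter pow2 [1..<Suc k])"
        proof cases
          case 1
          then show ?thesis using False pow2_odd[of 1] by (simp del: upt_Suc)
        next
          case 2
          then show ?thesis using pow2_double[of q] by auto
        qed
      qed
    qed (simp del: upt_Suc)
    then have "map (\<lambda>r. odd (k div r)) (filter pow2 [1..<Suc k])
       = odd k # map (\<lambda>r. odd (?h div r)) (filter pow2 [1..<Suc ?h])"
      by (simp add: div_mult2_eq comp_def del: upt_Suc)
    moreover have "binary k = odd k # binary ?h" using False by (subst binary.simps) simp
    moreover have "?h < k" using False by simp
    ultimately show ?thesis using less[of ?h] unfolding cm by simp
  qed
qed

text \<open>The positions after the adjacency matrix are the numbers \<open>r\<close> from 1 to \<open>k\<close>; the powers of two among them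
  emit the bits of \<open>k\<close>.\<close>

definition outcode :: "nat \<Rightarrow> (nat \<Rightarrow> nat \<Rightarrow> bool) \<Rightarrow> nat \<Rightarrow> nat \<Rightarrow> nat" where
  "outcode n ad k p = (if p < n then 2 else if p = n then 1
     else if p < Suc n + n * n then 1 + of_bool (ad ((p - Suc n) div n) ((p - Suc n) mod n))
     else if pow2 (p - (n + n * n)) then 1 + of_bool (k div (p - (n + n * n)) mod 2 = 1) else 0)"

lemma emit_of_bool: "emit (1 + of_bool b) = [b]" by (simp add: emit_def)

lemma upt_shift: "[a..<a + m] = map (\<lambda>i. i + a) [0..<m]"
  by (simp add: map_add_upt add.commute)

lemma encode_concat:
  assumes G: "card (verts G) = n" and ad: "\<And>i j. i < n \<Longrightarrow> j < n \<Longrightarrow> {i, j} \<in> edges G \<longleftrightarrow> ad i j"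
  shows "encode_instance G k = concat (map (\<lambda>p. emit (outcode n ad k p)) [0..<Suc n + n * n + k])"
proof -
  let ?f = "\<lambda>p. emit (outcode n ad k p)"
  have s: "[0..<Suc n + n * n + k] = [0..<n] @ [n] @ [Suc n..<Suc n + n * n] @ [Suc n + n * n..<Suc n + n * n + k]"
    using upt_add_eq_append[of 0 "Suc n + n * n" k] upt_add_eq_append[of 0 "Suc n" "n * n"] by simp
  have "concat (map ?f [0..<n]) = concat (map (\<lambda>p. [True]) [0..<n])"
    by (intro arg_cong[where f = concat] map_cong) (auto simp: outcode_def emit_def)
  then have 1: "concat (map ?f [0..<n]) = replicate n True" by (simp add: map_replicate_const)
  have 2: "?f n = [False]" by (simp add: outcode_def emit_def)
  have "concat (map ?f [Suc n..<Suc n + n * n]) = concat (map (\<lambda>p. [ad (p div n) (p mod n)]) [0..<n * n])"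
    unfolding upt_shift map_map
  proof (intro arg_cong[where f = concat] map_cong refl)
    fix p assume "p \<in> set [0..<n * n]"
    then have "outcode n ad k (p + Suc n) = 1 + of_bool (ad (p div n) (p mod n))" by (simp add: outcode_def)
    then show "((\<lambda>p. emit (outcode n ad k p)) \<circ> (\<lambda>i. i + Suc n)) p = [ad (p div n) (p mod n)]"
      by (simp only: comp_apply emit_of_bool)
  qed
  also have "\<dots> = concat (map (\<lambda>i. map (\<lambda>j. {i, j} \<in> edges G) [0..<n]) [0..<n])"
  proof -
    have l: "p div n < n" "p mod n < n" if "p < n * n" for p
      using that by (auto simp: less_mult_imp_div_less) (cases "n = 0"; simp)
    show ?thesis unfolding concat_matrix using l by (auto simp: ad concat_map_singleton)
  qed
  finally have 3: "concat (map ?f [Suc n..<Suc n + n * n]) = concat (map (\<lambda>i. map (\<lambda>j. {i, j} \<in> edges G) [0..<n]) [0..<n])" .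
  have "[1..<Suc k] = map Suc [0..<k]" by (simp add: map_Suc_upt)
  then have 4: "concat (map ?f [Suc n + n * n..<Suc n + n * n + k]) = binary k"
    unfolding upt_shift map_map binary_pow2
    by (simp add: comp_def del: upt_Suc)
       (intro arg_cong[where f = concat] map_cong refl, auto simp: outcode_def emit_of_bool[simplified] emit_def odd_iff_mod_2_eq_one)
  show ?thesis unfolding encode_instance_def Let_def G s
    by (simp only: map_append concat_append 1 3 4 list.map concat.simps 2 append_Nil2)
qed

section \<open>The reduction for a fixed verifier, and its computability\<close>

locale reduction = tm T for T +
  fixes pp pt :: "nat poly"
begin

definition qT :: nat where "qT = card tiles"
definition tl :: "nat \<Rightarrow> tile" where "tl = from_nat_into tiles"
definition hcs :: "lr set" where "hcs = lcol ` tiles \<union> rcol ` tiles"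
definition vcs :: "(nat \<times> (nat \<times> bool) list) option set" where "vcs = dcol ` tiles \<union> ucol ` tiles"
definition kT :: nat where "kT = card hcs + card vcs"
definition lfT :: "nat \<Rightarrow> nat" where "lfT v = to_nat_on hcs (lcol (tl v))"
definition rtT :: "nat \<Rightarrow> nat" where "rtT v = to_nat_on hcs (rcol (tl v))"
definition dnT :: "nat \<Rightarrow> nat" where "dnT v = to_nat_on vcs (dcol (tl v))"
definition upT :: "nat \<Rightarrow> nat" where "upT v = to_nat_on vcs (ucol (tl v))"

definition Px :: "bool list \<Rightarrow> nat" where "Px x = poly pp (length x)"
text \<open>The time bound is evaluated at the largest certificate length, so by monotonicity it
  serves every shorter certificate; \<open>Suc\<close> makes it positive, as the tilings
  demand.\<close>

definition Rx :: "bool list \<Rightarrow> nat" where "Rx x = Suc (poly pt (length x + Px x))"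
definition Wx :: "bool list \<Rightarrow> nat" where "Wx x = 2 * Rx x + 2"
definition Nx :: "bool list \<Rightarrow> nat" where "Nx x = Suc (Rx x) * Wx x"
definition Ax :: "bool list \<Rightarrow> nat \<Rightarrow> nat \<Rightarrow> bool" where
  "Ax x z v = okpos x (Px x) (Rx x) (z div Wx x) (z mod Wx x) (tl v)"

lemma bij_tl: "bij_betw tl {..<qT} tiles"
  unfolding tl_def qT_def by (rule bij_betw_from_nat_into_finite[OF finite_tiles])

lemma tl_in: "v < qT \<Longrightarrow> tl v \<in> tiles"
  using bij_tl by (auto simp: bij_betw_def)

lemma finite_cs: "finite hcs" "finite vcs"
  using finite_tiles by (auto simp: hcs_def vcs_def)

lemma to_nat_on_less: "finite X \<Longrightarrow> c \<in> X \<Longrightarrow> to_nat_on X c < card X"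
  using to_nat_on_finite[of X] by (auto simp: bij_betw_def)

lemma to_nat_on_eq: "finite X \<Longrightarrow> c \<in> X \<Longrightarrow> d \<in> X \<Longrightarrow> to_nat_on X c = to_nat_on X d \<longleftrightarrow> c = d"
  by (simp add: countable_finite)

lemma gadget_tiles: "gadget (Nx x) kT qT lfT rtT upT dnT"
proof
  show "0 < Nx x" by (simp add: Nx_def Wx_def)
  show "0 < qT" using finite_tiles tiles_nonempty by (simp add: qT_def card_gt_0_iff)
  fix v assume "v < qT"
  note tl = tl_in[OF this]
  have "lcol (tl v) \<in> hcs" "rcol (tl v) \<in> hcs" "ucol (tl v) \<in> vcs" "dcol (tl v) \<in> vcs"
    using tl by (auto simp: hcs_def vcs_def)
  then show "lfT v < kT" "rtT v < kT" "upT v < kT" "dnT v < kT"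
    using to_nat_on_less[OF finite_cs(1)] to_nat_on_less[OF finite_cs(2)]
    by (auto simp: lfT_def rtT_def upT_def dnT_def kT_def trans_less_add1 trans_less_add2)
qed

text \<open>Cell \<open>z\<close> lies in row \<open>z div Wx x\<close> and column
  \<open>z mod Wx x\<close>; adding 1 or \<open>Wx x\<close> modulo \<open>Nx x\<close> leads to the
  right or upper neighbour, with the helical passage between rows.\<close>

lemma sol_tiling:
  "(\<exists>f. gadget.sol (Nx x) (Wx x) qT lfT rtT upT dnT (Ax x) f) \<longleftrightarrow> (\<exists>g. tiling x (Px x) (Rx x) g)"
proof -
  let ?R = "Rx x" let ?W = "Wx x" let ?N = "Nx x"
  have hz: "rtT v = lfT w \<longleftrightarrow> rcol (tl v) = lcol (tl w)" if "v < qT" "w < qT" for v w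
    unfolding rtT_def lfT_def by (rule to_nat_on_eq[OF finite_cs(1)]) (use tl_in that in \<open>auto simp: hcs_def\<close>)
  have vt: "upT v = dnT w \<longleftrightarrow> ucol (tl v) = dcol (tl w)" if "v < qT" "w < qT" for v w
    unfolding upT_def dnT_def by (rule to_nat_on_eq[OF finite_cs(2)]) (use tl_in that in \<open>auto simp: vcs_def\<close>)
  have W0: "0 < ?W" by (simp add: Wx_def)
  have lt: "t * ?W + i < ?N" if "t \<le> ?R" "i < ?W" for t i
    using that mult_le_mono1[of "Suc t" "Suc ?R" ?W] by (simp only: Nx_def mult_Suc) linarith
  have right: "(t * ?W + i + 1) mod ?N = (if Suc i < ?W then t * ?W + Suc i else if t < ?R then Suc t * ?W + 0 else 0 * ?W + 0)"
    if "t \<le> ?R" "i < ?W" for t i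
  proof (cases "Suc i < ?W")
    case True
    then show ?thesis using lt[OF that(1) True] by simp
  next
    case False
    then have "t * ?W + i + 1 = Suc t * ?W" using that(2) by simp
    moreover have "Suc t * ?W < ?N" if "t < ?R" using lt[of "Suc t" 0] that W0 by simp
    moreover have "Suc t * ?W = ?N" if "\<not> t < ?R" using that \<open>t \<le> ?R\<close> by (simp add: Nx_def)
    ultimately show ?thesis using False by (simp only: if_False) (metis add_0_right mod_less mod_self mult_0)
  qed
  have up: "(t * ?W + i + ?W) mod ?N = (if t < ?R then Suc t * ?W + i else 0 * ?W + i)"
    if "t \<le> ?R" "i < ?W" for t i
  proof (cases "t < ?R")
    case True
    then show ?thesis using lt[of "Suc t" i] that by (simp add: add.commute add.left_commute)
  next
    case False
    then have "t * ?W + i + ?W = ?N + i" using that by (simp add: Nx_def)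
    then have "(t * ?W + i + ?W) mod ?N = i" using lt[of 0 i] that by (metis add_0 le0 mod_add_self1 mod_less mult_0)
    then show ?thesis using False by simp
  qed
  show ?thesis
  proof
    assume "\<exists>f. gadget.sol ?N ?W qT lfT rtT upT dnT (Ax x) f"
    then obtain f where f: "\<forall>z<?N. f z < qT \<and> Ax x z (f z) \<and> rtT (f z) = lfT (f ((z + 1) mod ?N)) \<and>
        upT (f z) = dnT (f ((z + ?W) mod ?N))"
      unfolding gadget.sol_def[OF gadget_tiles] by blast
    define g where "g t i = tl (f (t * ?W + i))" for t i
    have fQ: "f (t * ?W + i) < qT" if "t \<le> ?R" "i < ?W" for t i using f lt[OF that] by blast
    have "tiling x (Px x) ?R g"
      unfolding tiling_def Wx_def[symmetric]
    proof (intro allI impI conjI)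
      fix t i assume ti: "t \<le> ?R" "i < ?W"
      let ?z = "t * ?W + i"
      have z: "f ?z < qT" "Ax x ?z (f ?z)" "rtT (f ?z) = lfT (f ((?z + 1) mod ?N))" "upT (f ?z) = dnT (f ((?z + ?W) mod ?N))"
        using f lt[OF ti] by blast+
      have q: "f ((?z + 1) mod ?N) < qT" "f ((?z + ?W) mod ?N) < qT"
        using f lt[of 0 0] W0 by (simp_all add: Nx_def)
      show "g t i \<in> tiles" using tl_in[OF z(1)] by (simp add: g_def)
      show "okpos x (Px x) ?R t i (g t i)" using z(2) ti by (simp add: g_def Ax_def)
      have "rcol (g t i) = lcol (tl (f ((?z + 1) mod ?N)))" using hz[OF z(1) q(1)] z(3) by (simp add: g_def)
      then show "rcol (g t i) = lcol (if Suc i < ?W then g t (Suc i) else if t < ?R then g (Suc t) 0 else g 0 0)"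
        unfolding right[OF ti] by (auto simp: g_def)
      have "ucol (g t i) = dcol (tl (f ((?z + ?W) mod ?N)))" using vt[OF z(1) q(2)] z(4) by (simp add: g_def)
      then show "ucol (g t i) = dcol (if t < ?R then g (Suc t) i else g 0 i)"
        unfolding up[OF ti] by (auto simp: g_def)
    qed
    then show "\<exists>g. tiling x (Px x) ?R g" by blast
  next
    assume "\<exists>g. tiling x (Px x) ?R g"
    then obtain g where g: "tiling x (Px x) ?R g" by blast
    have gt: "g t i \<in> tiles" "okpos x (Px x) ?R t i (g t i)"
       "rcol (g t i) = lcol (if Suc i < ?W then g t (Suc i) else if t < ?R then g (Suc t) 0 else g 0 0)"
       "ucol (g t i) = dcol (if t < ?R then g (Suc t) i else g 0 i)" if "t \<le> ?R" "i < ?W" for t i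
      using g that unfolding tiling_def Wx_def[symmetric] by blast+
    define f where "f z = inv_into {..<qT} tl (g (z div ?W) (z mod ?W))" for z
    have f: "f (t * ?W + i) < qT \<and> tl (f (t * ?W + i)) = g t i" if "t \<le> ?R" "i < ?W" for t i
    proof -
      have "g t i \<in> tl ` {..<qT}" using gt(1)[OF that] bij_tl by (simp add: bij_betw_def)
      then show ?thesis using inv_into_into[of "g t i" tl "{..<qT}"] f_inv_into_f[of "g t i" tl "{..<qT}"] that
        by (simp add: f_def)
    qed
    have "gadget.sol ?N ?W qT lfT rtT upT dnT (Ax x) f"
      unfolding gadget.sol_def[OF gadget_tiles]
    proof (intro allI impI)
      fix z assume z: "z < ?N"
      define t i where "t = z div ?W" and "i = z mod ?W"
      have ti: "t \<le> ?R" "i < ?W" and zz: "z = t * ?W + i"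
        using z W0 less_mult_imp_div_less[of z "Suc ?R" ?W] by (auto simp: t_def i_def Nx_def)
      have fz: "f z < qT" "tl (f z) = g t i" using f[OF ti] zz by auto
      have r: "f ((z + 1) mod ?N) < qT \<and> tl (f ((z + 1) mod ?N)) = (if Suc i < ?W then g t (Suc i) else if t < ?R then g (Suc t) 0 else g 0 0)"
        using right[OF ti] f[of t "Suc i"] f[of "Suc t" 0] f[of 0 0] ti W0 unfolding zz by auto
      have u: "f ((z + ?W) mod ?N) < qT \<and> tl (f ((z + ?W) mod ?N)) = (if t < ?R then g (Suc t) i else g 0 i)"
        using up[OF ti] f[of "Suc t" i] f[of 0 i] ti unfolding zz by auto
      have "rtT (f z) = lfT (f ((z + 1) mod ?N))" using hz[of "f z"] r fz gt(3)[OF ti] by simp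
      moreover have "upT (f z) = dnT (f ((z + ?W) mod ?N))" using vt[of "f z"] u fz gt(4)[OF ti] by simp
      moreover have "Ax x z (f z)" using gt(2)[OF ti] fz(2) by (simp add: Ax_def t_def i_def)
      ultimately show "f z < qT \<and> Ax x z (f z) \<and> rtT (f z) = lfT (f ((z + 1) mod ?N)) \<and> upT (f z) = dnT (f ((z + ?W) mod ?N))"
        using fz(1) by blast
    qed
    then show "\<exists>f. gadget.sol ?N ?W qT lfT rtT upT dnT (Ax x) f" by blast
  qed
qed

abbreviation "e0 \<equiv> gadget.E0 kT qT"
abbreviation "v0 \<equiv> gadget.V0 kT qT"
abbreviation "c1 \<equiv> gadget.code1 kT qT"
abbreviation "c2 x \<equiv> gadget.code2 (Nx x) (Wx x) kT qT lfT rtT upT dnT (Ax x)"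
abbreviation "adx x \<equiv> gadget.adjn (Nx x) (Wx x) kT qT lfT rtT upT dnT (Ax x)"
abbreviation "grx x \<equiv> gadget.gr (Nx x) (Wx x) kT qT lfT rtT upT dnT (Ax x)"

definition red :: "bool list \<Rightarrow> bool list" where
  "red x = encode_instance (grx x) (Nx x * e0 - Nx x * v0)"

lemma red_correct:
  "red x \<in> even_cycle_transversal_on is_line_graph \<longleftrightarrow>
     (\<exists>u. length u \<le> Px x \<and> fst (run T [x, u] (Rx x)) = accept_state T)"
proof -
  have "valid (red x) \<and> graph (red x) = grx x \<and> kk (red x) = Nx x * e0 - Nx x * v0"
    by (rule encode_parse[OF gadget.gr_simple(1)[OF gadget_tiles] gadget.gr_simple(2)[OF gadget_tiles]]) (simp add: red_def)
  then have "red x \<in> even_cycle_transversal_on is_line_graph \<longleftrightarrow>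
      (\<exists>S. even_cycle_transversal (grx x) S \<and> card S \<le> gadget.n (Nx x) kT qT - Nx x * v0)"
    unfolding ect_on_iff using gadget.gr_line[OF gadget_tiles] by (simp add: gadget.n_def[OF gadget_tiles])
  also have "\<dots> \<longleftrightarrow> (\<exists>g. tiling x (Px x) (Rx x) g)"
    unfolding gadget.gr_iff_sol[OF gadget_tiles] sol_tiling ..
  also have "\<dots> \<longleftrightarrow> (\<exists>u. length u \<le> Px x \<and> fst (run T [x, u] (Rx x)) = accept_state T)"
    using tiling_accept[of x "Px x" "Rx x"] accept_tiling[of _ "Px x" x "Rx x"] by (auto simp: Rx_def)
  finally show ?thesis .
qed

lemma dfun_sizes: "dfun (\<lambda>W s. Px (W 0))" "dfun (\<lambda>W s. Rx (W 0))" "dfun (\<lambda>W s. Wx (W 0))" "dfun (\<lambda>W s. Nx (W 0))"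
  unfolding Nx_def Wx_def Rx_def Px_def by (intro D_intros D_const)+

text \<open>Whether a tile may lie on a cell depends only on five truth values and one symbol.
  Packed into a number together with the tile, they index a table of constant size.\<close>

definition okc :: "nat \<Rightarrow> bool" where
  "okc y = (let c = y div qT in ok (odd c) (odd (c div 2)) (odd (c div 4)) (odd (c div 8)) (odd (c div 16)) (c div 32) (tl (y mod qT)))"

definition flags :: "bool list \<Rightarrow> nat \<Rightarrow> nat" where
  "flags x z = of_bool (z div Wx x = 0) + 2 * of_bool (z mod Wx x = 0) + 4 * of_bool (z mod Wx x < Rx x + 1)
     + 8 * of_bool (z mod Wx x = Rx x + 1) + 16 * of_bool (z mod Wx x - (Rx x + 1) < Px x)
     + 32 * (if z mod Wx x < Rx x + 1 then 0 else word_cells x (int (z mod Wx x - (Rx x + 1))))"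

lemma bits5:
  fixes a b d e g :: bool and s c :: nat
  assumes c_def: "c = of_bool a + 2 * of_bool b + 4 * of_bool d + 8 * of_bool e + 16 * of_bool g + 32 * s"
  shows "odd c = a" "odd (c div 2) = b" "odd (c div 4) = d" "odd (c div 8) = e" "odd (c div 16) = g" "c div 32 = s"
proof -
  have 1: "c = of_bool a + 2 * (of_bool b + 2 * of_bool d + 4 * of_bool e + 8 * of_bool g + 16 * s)"
    unfolding c_def by simp
  have 2: "c div 2 = of_bool b + 2 * (of_bool d + 2 * of_bool e + 4 * of_bool g + 8 * s)"
    unfolding 1 by simp
  have 3: "c div 4 = of_bool d + 2 * (of_bool e + 2 * of_bool g + 4 * s)"
    using arg_cong[OF 2, of "\<lambda>u. u div 2"] by (simp add: div_mult2_eq[symmetric])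
  have 4: "c div 8 = of_bool e + 2 * (of_bool g + 2 * s)"
    using arg_cong[OF 3, of "\<lambda>u. u div 2"] by (simp add: div_mult2_eq[symmetric])
  have 5: "c div 16 = of_bool g + 2 * s"
    using arg_cong[OF 4, of "\<lambda>u. u div 2"] by (simp add: div_mult2_eq[symmetric])
  have o: "odd (of_bool p + 2 * u) = p" for p and u :: nat by simp
  show "odd c = a" unfolding 1 by (rule o)
  show "odd (c div 2) = b" unfolding 2 by (rule o)
  show "odd (c div 4) = d" unfolding 3 by (rule o)
  show "odd (c div 8) = e" unfolding 4 by (rule o)
  show "odd (c div 16) = g" unfolding 5 by (rule o)
  show "c div 32 = s"
    using arg_cong[OF 5, of "\<lambda>u. u div 2"] by (simp add: div_mult2_eq[symmetric])
qed

lemma Ax_okc: "v < qT \<Longrightarrow> Ax x z v \<longleftrightarrow> okc (flags x z * qT + v)"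
  unfolding Ax_def okpos_def okc_def by (simp add: flags_def bits5[OF refl] Let_def)

text \<open>The five truth values contribute at most 31 and the symbol, which is at most 2, at most
  64.\<close>

lemma flags_less: "flags x z < 96"
proof -
  have b: "of_bool p \<le> (1::nat)" for p by simp
  have "(if z mod Wx x < Rx x + 1 then 0 else word_cells x (int (z mod Wx x - (Rx x + 1)))) \<le> 2"
    using word_cells_le by auto
  then show ?thesis unfolding flags_def
    using b[of "z div Wx x = 0"] b[of "z mod Wx x = 0"] b[of "z mod Wx x < Rx x + 1"]
      b[of "z mod Wx x = Rx x + 1"] b[of "z mod Wx x - (Rx x + 1) < Px x"] by linarith
qed

lemma dfun_flags: "dfun F \<Longrightarrow> dfun (\<lambda>W s. flags (W 0) (F W s))"
  unfolding flags_def by (intro D_intros dfun_sizes D_const; assumption)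

lemma dpred_Ax:
  assumes "dfun F" "dfun G" "\<And>W s. G W s < qT"
  shows "dpred (\<lambda>W s. Ax (W 0) (F W s) (G W s))"
proof -
  have "dpred (\<lambda>W s. okc (flags (W 0) (F W s) * qT + G W s))"
  proof (rule DP_table[where c = "96 * qT"])
    show "dfun (\<lambda>W s. flags (W 0) (F W s) * qT + G W s)" by (intro D_intros dfun_flags D_const assms)
    show "flags (W 0) (F W s) * qT + G W s < 96 * qT" for W s
    proof -
      have "Suc (flags (W 0) (F W s)) * qT \<le> 96 * qT"
        by (rule mult_le_mono1) (use flags_less in \<open>simp add: Suc_le_eq\<close>)
      then show ?thesis using assms(3)[of W s] unfolding mult_Suc by linarith
    qed
  qed
  then show ?thesis using Ax_okc[OF assms(3)] by simp
qed

lemma dfun_tabE: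
  assumes "dfun F"
  shows "dfun (\<lambda>W s. Tb (F W s mod e0))"
  using D_table[OF D_mod[OF assms D_const[of e0]], of e0 Tb] gadget.E0_pos[OF gadget_tiles] by simp

lemma dfun_codes:
  assumes F: "dfun F"
  shows "dfun (\<lambda>W s. c1 (F W s))" "dfun (\<lambda>W s. c2 (W 0) (F W s))"
proof -
  show "dfun (\<lambda>W s. c1 (F W s))"
    unfolding gadget.code1_def[OF gadget_tiles] by (rule D_plus[OF D_mult[OF D_div[OF F D_const] D_const] dfun_tabE[OF F]])
  show "dfun (\<lambda>W s. c2 (W 0) (F W s))"
    unfolding gadget.code2_def[OF gadget_tiles]
  proof (intro D_plus D_mult D_mod D_div D_if DP_eq D_const F dfun_sizes)
    show "dpred (\<lambda>W s. Ax (W 0) (F W s div e0) (gadget.TS kT qT (F W s mod e0)))"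
      by (rule dpred_Ax[OF D_div[OF F D_const] dfun_tabE[OF F]])
        (use gadget.TS_less[OF gadget_tiles] gadget.E0_pos[OF gadget_tiles] in simp)
  qed (rule dfun_tabE[OF F])+
qed

lemma dpred_adx:
  assumes "dfun F" "dfun G"
  shows "dpred (\<lambda>W s. adx (W 0) (F W s) (G W s))"
  unfolding gadget.adjn_def[OF gadget_tiles] by (intro DP_conj DP_disj DP_not DP_eq dfun_codes assms)

lemma dpred_pow2:
  assumes "dfun F"
  shows "dpred (\<lambda>W s. pow2 (F W s))"
  unfolding pow2_def by (intro D_intros D_var D_const assms D_weak[OF assms])

lemma red_poly: "poly_time_computable red"
proof -
  define nx where "nx x = Nx x * e0" for x
  define kx where "kx x = nx x - Nx x * v0" for x
  have nD: "dfun (\<lambda>W s. nx (W 0))" unfolding nx_def by (intro D_intros dfun_sizes D_const)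
  have kD: "dfun (\<lambda>W s. kx (W 0))" unfolding kx_def by (intro D_intros nD dfun_sizes D_const)
  have "dfun (\<lambda>W s. Suc (nx (W 0)) + nx (W 0) * nx (W 0) + kx (W 0))" by (intro D_intros nD kD)
  then obtain l where l: "\<And>W s. eval l W s = Suc (nx (W 0)) + nx (W 0) * nx (W 0) + kx (W 0)" using D_ex by blast
  have "dfun (\<lambda>W s. outcode (nx (W 0)) (adx (W 0)) (kx (W 0)) (s 0))"
    unfolding outcode_def by (intro D_intros dpred_adx dpred_pow2 nD kD D_var D_const)
  then obtain e where e: "\<And>W s. eval e W s = outcode (nx (W 0)) (adx (W 0)) (kx (W 0)) (s 0)" using D_ex by blast
  show ?thesis
  proof (rule poly_time_computableI[of _ e l])
    fix x
    have v: "verts (grx x) = {..<nx x}"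
      by (simp add: gadget.gr_def[OF gadget_tiles] gadget.n_def[OF gadget_tiles] nx_def)
    have "red x = concat (map (\<lambda>p. emit (outcode (nx x) (adx x) (kx x) p)) [0..<Suc (nx x) + nx x * nx x + kx x])"
      unfolding red_def kx_def nx_def[symmetric]
    proof (rule encode_concat)
      show "card (verts (grx x)) = nx x" using v by simp
      show "{i, j} \<in> edges (grx x) \<longleftrightarrow> adx x i j" if "i < nx x" "j < nx x" for i j
        by (rule gadget.gr_edge[OF gadget_tiles]) (use that in \<open>simp_all add: gadget.n_def[OF gadget_tiles] nx_def\<close>)
    qed
    then show "red x = concat (map (\<lambda>p. emit (eval e (words [x]) (case_nat p (\<lambda>_. 0)))) [0..<eval l (words [x]) (\<lambda>_. 0)])"
      by (simp add: e l words_def del: upt_Suc)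
  qed
qed

end

lemma ect_NP_hard: "NP_hard (even_cycle_transversal_on is_line_graph)"
  unfolding NP_hard_def
proof
  fix A assume "A \<in> NP"
  then obtain T p where T: "poly_time_machine 2 T"
    and A: "\<And>x. x \<in> A \<longleftrightarrow> (\<exists>u. length u \<le> poly p (length x) \<and> accepts T [x, u])"
    unfolding NP_def by blast
  obtain q where q: "\<And>ws. length ws = 2 \<Longrightarrow> halted T (run T ws (poly q (sum_list (map length ws))))"
    using T unfolding poly_time_machine_def by blast
  have TM: "turing_machine T" "2 \<le> num_tapes T" using T by (auto simp: poly_time_machine_def)
  interpret reduction T p q by unfold_locales (rule TM)+
  have acc: "accepts T [x, u] \<longleftrightarrow> fst (run T [x, u] (Rx x)) = accept_state T" if "length u \<le> Px x" for x u
  proof (rule accepts_iff[OF _ TM(1)])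
    let ?t = "poly q (sum_list (map length [x, u]))"
    have h: "halted T (run T [x, u] ?t)" by (rule q) simp
    have t: "?t \<le> Rx x" unfolding Rx_def using that by (intro le_SucI poly_mono_nat) simp
    show "halted T (run T [x, u] (Rx x))" unfolding halted_run_mono[OF h t] by (rule h)
  qed
  have "x \<in> A \<longleftrightarrow> red x \<in> even_cycle_transversal_on is_line_graph" for x
    unfolding red_correct A Px_def[symmetric] by (intro iff_exI conj_cong refl acc)
  then show "poly_reducible A (even_cycle_transversal_on is_line_graph)"
    unfolding poly_reducible_def using red_poly by blast
qed

theorem theorem8: "NP_complete (even_cycle_transversal_on is_line_graph)"
  unfolding NP_complete_def using ect_NP ect_NP_hard by blast

end
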